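(* Let $c$ be a centre of a unit-ball packing of $\mathbb{R}^4$ at which at most one active neighbour direction fails to be a root direction of the $D_4$ root system $R$. Then the Voronoi cell $V_c$ satisfies $\mathrm{vol}(V_c)\ge 8$, with equality if and only if the active neighbours of $c$ form a copy of $\sqrt2\,R$ centred at $c$. Nothing is assumed about the deviating direction or about the size of its deviation.
   Context: A unit-ball packing of $\mathbb{R}^4$ is given by its centre set $\mathcal{C}\subset\mathbb{R}^4$, with $|c-c'|\ge 2$ for distinct $c,c'\in\mathcal{C}$. The Voronoi cell of $c\in\mathcal{C}$ is $V_c=\{z\in\mathbb{R}^4: |z-c|\le|z-c'|\text{ for all }c'\in\mathcal{C}\}$. The active neighbours of $c$ are the centres $y\in\mathcal{C}\setminus\{c\}$ with $|y-c|<2\sqrt2$; the direction of an active neighbour $y$ is $(y-c)/|y-c|\in S^3$. The $D_4$ root system is $R=\{\pm e_i\pm e_j:1\le i<j\le4\}$ ($24$ vectors of norm $\sqrt2$); a root direction is a unit vector $\alpha/\sqrt2$ with $\alpha\in R$. A copy of $\sqrt2\,R$ centred at $c$ is a set of the form $c+\sqrt2\,O(R)$ with $O$ an orthogonal map. *)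

theory Defs
  imports "HOL-Analysis.Analysis"
begin

definition unit_ball_packing :: "(real^4) set \<Rightarrow> bool" where
  "unit_ball_packing C \<longleftrightarrow> (\<forall>c\<in>C. \<forall>c'\<in>C. c \<noteq> c' \<longrightarrow> norm (c - c') \<ge> 2)"

definition voronoi_cell :: "(real^4) set \<Rightarrow> real^4 \<Rightarrow> (real^4) set" where
  "voronoi_cell C c = {z. \<forall>c'\<in>C. norm (z - c) \<le> norm (z - c')}"

definition active_neighbours :: "(real^4) set \<Rightarrow> real^4 \<Rightarrow> (real^4) set" where
  "active_neighbours C c = {y \<in> C - {c}. norm (y - c) < 2 * sqrt 2}"

definition active_directions :: "(real^4) set \<Rightarrow> real^4 \<Rightarrow> (real^4) set" where
  "active_directions C c = (\<lambda>y. (y - c) /\<^sub>R norm (y - c)) ` active_neighbours C c"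

definition D4_roots :: "(real^4) set" where
  "D4_roots = {s *\<^sub>R axis i 1 + t *\<^sub>R axis j 1 | s t i j.
     s \<in> {1, -1} \<and> t \<in> {1, -1} \<and> i < j}"

definition D4_root_directions :: "(real^4) set" where
  "D4_root_directions = (\<lambda>\<alpha>. \<alpha> /\<^sub>R sqrt 2) ` D4_roots"

definition copy_of_sqrt2_D4_roots :: "real^4 \<Rightarrow> (real^4) set \<Rightarrow> bool" where
  "copy_of_sqrt2_D4_roots c S \<longleftrightarrow>
     (\<exists>T. orthogonal_transformation T \<and> S = (\<lambda>\<alpha>. c + sqrt 2 *\<^sub>R T \<alpha>) ` D4_roots)"

end

(*
  Rotate the D4 roots so that the root directions become the 24 Hurwitz units and move c to the origin. If every
  active direction is a unit w, the cell contains the 24-cell, of volume 8; if moreover 2 w is not a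
  neighbour for some unit w, the cell also contains a piece of a pyramid over the facet with normal w.

  Suppose now that one neighbour at distance 2r has a direction u that is not a unit. By symmetry the unit
  nearest to u is e1, at cosine c. The hyperplane u.x = r cuts a cap off the 24-cell, but the neighbour in direction
  e1 must be missing or pushed out to some distance 2h, because h^2 + r^2 - 2hrc >= 1; so the cell gains a part
  of the pyramid with apex 2 e1 over the facet x1 = 1, kept inside the ball of radius sqrt 2, where inactive
  neighbours do not matter. If c >= 151/200 the direction e1 is free and one may take r = 1: cap plus
  ungained part of the pyramid lie in the cone with apex 2 e1 cut at u.x = 1, whose volume is at most
  (2c-1)^4 / (3 c^2 (2c^2-1)), and this leaves enough of the pyramid volume 1/3. If c < 151/200 the direction u is close
  to a vertex e1 + e2; the cap is then of order m^4 with m = u.(e1 + e2) - r, whereas the pyramid is available up to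
  height of order m.
*)
theory Submission
  imports Defs
begin

section \<open>Volumes of simplices\<close>

text \<open>The facet vertices have norm exactly \<open>sqrt 2\<close>, so just above them the
  pyramid leaves the ball in which inactive neighbours are harmless. These corners, the tips, are
  given up, and the gains used stop at height 13/40. The split at 151/200 has two causes. As c
  decreases to 1/sqrt 2 the cone bound blows up, because the hyperplane can become parallel to an
  edge of the cone; so that bound cannot serve near a vertex direction. Above the split, (151/200) *
  (53/40) > 1, which means that beyond height 13/40 the half-space u.x \<le> 1 keeps at most half of
  the pyramid. The direction u has three free parameters, yet the estimates use little more than its
  cosine. One reason is the inversion of the last three coordinates: it preserves all the regions
  over the facet, and at least one half of each satisfies u.x \<le> c x1. The other is that the cone
  volume, summed over signs, depends only on the squares of the coordinates of u and is largest when
  one coordinate carries the whole deviation.\<close>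

abbreviation vol :: "(real^4) set \<Rightarrow> real" where
  "vol S \<equiv> measure lebesgue S"

lemma det_4:
  "det (A::'a::comm_ring_1^4^4) =
     A$1$1 * (A$2$2*(A$3$3*A$4$4 - A$3$4*A$4$3) - A$2$3*(A$3$2*A$4$4 - A$3$4*A$4$2) + A$2$4*(A$3$2*A$4$3 - A$3$3*A$4$2))
   - A$1$2 * (A$2$1*(A$3$3*A$4$4 - A$3$4*A$4$3) - A$2$3*(A$3$1*A$4$4 - A$3$4*A$4$1) + A$2$4*(A$3$1*A$4$3 - A$3$3*A$4$1))
   + A$1$3 * (A$2$1*(A$3$2*A$4$4 - A$3$4*A$4$2) - A$2$2*(A$3$1*A$4$4 - A$3$4*A$4$1) + A$2$4*(A$3$1*A$4$2 - A$3$2*A$4$1))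
   - A$1$4 * (A$2$1*(A$3$2*A$4$3 - A$3$3*A$4$2) - A$2$2*(A$3$1*A$4$3 - A$3$3*A$4$1) + A$2$3*(A$3$1*A$4$2 - A$3$2*A$4$1))"
proof -
  have f1234: "finite {2::4, 3, 4}" "1 \<notin> {2::4, 3, 4}" by auto
  have f234: "finite {3::4, 4}" "2 \<notin> {3::4, 4}" by auto
  have f34: "finite {4::4}" "3 \<notin> {4::4}" by auto
  show ?thesis
    unfolding det_def UNIV_4
    unfolding sum_over_permutations_insert[OF f1234]
    unfolding sum_over_permutations_insert[OF f234]
    unfolding sum_over_permutations_insert[OF f34]
    unfolding permutes_sing
    by (simp add: sign_swap_id permutation_swap_id sign_compose sign_id permutation_compose swap_id_eq algebra_simps)
qed

lemma vector_4 [simp]: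
  "(vector [w,x,y,z] ::('a::zero)^4)$1 = w"
  "(vector [w,x,y,z] ::('a::zero)^4)$2 = x"
  "(vector [w,x,y,z] ::('a::zero)^4)$3 = y"
  "(vector [w,x,y,z] ::('a::zero)^4)$4 = z"
  unfolding vector_def by simp_all

lemma Basis_cart_eq: "(Basis :: (real^'n) set) = range (\<lambda>i. axis i 1)"
  by (auto simp: Basis_vec_def)

lemma std_simplex_cart:
  "convex hull (insert 0 Basis) = {x::real^'n. (\<forall>i. 0 \<le> x$i) \<and> (\<Sum>i\<in>UNIV. x$i) \<le> 1}"
proof -
  have "(\<Sum>b\<in>Basis. x \<bullet> b) = (\<Sum>i\<in>UNIV. x$i)" for x :: "real^'n"
    unfolding Basis_cart_eq
    by (subst sum.reindex) (auto simp: inj_on_def axis_eq_axis cart_eq_inner_axis)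
  then show ?thesis
    unfolding std_simplex by (auto simp: Basis_cart_eq cart_eq_inner_axis)
qed

text \<open>The regions are cut out by inequalities, not spanned by vertices, so a simplex is given
  as the preimage of the standard simplex, of volume 1/24, under an affine map.\<close>

lemma volume_simplex_4:
  fixes M :: "real^4^4" and b :: "real^4"
  assumes "det M \<noteq> 0"
    and S: "\<And>x. x \<in> S \<longleftrightarrow> (\<forall>i. 0 \<le> (M *v x + b)$i) \<and> (\<Sum>i\<in>UNIV. (M *v x + b)$i) \<le> 1"
  shows "S \<in> lmeasurable" "vol S = 1 / (24 * \<bar>det M\<bar>)"
proof -
  define D where "D = (convex hull (insert 0 Basis) :: (real^4) set)"
  have D: "D = {x. (\<forall>i. 0 \<le> x$i) \<and> (\<Sum>i\<in>UNIV. x$i) \<le> 1}"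
    unfolding D_def by (rule std_simplex_cart)
  have "compact D" unfolding D_def by (simp add: finite_imp_compact_convex_hull)
  then have DL: "D \<in> lmeasurable" by (rule lmeasurable_compact)
  have volD: "vol D = 1 / 24"
  proof -
    have "vol D = measure lborel D" using \<open>compact D\<close> by (simp add: measure_completion compact_imp_closed borel_closed)
    then show ?thesis unfolding D_def content_std_simplex by (simp add: fact_numeral)
  qed
  obtain N where N: "M ** N = mat 1" "N ** M = mat 1"
    using assms(1) invertible_det_nz[of M] unfolding invertible_def by blast
  have SD: "S = (\<lambda>x. - (N *v b) + x) ` ((*v) N ` D)"
  proof (intro set_eqI iffI)
    fix x assume "x \<in> S"
    then have "M *v x + b \<in> D" using S D by simp
    moreover have "x = - (N *v b) + N *v (M *v x + b)"
      by (simp add: matrix_vector_right_distrib matrix_vector_mul_assoc N)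
    ultimately show "x \<in> (\<lambda>x. - (N *v b) + x) ` ((*v) N ` D)" by blast
  next
    fix x assume "x \<in> (\<lambda>x. - (N *v b) + x) ` ((*v) N ` D)"
    then obtain d where d: "d \<in> D" "x = - (N *v b) + N *v d" by blast
    have "M *v x = M *v (N *v d) - M *v (N *v b)"
      unfolding d(2) by (simp add: matrix_vector_mult_diff_distrib flip: diff_conv_add_uminus)
    then have "M *v x + b = d"
      by (simp add: matrix_vector_mul_assoc N)
    with d(1) have "M *v x + b \<in> D" by simp
    then show "x \<in> S" unfolding S D mem_Collect_eq .
  qed
  have NL: "(*v) N ` D \<in> lmeasurable" by (rule measurable_linear_image[OF _ DL]) simp
  then show "S \<in> lmeasurable" unfolding SD by (rule measurable_translation)
  have "vol S = vol ((*v) N ` D)" unfolding SD by (rule measure_translation)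
  also have "\<dots> = \<bar>det N\<bar> / 24"
    using measure_linear_image[of "(*v) N" D] DL volD by simp
  also have "det M * det N = 1" using N(1) by (metis det_I det_mul)
  then have "\<bar>det N\<bar> = 1 / \<bar>det M\<bar>"
    by (metis abs_divide abs_one assms(1) nonzero_eq_divide_eq mult.commute)
  finally show "vol S = 1 / (24 * \<bar>det M\<bar>)" by simp
qed

lemma volume_simplex_rows:
  fixes r1 r2 r3 r4 :: "real^4" and S :: "(real^4) set"
  defines "d \<equiv> det (vector [r1, r2, r3, r4] :: real^4^4)"
  assumes "d \<noteq> 0"
    and S: "\<And>x. x \<in> S \<longleftrightarrow> 0 \<le> r1 \<bullet> x + b1 \<and> 0 \<le> r2 \<bullet> x + b2 \<and> 0 \<le> r3 \<bullet> x + b3 \<and> 0 \<le> r4 \<bullet> x + b4 \<and>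
       (r1 \<bullet> x + b1) + (r2 \<bullet> x + b2) + (r3 \<bullet> x + b3) + (r4 \<bullet> x + b4) \<le> 1"
  shows "S \<in> lmeasurable" "vol S = 1 / (24 * \<bar>d\<bar>)"
proof -
  let ?M = "vector [r1, r2, r3, r4] :: real^4^4" and ?b = "vector [b1, b2, b3, b4] :: real^4"
  have *: "x \<in> S \<longleftrightarrow> (\<forall>i. 0 \<le> (?M *v x + ?b)$i) \<and> (\<Sum>i\<in>UNIV. (?M *v x + ?b)$i) \<le> 1" for x
    unfolding S forall_4 sum_4 by (simp add: matrix_vector_mul_component add.assoc)
  show "S \<in> lmeasurable" "vol S = 1 / (24 * \<bar>d\<bar>)"
    using volume_simplex_4[OF _ *] assms by simp_all
qed

section \<open>Reflections in coordinate hyperplanes\<close>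

definition flip :: "'n \<Rightarrow> real^'n \<Rightarrow> real^'n" where
  "flip i x = (\<chi> j. if j = i then - x$j else x$j)"

lemma flip_nth [simp]: "flip i x $ j = (if j = i then - x$j else x$j)"
  by (simp add: flip_def)

lemma flip_flip [simp]: "flip i (flip i x) = x"
  by (simp add: vec_eq_iff)

lemma orthogonal_transformation_flip: "orthogonal_transformation (flip i)"
  unfolding orthogonal_transformation_def
  by (auto intro!: linearI simp: vec_eq_iff inner_vec_def intro: sum.cong)

lemma negligible_coordinate_hyperplane: "negligible {x::real^'n. x$i = a}"
  using negligible_hyperplane[of "axis i (1::real)" a]
  by (simp add: inner_axis' axis_eq_0_iff)

lemma vol_Un_overlap:
  assumes "A \<in> lmeasurable" "B \<in> lmeasurable" "A \<inter> B \<subseteq> {x. x$i = a}"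
  shows "vol (A \<union> B) = vol A + vol B"
proof -
  have "negligible (A \<inter> B)"
    using negligible_subset[OF negligible_coordinate_hyperplane assms(3)] .
  then show ?thesis
    using assms by (simp add: measure_Un3 negligible_imp_measure0)
qed

lemma vol_half:
  fixes S :: "(real^4) set"
  assumes S: "S \<in> lmeasurable" and sym: "\<And>x. x \<in> S \<Longrightarrow> flip i x \<in> S"
  shows "vol S = 2 * vol (S \<inter> {x. 0 \<le> x$i})"
proof -
  let ?P = "S \<inter> {x. 0 \<le> x$i}"
  have "{x::real^4. 0 \<le> x$i} \<in> sets lebesgue"
    using closed_halfspace_component_ge_cart[of 0 i] by (simp add: borel_closed)
  then have P: "?P \<in> lmeasurable" by (rule fmeasurable_Int_fmeasurable[OF S])
  have F: "flip i ` ?P \<in> lmeasurable"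
    by (rule measurable_orthogonal_image[OF orthogonal_transformation_flip P])
  have "S = ?P \<union> flip i ` ?P"
  proof (intro equalityI subsetI)
    fix x assume x: "x \<in> S"
    show "x \<in> ?P \<union> flip i ` ?P"
    proof (cases "0 \<le> x$i")
      case False
      then have "flip i x \<in> ?P" using sym x by auto
      then have "flip i (flip i x) \<in> flip i ` ?P" by (rule imageI)
      then show ?thesis by simp
    qed (use x in auto)
  qed (use sym in auto)
  then have "vol S = vol (?P \<union> flip i ` ?P)" by simp
  also have "\<dots> = vol ?P + vol (flip i ` ?P)"
    by (rule vol_Un_overlap[OF P F, of i 0]) auto
  also have "vol (flip i ` ?P) = vol ?P"
    by (rule measure_orthogonal_image[OF orthogonal_transformation_flip P])
  finally show ?thesis by simp
qed

section \<open>The 24-cell\<close>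

definition cross_polytope :: "(real^4) set" where
  "cross_polytope = {x. (\<Sum>i\<in>UNIV. \<bar>x$i\<bar>) \<le> 2}"

text \<open>The 24-cell of inradius 1. Its vertices have two entries of absolute value 1 and two
  zeros; its facets are octahedra.\<close>

definition cell24 :: "(real^4) set" where
  "cell24 = {x. (\<forall>i. \<bar>x$i\<bar> \<le> 1) \<and> (\<Sum>i\<in>UNIV. \<bar>x$i\<bar>) \<le> 2}"

text \<open>For \<open>t = 0\<close> the pyramid over the facet \<open>x$1 = 1\<close> with apex
  \<open>(2,0,0,0)\<close>, otherwise its part above height \<open>t\<close>.\<close>

definition pyramid :: "real \<Rightarrow> (real^4) set" where
  "pyramid t = {x. 1 + t \<le> x$1 \<and> (\<Sum>i\<in>UNIV. \<bar>x$i\<bar>) \<le> 2}"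

lemma bounded_cross_polytope: "bounded cross_polytope"
proof -
  have "norm x \<le> 2" if "x \<in> cross_polytope" for x
    using that norm_le_l1_cart[of x] unfolding cross_polytope_def by simp
  then show ?thesis unfolding bounded_iff by blast
qed

lemma lmeasurable_subset_cross_polytope:
  assumes "closed S" "S \<subseteq> cross_polytope"
  shows "S \<in> lmeasurable"
  using assms bounded_cross_polytope bounded_subset compact_eq_bounded_closed lmeasurable_compact by blast

lemma closed_cross_polytope: "closed cross_polytope"
  unfolding cross_polytope_def by (intro closed_Collect_le continuous_intros)

lemma closed_cell24: "closed cell24"
  unfolding cell24_def
  by (intro closed_Collect_conj closed_Collect_all closed_Collect_le continuous_intros)

lemma closed_pyramid: "closed (pyramid t)"
  unfolding pyramid_def by (intro closed_Collect_conj closed_Collect_le continuous_intros)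

lemma closed_ge: "closed {x::real^4. a \<le> x$i}"
  by (intro closed_Collect_le continuous_intros)

lemma lmeasurable_cross_polytope: "cross_polytope \<in> lmeasurable"
  by (simp add: closed_cross_polytope lmeasurable_subset_cross_polytope)

lemma lmeasurable_cell24: "cell24 \<in> lmeasurable"
  by (rule lmeasurable_subset_cross_polytope[OF closed_cell24]) (auto simp: cell24_def cross_polytope_def)

lemma lmeasurable_pyramid: "pyramid t \<in> lmeasurable"
  by (rule lmeasurable_subset_cross_polytope[OF closed_pyramid]) (auto simp: pyramid_def cross_polytope_def)

lemma vol_tail_sign_symmetric:
  assumes S: "S \<in> lmeasurable" and sym: "\<And>x i. x \<in> S \<Longrightarrow> i \<noteq> 1 \<Longrightarrow> flip i x \<in> S"
  shows "vol S = 8 * vol (S \<inter> {x. 0 \<le> x$2 \<and> 0 \<le> x$3 \<and> 0 \<le> x$4})"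
proof -
  have H: "T \<inter> {x::real^4. 0 \<le> x$i} \<in> lmeasurable" if "T \<in> lmeasurable" for T i
    using that closed_ge[of 0 i] by (intro fmeasurable_Int_fmeasurable) (simp_all add: borel_closed)
  let ?T = "S \<inter> {x. 0 \<le> x$2}" and ?U = "S \<inter> {x. 0 \<le> x$2} \<inter> {x. 0 \<le> x$3}"
  have "vol S = 2 * vol ?T" by (rule vol_half[OF S]) (simp add: sym)
  also have "vol ?T = 2 * vol ?U" by (rule vol_half[OF H[OF S]]) (simp add: sym)
  also have "vol ?U = 2 * vol (?U \<inter> {x. 0 \<le> x$4})" by (rule vol_half[OF H[OF H[OF S]]]) (simp add: sym)
  also have "?U \<inter> {x. 0 \<le> x$4} = S \<inter> {x. 0 \<le> x$2 \<and> 0 \<le> x$3 \<and> 0 \<le> x$4}" by auto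
  finally show ?thesis by simp
qed

lemma vol_sign_symmetric:
  assumes S: "S \<in> lmeasurable" and sym: "\<And>x i. x \<in> S \<Longrightarrow> flip i x \<in> S"
  shows "vol S = 16 * vol (S \<inter> {x. \<forall>i. 0 \<le> x$i})"
proof -
  let ?T = "S \<inter> {x. 0 \<le> x$1}"
  have T: "?T \<in> lmeasurable"
    using S closed_ge[of 0 1] by (intro fmeasurable_Int_fmeasurable) (simp_all add: borel_closed)
  have "vol S = 2 * vol ?T" by (rule vol_half[OF S]) (simp add: sym)
  also have "vol ?T = 8 * vol (?T \<inter> {x. 0 \<le> x$2 \<and> 0 \<le> x$3 \<and> 0 \<le> x$4})"
    by (rule vol_tail_sign_symmetric[OF T]) (auto simp: sym)
  also have "?T \<inter> {x. 0 \<le> x$2 \<and> 0 \<le> x$3 \<and> 0 \<le> x$4} = S \<inter> {x. \<forall>i. 0 \<le> x$i}" by (auto simp: forall_4)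
  finally show ?thesis by simp
qed

lemma vol_pyramid:
  assumes "0 \<le> t" "t < 1"
  shows "vol (pyramid t) = (1 - t)^4 / 3"
proof -
  define k where "k = 1 / (1 - t)"
  have k: "k > 0" "k * (1 - t) = 1" using assms by (auto simp: k_def)
  let ?S = "pyramid t \<inter> {x. 0 \<le> x$2 \<and> 0 \<le> x$3 \<and> 0 \<le> x$4}"
  have "vol (pyramid t) = 8 * vol ?S"
    by (rule vol_tail_sign_symmetric[OF lmeasurable_pyramid]) (auto simp: pyramid_def sum_4)
  also have "vol ?S = 1 / (24 * \<bar>det (vector [vector [k,0,0,0], vector [0,k,0,0], vector [0,0,k,0], vector [0,0,0,k]] :: real^4^4)\<bar>)"
  proof (rule volume_simplex_rows(2)[where ?b1.0 = "- (k * (1 + t))" and ?b2.0 = 0 and ?b3.0 = 0 and ?b4.0 = 0])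
    fix x :: "real^4"
    have e: "k * x$1 - k * (1 + t) = k * (x$1 - (1 + t))"
      "k * (x$1 - (1 + t)) + k * x$2 + k * x$3 + k * x$4 \<le> 1 \<longleftrightarrow> k * (x$1 + x$2 + x$3 + x$4 - (1 + t)) \<le> k * (1 - t)"
      using k by (auto simp: algebra_simps)
    show "x \<in> ?S \<longleftrightarrow> 0 \<le> vector [k,0,0,0] \<bullet> x + - (k * (1 + t)) \<and> 0 \<le> vector [0,k,0,0] \<bullet> x + 0 \<and>
      0 \<le> vector [0,0,k,0] \<bullet> x + 0 \<and> 0 \<le> vector [0,0,0,k] \<bullet> x + 0 \<and>
      vector [k,0,0,0] \<bullet> x + - (k * (1 + t)) + (vector [0,k,0,0] \<bullet> x + 0) + (vector [0,0,k,0] \<bullet> x + 0) + (vector [0,0,0,k] \<bullet> x + 0) \<le> 1"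
      using k(1) assms unfolding inner_vec_def sum_4
      by (auto simp: pyramid_def sum_4 e zero_le_mult_iff mult_le_cancel_left)
  qed (use k in \<open>simp add: det_4\<close>)
  also have "\<dots> = (1 - t)^4 / 24"
  proof -
    have "k^4 * (1 - t)^4 = 1" using k by (simp flip: power_mult_distrib)
    then have "1 / k^4 = (1 - t)^4" using k by (simp add: field_simps)
    moreover have "\<bar>det (vector [vector [k,0,0,0], vector [0,k,0,0], vector [0,0,k,0], vector [0,0,0,k]] :: real^4^4)\<bar> = k^4"
      using k by (simp add: det_4 power4_eq_xxxx)
    ultimately show ?thesis by simp
  qed
  finally show ?thesis by simp
qed

lemma vol_cross_polytope: "vol cross_polytope = 32 / 3"
proof -
  let ?S = "cross_polytope \<inter> {x. \<forall>i. 0 \<le> x$i}"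
  have "vol cross_polytope = 16 * vol ?S"
    by (rule vol_sign_symmetric[OF lmeasurable_cross_polytope]) (auto simp: cross_polytope_def sum_4)
  also have "vol ?S = 1 / (24 * \<bar>det (vector [vector [1/2,0,0,0], vector [0,1/2,0,0], vector [0,0,1/2,0], vector [0,0,0,1/2]] :: real^4^4)\<bar>)"
    by (rule volume_simplex_rows(2)[where ?b1.0 = 0 and ?b2.0 = 0 and ?b3.0 = 0 and ?b4.0 = 0])
      (auto simp: det_4 cross_polytope_def forall_4 sum_4 inner_vec_def)
  finally show ?thesis by (simp add: det_4)
qed

text \<open>In the positive orthant the cross-polytope has volume 2/3, and the 24-cell arises from
  it by removing four corner simplices of volume 1/24. Sixteen orthants give
  \<open>16 * (2/3 - 4/24) = 8\<close>.\<close>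

lemma vol_cell24: "vol cell24 = 8"
proof -
  let ?O = "{x::real^4. \<forall>i. 0 \<le> x$i}"
  define T where "T i = {x::real^4. (\<forall>j. 0 \<le> (x - axis i 1)$j) \<and> (\<Sum>j\<in>UNIV. (x - axis i 1)$j) \<le> 1}" for i
  have T: "T i \<in> lmeasurable" "vol (T i) = 1 / 24" for i
    using volume_simplex_4[of "mat 1" "T i" "- axis i 1"] unfolding T_def by simp_all
  have T_eq: "T i = {x. (\<forall>j. 0 \<le> x$j) \<and> 1 \<le> x$i \<and> (\<Sum>j\<in>UNIV. x$j) \<le> 2}" for i
  proof -
    have "(\<forall>j. 0 \<le> (x - axis i 1)$j) \<longleftrightarrow> (\<forall>j. 0 \<le> x$j) \<and> 1 \<le> x$i" (is "?L \<longleftrightarrow> ?R") for x :: "real^4"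
    proof
      assume L: ?L
      have "1 \<le> x$i" using L[rule_format, of i] by (simp add: axis_def)
      moreover have "0 \<le> x$j" if "j \<noteq> i" for j using L[rule_format, of j] that by (simp add: axis_def)
      ultimately show ?R by (metis order_trans zero_le_one)
    qed (auto simp: axis_def)
    moreover have "(\<Sum>j\<in>UNIV. (x - axis i 1)$j) = (\<Sum>j\<in>UNIV. x$j) - 1" for x :: "real^4"
      by (simp add: sum_subtractf axis_def)
    ultimately show ?thesis unfolding T_def by auto
  qed
  have U: "vol (\<Union>i. T i) = 4 / 24"
  proof -
    have "vol (\<Union>i. T i) = (\<Sum>i\<in>UNIV. vol (T i))"
    proof (rule measure_negligible_finite_Union_image)
      show "pairwise (\<lambda>i j. negligible (T i \<inter> T j)) UNIV"
      proof (rule pairwiseI)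
        fix i j :: 4 assume "i \<noteq> j"
        \<comment> \<open>Two coordinates that are at least 1 exhaust the sum 2.\<close>
        have "T i \<inter> T j \<subseteq> {x. x$i = 1}"
        proof
          fix x assume x: "x \<in> T i \<inter> T j"
          have "x$i + x$j = (\<Sum>k\<in>{i,j}. x$k)" using \<open>i \<noteq> j\<close> by simp
          also have "\<dots> \<le> (\<Sum>k\<in>UNIV. x$k)" using x by (intro sum_mono2) (auto simp: T_eq)
          finally show "x \<in> {x. x$i = 1}" using x by (auto simp: T_eq)
        qed
        then show "negligible (T i \<inter> T j)"
          using negligible_subset negligible_coordinate_hyperplane by blast
      qed
    qed (use T in auto)
    then show ?thesis using T by simp
  qed
  have UL: "(\<Union>i. T i) \<in> lmeasurable" using T by (intro fmeasurable.finite_UN) auto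
  have "closed ?O" by (intro closed_Collect_all closed_Collect_le continuous_intros)
  then have PL: "cell24 \<inter> ?O \<in> lmeasurable"
    by (intro fmeasurable_Int_fmeasurable lmeasurable_cell24) (simp add: borel_closed)
  have "vol (cross_polytope \<inter> ?O) = vol (cell24 \<inter> ?O \<union> (\<Union>i. T i))"
  proof -
    have "cross_polytope \<inter> ?O = cell24 \<inter> ?O \<union> (\<Union>i. T i)"
    proof (intro set_eqI iffI)
      fix x assume x: "x \<in> cross_polytope \<inter> ?O"
      have "(\<Sum>i\<in>UNIV. x$i) = (\<Sum>i\<in>UNIV. \<bar>x$i\<bar>)" using x by (intro sum.cong) auto
      also have "\<dots> \<le> 2" using x unfolding cross_polytope_def by blast
      finally have "(\<Sum>i\<in>UNIV. x$i) \<le> 2" .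
      then show "x \<in> cell24 \<inter> ?O \<union> (\<Union>i. T i)"
        using x unfolding cell24_def T_eq cross_polytope_def
        by (cases "\<forall>i. x$i \<le> 1") (auto simp: not_le intro: less_imp_le)
    next
      fix x assume "x \<in> cell24 \<inter> ?O \<union> (\<Union>i. T i)"
      then show "x \<in> cross_polytope \<inter> ?O"
        unfolding cell24_def T_eq cross_polytope_def by auto
    qed
    then show ?thesis by simp
  qed
  also have "\<dots> = vol (cell24 \<inter> ?O) + vol (\<Union>i. T i)"
  proof -
    have "negligible (\<Union>i\<in>UNIV. {x::real^4. x$i = 1})"
      by (intro negligible_Union) (auto intro: negligible_coordinate_hyperplane)
    moreover have "cell24 \<inter> ?O \<inter> (\<Union>i. T i) \<subseteq> (\<Union>i\<in>UNIV. {x. x$i = 1})"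
    proof
      fix x assume x: "x \<in> cell24 \<inter> ?O \<inter> (\<Union>i. T i)"
      then obtain i where "x \<in> T i" by blast
      then have "1 \<le> x$i" by (simp add: T_eq)
      moreover have "\<bar>x$i\<bar> \<le> 1" using x unfolding cell24_def by blast
      ultimately have "x$i = 1" by linarith
      then show "x \<in> (\<Union>i\<in>UNIV. {x. x$i = 1})" by blast
    qed
    ultimately have "negligible (cell24 \<inter> ?O \<inter> (\<Union>i. T i))" by (rule negligible_subset)
    then show ?thesis using PL UL by (simp add: measure_Un3 negligible_imp_measure0)
  qed
  finally have "vol (cross_polytope \<inter> ?O) = vol (cell24 \<inter> ?O) + 4 / 24" using U by simp
  moreover have "vol cross_polytope = 16 * vol (cross_polytope \<inter> ?O)"
    by (rule vol_sign_symmetric[OF lmeasurable_cross_polytope]) (auto simp: cross_polytope_def sum_4)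
  moreover have "vol cell24 = 16 * vol (cell24 \<inter> ?O)"
    by (rule vol_sign_symmetric[OF lmeasurable_cell24]) (auto simp: cell24_def sum_4)
  ultimately show ?thesis using vol_cross_polytope by simp
qed

section \<open>Tips, wedges and cone caps\<close>

definition swap :: "'n::finite \<Rightarrow> 'n \<Rightarrow> real^'n \<Rightarrow> real^'n" where
  "swap i j x = (\<chi> k. x $ Transposition.transpose i j k)"

lemma swap_nth: "swap i j x $ k = x $ Transposition.transpose i j k"
  by (simp add: swap_def)

lemma swap_swap [simp]: "swap i j (swap i j x) = x"
  by (simp add: vec_eq_iff swap_nth)

lemma orthogonal_transformation_swap: "orthogonal_transformation (swap i j :: real^'a \<Rightarrow> real^'a)"
proof -
  have "(\<Sum>k\<in>UNIV. v $ Transposition.transpose i j k * w $ Transposition.transpose i j k) = (\<Sum>k\<in>UNIV. v$k * w$k)"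
    for v w :: "real^'a"
    by (rule sum.reindex_bij_betw) (rule bij_transpose)
  then show ?thesis
    unfolding orthogonal_transformation_def
    by (auto intro!: linearI simp: vec_eq_iff inner_vec_def swap_nth)
qed

text \<open>Near the two base vertices in direction \<open>j\<close> the pyramid leaves the ball of radius \<open>sqrt 2\<close>.\<close>

definition tip :: "4 \<Rightarrow> real \<Rightarrow> (real^4) set" where
  "tip j t = {x. x$1 \<le> 1 + t \<and> 1 - 9/5 * (x$1 - 1) \<le> \<bar>x$j\<bar> \<and> (\<Sum>i\<in>UNIV. \<bar>x$i\<bar>) \<le> 2}"

lemma lmeasurable_tip: "tip j t \<in> lmeasurable"
  by (rule lmeasurable_subset_cross_polytope)
    (auto simp: tip_def cross_polytope_def intro!: closed_Collect_conj closed_Collect_le continuous_intros)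

lemma vol_tip_2:
  assumes t: "0 < t" "t \<le> 1/3"
  shows "vol (tip 2 t) = (4/5)^3 * t^4 / 3"
proof -
  \<comment> \<open>The four slacks used as barycentric coordinates add up to
    \<open>4/5 * (x$1 - 1)\<close>; this factor turns \<open>x$1 \<le> 1 + t\<close> into a sum of
    at most 1.\<close>
  define k where "k = 5 / (4 * t)"
  have k: "k > 0" "k * (4 * t) = 5" using t by (auto simp: k_def)
  let ?S = "tip 2 t \<inter> {x. 0 \<le> x$2 \<and> 0 \<le> x$3 \<and> 0 \<le> x$4}"
  have "vol (tip 2 t) = 8 * vol ?S"
    by (rule vol_tail_sign_symmetric[OF lmeasurable_tip]) (auto simp: tip_def sum_4)
  also have "vol ?S = 1 / (24 * \<bar>det (vector [vector [0,0,k,0], vector [0,0,0,k], vector [-k,-k,-k,-k], vector [9/5*k,k,0,0]] :: real^4^4)\<bar>)"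
  proof (rule volume_simplex_rows(2)[where ?b1.0 = 0 and ?b2.0 = 0 and ?b3.0 = "2 * k" and ?b4.0 = "- (14/5 * k)"])
    fix x :: "real^4"
    have "x \<in> ?S \<longleftrightarrow> 0 \<le> x$3 \<and> 0 \<le> x$4 \<and> 0 \<le> 2 - x$1 - x$2 - x$3 - x$4 \<and> 0 \<le> 9/5 * x$1 + x$2 - 14/5
        \<and> x$3 + x$4 + (2 - x$1 - x$2 - x$3 - x$4) + (9/5 * x$1 + x$2 - 14/5) \<le> 4/5 * t"
      using t by (auto simp: tip_def sum_4 field_simps)
    also have "\<dots> \<longleftrightarrow> 0 \<le> k * (x$3) \<and> 0 \<le> k * x$4 \<and> 0 \<le> k * (2 - x$1 - x$2 - x$3 - x$4) \<and> 0 \<le> k * (9/5 * x$1 + x$2 - 14/5)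
        \<and> k * (x$3 + x$4 + (2 - x$1 - x$2 - x$3 - x$4) + (9/5 * x$1 + x$2 - 14/5)) \<le> k * (4/5 * t)"
      using k(1) by (simp add: zero_le_mult_iff mult_le_cancel_left)
    also have "k * (4/5 * t) = 1" using k by simp
    finally show "x \<in> ?S \<longleftrightarrow> 0 \<le> vector [0,0,k,0] \<bullet> x + 0 \<and> 0 \<le> vector [0,0,0,k] \<bullet> x + 0 \<and>
      0 \<le> vector [-k,-k,-k,-k] \<bullet> x + 2 * k \<and> 0 \<le> vector [9/5*k,k,0,0] \<bullet> x + - (14/5 * k) \<and>
      vector [0,0,k,0] \<bullet> x + 0 + (vector [0,0,0,k] \<bullet> x + 0) + (vector [-k,-k,-k,-k] \<bullet> x + 2 * k) + (vector [9/5*k,k,0,0] \<bullet> x + - (14/5 * k)) \<le> 1"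
      unfolding inner_vec_def sum_4 by (simp add: algebra_simps)
  qed (use k in \<open>simp add: det_4\<close>)
  also have "\<dots> = (4/5)^3 * t^4 / 24"
  proof -
    have "k^4 * (4/5 * t)^4 = 1" using k by (simp flip: power_mult_distrib)
    then have "1 / k^4 = (4/5 * t)^4" using k by (simp add: field_simps)
    moreover have "\<bar>det (vector [vector [0,0,k,0], vector [0,0,0,k], vector [-k,-k,-k,-k], vector [9/5*k,k,0,0]] :: real^4^4)\<bar> = 4/5 * k^4"
      using k by (simp add: det_4 power4_eq_xxxx)
    moreover have "1 / (24 * (4/5 * k^4)) = 5 / 96 * (1 / k^4)" by simp
    ultimately have "1 / (24 * \<bar>det (vector [vector [0,0,k,0], vector [0,0,0,k], vector [-k,-k,-k,-k], vector [9/5*k,k,0,0]] :: real^4^4)\<bar>)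
      = 5 / 96 * (4/5 * t)^4" by metis
    also have "\<dots> = (4/5)^3 * t^4 / 24" by (simp add: power_mult_distrib power_divide)
    finally show ?thesis .
  qed
  finally show ?thesis by simp
qed

lemma swap_2_nth: "j \<noteq> 1 \<Longrightarrow> swap 2 j x $ 1 = x $ 1" for x :: "real^4"
  by (simp add: swap_nth transpose_def)

lemma vol_tip:
  assumes "0 < t" "t \<le> 1/3" "j \<noteq> 1"
  shows "vol (tip j t) = (4/5)^3 * t^4 / 3"
proof -
  have s: "(\<Sum>k\<in>UNIV. \<bar>swap 2 j x $ k\<bar>) = (\<Sum>k\<in>UNIV. \<bar>x$k\<bar>)" for x :: "real^4"
    unfolding swap_nth by (rule sum.reindex_bij_betw) (rule bij_transpose)
  have m: "x \<in> tip 2 t \<longleftrightarrow> swap 2 j x \<in> tip j t" for x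
    using assms(3) by (simp add: tip_def s swap_2_nth) (simp add: swap_nth)
  have "tip j t = swap 2 j ` tip 2 t"
  proof (intro set_eqI iffI)
    fix x assume "x \<in> tip j t"
    then have "swap 2 j x \<in> tip 2 t" using m[of "swap 2 j x"] by simp
    then have "swap 2 j (swap 2 j x) \<in> swap 2 j ` tip 2 t" by (rule imageI)
    then show "x \<in> swap 2 j ` tip 2 t" by simp
  qed (auto simp: m)
  then show ?thesis
    using measure_orthogonal_image[OF orthogonal_transformation_swap lmeasurable_tip] vol_tip_2 assms by simp
qed

lemma vol_tips:
  assumes "0 < t" "t \<le> 1/3"
  shows "(\<Union>j\<in>{2,3,4}. tip j t) \<in> lmeasurable" "vol (\<Union>j\<in>{2,3,4}. tip j t) \<le> (4/5)^3 * t^4"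
proof -
  show "(\<Union>j\<in>{2,3,4}. tip j t) \<in> lmeasurable"
    by (intro fmeasurable.finite_UN) (auto simp: lmeasurable_tip)
  have "vol (\<Union>j\<in>{2,3,4}. tip j t) \<le> (\<Sum>j\<in>{2,3,4}. vol (tip j t))"
    by (rule measure_UNION_le) (auto simp: lmeasurable_tip fmeasurableD)
  also have "\<dots> = (4/5)^3 * t^4" using assms by (simp add: vol_tip)
  finally show "vol (\<Union>j\<in>{2,3,4}. tip j t) \<le> (4/5)^3 * t^4" .
qed

text \<open>The cone of the six facets at the vertex \<open>(1,1,0,0)\<close> of the 24-cell,
  truncated by a hyperplane with intercepts \<open>A\<close> and \<open>B\<close> in the variables
  \<open>1 - x$1\<close> and \<open>1 - x$2\<close>.\<close>

definition wedge :: "real \<Rightarrow> real \<Rightarrow> (real^4) set" where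
  "wedge A B = {x. x$1 \<le> 1 \<and> x$2 \<le> 1 \<and> \<bar>x$3\<bar> + \<bar>x$4\<bar> \<le> 2 - x$1 - x$2 \<and> (1 - x$1) / A + (1 - x$2) / B \<le> 1}"

lemma vol_wedge:
  assumes AB: "0 < A" "A \<le> 1" "0 < B" "B \<le> 1"
  shows "wedge A B \<in> lmeasurable" "vol (wedge A B) \<le> (A^3 * B + A^2 * B^2 + A * B^3) / 6"
proof -
  define \<alpha> \<beta> where "\<alpha> = 1 / A" and "\<beta> = 1 / B"
  have pos: "\<alpha> > 0" "\<beta> > 0" using AB by (auto simp: \<alpha>_def \<beta>_def)
  have closed: "closed (wedge A B)"
    unfolding wedge_def using AB
    by (intro closed_Collect_conj closed_Collect_le continuous_intros) auto
  have "wedge A B \<subseteq> cross_polytope"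
  proof
    fix x assume x: "x \<in> wedge A B"
    have "0 \<le> (1 - x$1) / A" "0 \<le> (1 - x$2) / B" "(1 - x$1) / A + (1 - x$2) / B \<le> 1"
      using x AB by (auto simp: wedge_def)
    then have "(1 - x$1) / A \<le> 1" "(1 - x$2) / B \<le> 1" by linarith+
    then have "1 - x$1 \<le> A" "1 - x$2 \<le> B" using AB by (auto simp: field_simps)
    then show "x \<in> cross_polytope"
      using x AB by (auto simp: wedge_def cross_polytope_def sum_4)
  qed
  then show L: "wedge A B \<in> lmeasurable" using closed by (rule lmeasurable_subset_cross_polytope[rotated])
  have H: "T \<inter> {x::real^4. 0 \<le> x$i} \<in> lmeasurable" if "T \<in> lmeasurable" for T i
    using that closed_ge[of 0 i] by (intro fmeasurable_Int_fmeasurable) (simp_all add: borel_closed)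
  let ?T = "wedge A B \<inter> {x. 0 \<le> x$3}" and ?U = "wedge A B \<inter> {x. 0 \<le> x$3} \<inter> {x. 0 \<le> x$4}"
  have "vol (wedge A B) = 2 * vol ?T" by (rule vol_half[OF L]) (simp add: wedge_def)
  also have "vol ?T = 2 * vol ?U" by (rule vol_half[OF H[OF L]]) (auto simp: wedge_def)
  finally have W: "vol (wedge A B) = 4 * vol ?U" by simp
  \<comment> \<open>With \<open>p = 1 - x$1\<close>, the hyperplanes \<open>x$3 + x$4 = p\<close>
    and \<open>x$3 = p\<close> cut the quarter \<open>?U\<close> into three simplices, one for each
    of the monomials \<open>A^3 * B\<close>, \<open>A^2 * B^2\<close> and
    \<open>A * B^3\<close>.\<close>
  define S1 where "S1 = {x::real^4. 0 \<le> \<alpha> * (1 - x$1 - x$3 - x$4) \<and> 0 \<le> \<alpha> * x$3 \<and> 0 \<le> \<alpha> * x$4 \<and> 0 \<le> \<beta> * (1 - x$2) \<and>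
    \<alpha> * (1 - x$1) + \<beta> * (1 - x$2) \<le> 1}"
  define S2 where "S2 = {x::real^4. 0 \<le> \<alpha> * x$3 \<and> 0 \<le> \<alpha> * (1 - x$1 - x$3) \<and> 0 \<le> \<beta> * (x$1 + x$3 + x$4 - 1) \<and> 0 \<le> \<beta> * (2 - x$1 - x$2 - x$3 - x$4) \<and>
    \<alpha> * (1 - x$1) + \<beta> * (1 - x$2) \<le> 1}"
  define S3 where "S3 = {x::real^4. 0 \<le> \<beta> * (x$1 + x$3 - 1) \<and> 0 \<le> \<alpha> * (1 - x$1) \<and> 0 \<le> \<beta> * x$4 \<and> 0 \<le> \<beta> * (2 - x$1 - x$2 - x$3 - x$4) \<and>
    \<alpha> * (1 - x$1) + \<beta> * (1 - x$2) \<le> 1}"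
  let ?M1 = "vector [vector [-\<alpha>,0,-\<alpha>,-\<alpha>], vector [0,0,\<alpha>,0], vector [0,0,0,\<alpha>], vector [0,-\<beta>,0,0]] :: real^4^4"
  let ?M2 = "vector [vector [0,0,\<alpha>,0], vector [-\<alpha>,0,-\<alpha>,0], vector [\<beta>,0,\<beta>,\<beta>], vector [-\<beta>,-\<beta>,-\<beta>,-\<beta>]] :: real^4^4"
  let ?M3 = "vector [vector [\<beta>,0,\<beta>,0], vector [-\<alpha>,0,0,0], vector [0,0,0,\<beta>], vector [-\<beta>,-\<beta>,-\<beta>,-\<beta>]] :: real^4^4"
  have d1: "\<bar>det ?M1\<bar> = \<alpha>^3 * \<beta>" using pos by (simp add: det_4 power3_eq_cube)
  have d2: "\<bar>det ?M2\<bar> = \<alpha>^2 * \<beta>^2" using pos by (simp add: det_4 power2_eq_square)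
  have d3: "\<bar>det ?M3\<bar> = \<alpha> * \<beta>^3" using pos by (simp add: det_4 power3_eq_cube)
  have n: "det ?M1 \<noteq> 0" "det ?M2 \<noteq> 0" "det ?M3 \<noteq> 0"
    using pos by (auto simp: det_4)
  have S1: "S1 \<in> lmeasurable" "vol S1 = 1 / (24 * \<bar>det ?M1\<bar>)"
    by (rule volume_simplex_rows[where ?b1.0 = \<alpha> and ?b2.0 = 0 and ?b3.0 = 0 and ?b4.0 = \<beta>, OF n(1)];
      simp add: S1_def inner_vec_def sum_4 algebra_simps)+
  have S2: "S2 \<in> lmeasurable" "vol S2 = 1 / (24 * \<bar>det ?M2\<bar>)"
    by (rule volume_simplex_rows[where ?b1.0 = 0 and ?b2.0 = \<alpha> and ?b3.0 = "-\<beta>" and ?b4.0 = "2*\<beta>", OF n(2)];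
      simp add: S2_def inner_vec_def sum_4 algebra_simps)+
  have S3: "S3 \<in> lmeasurable" "vol S3 = 1 / (24 * \<bar>det ?M3\<bar>)"
    by (rule volume_simplex_rows[where ?b1.0 = "-\<beta>" and ?b2.0 = \<alpha> and ?b3.0 = 0 and ?b4.0 = "2*\<beta>", OF n(3)];
      simp add: S3_def inner_vec_def sum_4 algebra_simps)+
  have sub: "?U \<subseteq> S1 \<union> S2 \<union> S3"
  proof
    fix x assume "x \<in> ?U"
    then have x: "x$1 \<le> 1" "x$2 \<le> 1" "x$3 + x$4 \<le> 2 - x$1 - x$2" "0 \<le> x$3" "0 \<le> x$4"
      "\<alpha> * (1 - x$1) + \<beta> * (1 - x$2) \<le> 1"
      by (auto simp: wedge_def \<alpha>_def \<beta>_def)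
    consider "x$3 + x$4 \<le> 1 - x$1" | "x$3 \<le> 1 - x$1" "1 - x$1 \<le> x$3 + x$4" | "1 - x$1 \<le> x$3" by linarith
    then show "x \<in> S1 \<union> S2 \<union> S3"
      using x pos by cases (auto simp: S1_def S2_def S3_def zero_le_mult_iff)
  qed
  have "vol ?U \<le> vol (S1 \<union> S2 \<union> S3)"
    using sub by (rule measure_mono_fmeasurable) (auto intro!: fmeasurableD H L S1 S2 S3 fmeasurable.Un)
  also have "\<dots> \<le> vol S1 + vol S2 + vol S3"
    using measure_Un_le[of "S1 \<union> S2" lebesgue S3] measure_Un_le[of S1 lebesgue S2] S1(1) S2(1) S3(1)
    by (simp add: fmeasurableD fmeasurable.Un)
  also have "\<dots> = (A^3 * B + A^2 * B^2 + A * B^3) / 24"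
    unfolding S1(2) S2(2) S3(2) d1 d2 d3 by (simp add: \<alpha>_def \<beta>_def power_divide add_divide_distrib)
  finally show "vol (wedge A B) \<le> (A^3 * B + A^2 * B^2 + A * B^3) / 6" using W by simp
qed

text \<open>The cone of the pyramid over the facet \<open>x$1 = 1\<close> has apex \<open>(2,0,0,0)\<close>; a half-space cuts it into eight
  simplices, and summing their volumes over all signs factors.\<close>

lemma vol_cone_cap:
  fixes c r u2 u3 u4 :: real
  assumes u: "\<bar>u2\<bar> < c" "\<bar>u3\<bar> < c" "\<bar>u4\<bar> < c" and r: "r < 2 * c"
  defines "S \<equiv> {x::real^4. x$1 + \<bar>x$2\<bar> + \<bar>x$3\<bar> + \<bar>x$4\<bar> \<le> 2 \<and> r \<le> c * x$1 + u2 * x$2 + u3 * x$3 + u4 * x$4}"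
  shows "S \<in> lmeasurable"
    "vol S \<le> (2*c - r)^4 * c^2 / (3 * ((c^2 - u2^2) * (c^2 - u3^2) * (c^2 - u4^2)))"
proof -
  define k where "k = 1 / (2*c - r)"
  have k: "k > 0" "k * (2*c - r) = 1" using r by (auto simp: k_def)
  have c: "c > 0" using u by linarith
  define E where "E = {-1, 1::real}"
  have E: "\<bar>u2\<bar> < c \<Longrightarrow> e \<in> E \<Longrightarrow> 0 < c - e * u2" "e \<in> E \<Longrightarrow> e * e = 1" for e u2 by (auto simp: E_def)
  \<comment> \<open>The weights make the sum of the coordinates equal to \<open>k\<close> times
    \<open>2*c - (c * x$1 + u2 * x$2 + u3 * x$3 + u4 * x$4)\<close>, which is at most 1 exactly on
    the half-space. They are nonzero because each of \<open>u2\<close>, \<open>u3\<close>,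
    \<open>u4\<close> is below \<open>c\<close> in absolute value, that is, because the half-space
    cuts every edge of the cone.\<close>
  define D where "D e2 e3 e4 = {x::real^4. 0 \<le> k*c * (2 - x$1 - e2 * x$2 - e3 * x$3 - e4 * x$4) \<and>
     0 \<le> k*(c - e2*u2)*e2 * x$2 \<and> 0 \<le> k*(c - e3*u3)*e3 * x$3 \<and> 0 \<le> k*(c - e4*u4)*e4 * x$4 \<and>
     k*c * (2 - x$1 - e2 * x$2 - e3 * x$3 - e4 * x$4) + k*(c - e2*u2)*e2 * x$2 + k*(c - e3*u3)*e3 * x$3 + k*(c - e4*u4)*e4 * x$4 \<le> 1}"
    for e2 e3 e4
  have D: "D e2 e3 e4 \<in> lmeasurable"
    "vol (D e2 e3 e4) = (2*c - r)^4 / (24 * c) * (1 / (c - e2*u2) * (1 / (c - e3*u3)) * (1 / (c - e4*u4)))"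
    if e: "e2 \<in> E" "e3 \<in> E" "e4 \<in> E" for e2 e3 e4
  proof -
    have p: "0 < c - e2*u2" "0 < c - e3*u3" "0 < c - e4*u4" using E(1) e u by auto
    have ab: "\<bar>e2\<bar> = 1" "\<bar>e3\<bar> = 1" "\<bar>e4\<bar> = 1" using e by (auto simp: E_def)
    let ?M = "vector [vector [-(k*c), -(k*c*e2), -(k*c*e3), -(k*c*e4)], vector [0, k*(c - e2*u2)*e2, 0, 0],
      vector [0, 0, k*(c - e3*u3)*e3, 0], vector [0, 0, 0, k*(c - e4*u4)*e4]] :: real^4^4"
    have d: "\<bar>det ?M\<bar> = k^4 * (c * ((c - e2*u2) * (c - e3*u3) * (c - e4*u4)))"
    proof -
      have "det ?M = - (k*c * (k*(c - e2*u2)*e2) * (k*(c - e3*u3)*e3) * (k*(c - e4*u4)*e4))"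
        by (simp add: det_4)
      then show ?thesis using ab p k(1) c by (simp add: abs_mult power4_eq_xxxx)
    qed
    have n: "det ?M \<noteq> 0"
    proof
      assume "det ?M = 0"
      with d have "k^4 * (c * ((c - e2*u2) * (c - e3*u3) * (c - e4*u4))) = 0" by simp
      then show False using k c p by simp
    qed
    have "D e2 e3 e4 \<in> lmeasurable \<and> vol (D e2 e3 e4) = 1 / (24 * \<bar>det ?M\<bar>)"
      by (intro conjI volume_simplex_rows[where ?b1.0 = "2*(k*c)" and ?b2.0 = 0 and ?b3.0 = 0 and ?b4.0 = 0, OF n];
        simp add: D_def inner_vec_def sum_4 algebra_simps)
    then show "D e2 e3 e4 \<in> lmeasurable"
      "vol (D e2 e3 e4) = (2*c - r)^4 / (24 * c) * (1 / (c - e2*u2) * (1 / (c - e3*u3)) * (1 / (c - e4*u4)))"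
      unfolding d using k by (auto simp: k_def power_divide)
  qed
  define I where "I = E \<times> E \<times> E"
  have SD: "S \<subseteq> (\<Union>(e2,e3,e4)\<in>I. D e2 e3 e4)"
  proof
    fix x assume x: "x \<in> S"
    define s :: "real \<Rightarrow> real" where "s t = (if 0 \<le> t then 1 else -1)" for t
    have s: "s t \<in> E" "s t * t = \<bar>t\<bar>" for t by (auto simp: s_def E_def)
    let ?a = "s (x$2)" and ?b = "s (x$3)" and ?d = "s (x$4)"
    have nonneg: "0 \<le> k * (c - e*w)*e * y" if "e \<in> E" "\<bar>w\<bar> < c" "e * y = \<bar>y\<bar>" for e w y
    proof -
      have "0 \<le> k * (c - e*w) * \<bar>y\<bar>" using k E(1)[OF that(2,1)] by simp
      then show ?thesis using that(3) by (simp add: mult.assoc)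
    qed
    have split: "k*(c - e*w)*e * y = k * (c * (e * y) - w * y)" if "e \<in> E" for e w y
    proof -
      have "k*(c - e*w)*e * y = k * (c * (e * y) - (e*e) * (w * y))" by (simp add: algebra_simps)
      then show ?thesis using E(2)[OF that] by simp
    qed
    have "k*c * (2 - x$1 - ?a * x$2 - ?b * x$3 - ?d * x$4) + k*(c - ?a*u2)*?a * x$2 + k*(c - ?b*u3)*?b * x$3 + k*(c - ?d*u4)*?d * x$4
      = k * (2 * c - (c * x$1 + u2 * x$2 + u3 * x$3 + u4 * x$4))"
      unfolding split[OF s(1)] by (simp add: algebra_simps)
    also have "\<dots> \<le> k * (2 * c - r)" using x k(1) unfolding S_def by (intro mult_left_mono) auto
    finally have "k*c * (2 - x$1 - ?a * x$2 - ?b * x$3 - ?d * x$4) + k*(c - ?a*u2)*?a * x$2 + k*(c - ?b*u3)*?b * x$3 + k*(c - ?d*u4)*?d * x$4 \<le> 1"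
      using k by simp
    moreover have "0 \<le> k*c * (2 - x$1 - ?a * x$2 - ?b * x$3 - ?d * x$4)"
      using x k(1) c unfolding S_def s(2) by simp
    ultimately have "x \<in> D ?a ?b ?d"
      unfolding D_def using nonneg[OF s(1) u(1) s(2)] nonneg[OF s(1) u(2) s(2)] nonneg[OF s(1) u(3) s(2)] by blast
    then show "x \<in> (\<Union>(e2,e3,e4)\<in>I. D e2 e3 e4)"
      using s(1) unfolding I_def by blast
  qed
  have fin: "finite I" by (simp add: I_def E_def)
  have UL: "(\<Union>(e2,e3,e4)\<in>I. D e2 e3 e4) \<in> lmeasurable"
    by (intro fmeasurable.finite_UN fin) (auto simp: I_def D)
  have "closed S" unfolding S_def by (intro closed_Collect_conj closed_Collect_le continuous_intros)
  then show SL: "S \<in> lmeasurable" using SD UL by (intro fmeasurableI2[OF UL]) (auto simp: borel_closed)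
  have signs: "(\<Sum>e\<in>E. 1 / (c - e*w)) = 2*c / (c^2 - w^2)" if "\<bar>w\<bar> < c" for w
  proof -
    have "c + w \<noteq> 0" "c - w \<noteq> 0" using that by auto
    then show ?thesis
      unfolding square_diff_square_factored power2_eq_square E_def by (simp add: field_simps)
  qed
  have factor: "(\<Sum>a\<in>E. \<Sum>b\<in>E. \<Sum>d\<in>E. K * (f a * g b * h d)) = K * ((\<Sum>a\<in>E. f a) * (\<Sum>b\<in>E. g b) * (\<Sum>d\<in>E. h d))"
    for K and f g h :: "real \<Rightarrow> real"
    by (simp add: E_def algebra_simps)
  have "vol S \<le> vol (\<Union>(e2,e3,e4)\<in>I. D e2 e3 e4)"
    using SD SL UL by (intro measure_mono_fmeasurable) (auto simp: fmeasurableD)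
  also have "\<dots> \<le> (\<Sum>i\<in>I. vol (case i of (e2,e3,e4) \<Rightarrow> D e2 e3 e4))"
    by (intro measure_UNION_le fin) (auto simp: I_def D fmeasurableD)
  also have "\<dots> = (\<Sum>e2\<in>E. \<Sum>e3\<in>E. \<Sum>e4\<in>E. (2*c - r)^4 / (24 * c) * (1 / (c - e2*u2) * (1 / (c - e3*u3)) * (1 / (c - e4*u4))))"
    unfolding I_def sum.cartesian_product by (intro sum.cong) (auto simp: D)
  also have "\<dots> = (2*c - r)^4 / (24 * c) * ((\<Sum>e\<in>E. 1 / (c - e*u2)) * (\<Sum>e\<in>E. 1 / (c - e*u3)) * (\<Sum>e\<in>E. 1 / (c - e*u4)))"
    by (rule factor)
  also have "\<dots> = (2*c - r)^4 / (24 * c) * (2*c / (c^2 - u2^2) * (2*c / (c^2 - u3^2)) * (2*c / (c^2 - u4^2)))"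
    using u by (simp only: signs)
  also have "\<dots> = (2*c - r)^4 * c^2 / (3 * ((c^2 - u2^2) * (c^2 - u3^2) * (c^2 - u4^2)))"
    using c by (simp add: power2_eq_square)
  finally show "vol S \<le> (2*c - r)^4 * c^2 / (3 * ((c^2 - u2^2) * (c^2 - u3^2) * (c^2 - u4^2)))" .
qed

section \<open>Truncated pyramids\<close>

text \<open>The frustum is the part of the pyramid below height \<open>t\<close> with the tips removed; the slope \<open>9/5\<close> keeps it
  inside the ball of radius \<open>sqrt 2\<close> up to height \<open>20/61\<close>.\<close>

definition frustum :: "real \<Rightarrow> (real^4) set" where
  "frustum t = {x. 1 \<le> x$1 \<and> x$1 \<le> 1 + t \<and> (\<Sum>i\<in>UNIV. \<bar>x$i\<bar>) \<le> 2 \<and>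
     \<bar>x$2\<bar> \<le> 1 - 9/5 * (x$1 - 1) \<and> \<bar>x$3\<bar> \<le> 1 - 9/5 * (x$1 - 1) \<and> \<bar>x$4\<bar> \<le> 1 - 9/5 * (x$1 - 1)}"

lemma closed_frustum: "closed (frustum t)"
  unfolding frustum_def by (intro closed_Collect_conj closed_Collect_le continuous_intros)

lemma frustum_subset: "frustum t \<subseteq> cross_polytope"
  by (auto simp: frustum_def cross_polytope_def)

text \<open>The extreme point is \<open>(M, K, 0)\<close>. If a coordinate \<open>x\<close> is at
  least \<open>K\<close>, the other two contribute at most \<open>(M + K - x)^2\<close>, and
  \<open>(x - K) * (M - x) \<ge> 0\<close> finishes; if all are at most \<open>K\<close>, then
  \<open>2 * K^2 \<le> M^2\<close> does.\<close>

lemma sum_squares_truncated: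
  fixes a b d M K :: real
  assumes "0 \<le> a" "0 \<le> b" "0 \<le> d" "a \<le> M" "b \<le> M" "d \<le> M" "a + b + d \<le> M + K" "0 \<le> K" "2 * K^2 \<le> M^2"
  shows "a^2 + b^2 + d^2 \<le> M^2 + K^2"
proof -
  have *: "x^2 + y^2 + z^2 \<le> M^2 + K^2"
    if "0 \<le> x" "0 \<le> y" "0 \<le> z" "x \<le> M" "x + y + z \<le> M + K" "K \<le> x" for x y z
  proof -
    have "y^2 + z^2 \<le> (y + z)^2" using that by (simp add: power2_sum)
    also have "\<dots> \<le> (M + K - x)^2" using that by (intro power_mono) auto
    finally have "x^2 + y^2 + z^2 \<le> x^2 + (M + K - x)^2" by simp
    also have "\<dots> = M^2 + K^2 - 2 * ((x - K) * (M - x))" by (simp add: power2_eq_square algebra_simps)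
    also have "\<dots> \<le> M^2 + K^2" using that by simp
    finally show ?thesis .
  qed
  consider "K \<le> a" | "K \<le> b" | "K \<le> d" | "a \<le> K" "b \<le> K" "d \<le> K" by linarith
  then show ?thesis
  proof cases
    case 1 then show ?thesis using *[of a b d] assms by simp
  next
    case 2 then show ?thesis using *[of b a d] assms by simp
  next
    case 3 then show ?thesis using *[of d a b] assms by simp
  next
    case 4
    then have "a^2 \<le> K^2" "b^2 \<le> K^2" "d^2 \<le> K^2" using assms by (auto intro: power_mono)
    then show ?thesis using assms(9) by linarith
  qed
qed

lemma norm_frustum:
  assumes "x \<in> frustum t" "t \<le> 13/40"
  shows "norm x \<le> sqrt 2"
proof -
  define s where "s = x$1 - 1"
  have s: "0 \<le> s" "s \<le> 13/40" using assms by (auto simp: s_def frustum_def)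
  have K: "2 * (4/5 * s)^2 \<le> (1 - 9/5 * s)^2"
  proof -
    \<comment> \<open>The factor \<open>3/2\<close> stands in for \<open>sqrt 2\<close>; this linear
      inequality holds up to \<open>s = 1/3\<close>.\<close>
    have "3/2 * (4/5 * s) \<le> 1 - 9/5 * s" using s by simp
    then have "(3/2 * (4/5 * s))^2 \<le> (1 - 9/5 * s)^2" using s by (intro power_mono) auto
    moreover have "2 * (4/5 * s)^2 \<le> (3/2 * (4/5 * s))^2" by (simp add: power2_eq_square)
    ultimately show ?thesis by linarith
  qed
  have "\<bar>x$2\<bar>^2 + \<bar>x$3\<bar>^2 + \<bar>x$4\<bar>^2 \<le> (1 - 9/5 * s)^2 + (4/5 * s)^2"
  proof (rule sum_squares_truncated)
    show "\<bar>x$2\<bar> + \<bar>x$3\<bar> + \<bar>x$4\<bar> \<le> 1 - 9/5 * s + 4/5 * s"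
      using assms(1) unfolding frustum_def s_def mem_Collect_eq sum_4 by argo
  qed (use assms(1) s K in \<open>auto simp: frustum_def s_def\<close>)
  moreover have "(x$1)^2 = (1 + s)^2" by (simp add: s_def)
  \<comment> \<open>The last factor vanishes at \<open>s = 20/61\<close>, just above 13/40.\<close>
  moreover have "(1 + s)^2 + ((1 - 9/5 * s)^2 + (4/5 * s)^2) = 2 - s * (8/5 - 122/25 * s)"
    by (simp add: power2_eq_square algebra_simps)
  moreover have "0 \<le> s * (8/5 - 122/25 * s)" using s by (intro mult_nonneg_nonneg) auto
  ultimately have "(x$1)^2 + (x$2)^2 + (x$3)^2 + (x$4)^2 \<le> 2" by simp
  then have "(norm x)^2 \<le> 2"
    unfolding power2_norm_eq_inner inner_vec_def sum_4 by (simp add: power2_eq_square)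
  then show ?thesis by (rule real_le_rsqrt)
qed

lemma lmeasurable_Int_closed:
  assumes "S \<in> lmeasurable" "closed T" shows "S \<inter> T \<in> lmeasurable"
  using assms by (intro fmeasurable_Int_fmeasurable) (simp_all add: borel_closed)

lemma closed_halfspaces:
  "closed {x::real^4. u \<bullet> x \<le> r}" "closed {x::real^4. r \<le> u \<bullet> x}"
  by (intro closed_Collect_le continuous_intros)+

lemma lmeasurable_frustum: "frustum t \<in> lmeasurable"
  by (simp add: closed_frustum frustum_subset lmeasurable_subset_cross_polytope)

text \<open>The inversion of the last three coordinates. It preserves frusta and pyramids and
  negates \<open>tail_inner u\<close> for every \<open>u\<close>, so volumes can be halved without
  knowing the direction of \<open>u\<close>.\<close>

definition turn :: "real^4 \<Rightarrow> real^4" where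
  "turn x = (\<chi> i. if i = 1 then x$i else - x$i)"

lemma turn_nth [simp]: "turn x $ i = (if i = 1 then x$i else - x$i)"
  by (simp add: turn_def)

lemma turn_turn [simp]: "turn (turn x) = x"
  by (simp add: vec_eq_iff)

lemma orthogonal_transformation_turn: "orthogonal_transformation turn"
  unfolding orthogonal_transformation_def
  by (auto intro!: linearI simp: vec_eq_iff inner_vec_def intro: sum.cong)

definition tail_inner :: "real^4 \<Rightarrow> real^4 \<Rightarrow> real" where
  "tail_inner u x = u$2 * x$2 + u$3 * x$3 + u$4 * x$4"

lemma inner_tail: "u \<bullet> x = u$1 * x$1 + tail_inner u x"
  by (simp add: inner_vec_def sum_4 tail_inner_def)

lemma tail_inner_turn: "tail_inner u (turn x) = - tail_inner u x"
  by (simp add: tail_inner_def)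

lemma closed_tail_inner: "closed {x. tail_inner u x \<le> 0}"
  unfolding tail_inner_def by (intro closed_Collect_le continuous_intros)

lemma vol_tail_halfspace:
  assumes S: "S \<in> lmeasurable" and sym: "\<And>x. x \<in> S \<Longrightarrow> turn x \<in> S"
  shows "vol S \<le> 2 * vol (S \<inter> {x. tail_inner u x \<le> 0})"
proof -
  let ?A = "S \<inter> {x. tail_inner u x \<le> 0}"
  have A: "?A \<in> lmeasurable" using S closed_tail_inner by (rule lmeasurable_Int_closed)
  have T: "turn ` ?A \<in> lmeasurable" "vol (turn ` ?A) = vol ?A"
    using measurable_orthogonal_image[OF orthogonal_transformation_turn A]
      measure_orthogonal_image[OF orthogonal_transformation_turn A] by auto
  have "S \<subseteq> ?A \<union> turn ` ?A"
  proof
    fix x assume x: "x \<in> S"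
    show "x \<in> ?A \<union> turn ` ?A"
    proof (cases "tail_inner u x \<le> 0")
      case False
      then have "turn x \<in> ?A" using sym x by (simp add: tail_inner_turn)
      then have "turn (turn x) \<in> turn ` ?A" by (rule imageI)
      then show ?thesis by simp
    qed (use x in simp)
  qed
  then have "vol S \<le> vol (?A \<union> turn ` ?A)"
    using S A T by (intro measure_mono_fmeasurable) (auto intro: fmeasurableD)
  also have "\<dots> \<le> vol ?A + vol (turn ` ?A)" using A T by (intro measure_Un_le) (auto intro: fmeasurableD)
  finally show ?thesis using T by simp
qed

lemma vol_tail_open_halfspace:
  assumes S: "S \<in> lmeasurable" and sym: "\<And>x. x \<in> S \<Longrightarrow> turn x \<in> S"
    and A: "A \<in> lmeasurable" "A \<subseteq> S" "\<And>x. x \<in> A \<Longrightarrow> tail_inner u x < 0"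
  shows "2 * vol A \<le> vol S"
proof -
  have T: "turn ` A \<in> lmeasurable" "vol (turn ` A) = vol A"
    using measurable_orthogonal_image[OF orthogonal_transformation_turn A(1)]
      measure_orthogonal_image[OF orthogonal_transformation_turn A(1)] by auto
  have disj: "A \<inter> turn ` A = {}"
  proof -
    have False if "x \<in> A" "turn x \<in> A" for x
      using A(3)[OF that(1)] A(3)[OF that(2)] by (simp add: tail_inner_turn)
    then show ?thesis by blast
  qed
  have "vol A + vol (turn ` A) = vol (A \<union> turn ` A)"
    using A T disj by (simp add: measure_Un3)
  also have "\<dots> \<le> vol S"
    using A(2) sym S A T by (intro measure_mono_fmeasurable) (auto intro: fmeasurableD)
  finally show ?thesis using T by simp
qed

lemma sum_abs_turn [simp]: "(\<Sum>i\<in>UNIV. \<bar>turn x $ i\<bar>) = (\<Sum>i\<in>UNIV. \<bar>x$i\<bar>)"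
  by (intro sum.cong) auto

lemma turn_frustum: "x \<in> frustum t \<Longrightarrow> turn x \<in> frustum t"
  unfolding frustum_def mem_Collect_eq sum_abs_turn by simp

lemma turn_pyramid: "x \<in> pyramid t \<Longrightarrow> turn x \<in> pyramid t"
  unfolding pyramid_def mem_Collect_eq sum_abs_turn by simp

lemma pyramid_subset: "pyramid 0 \<subseteq> frustum t \<union> pyramid t \<union> (\<Union>j\<in>{2,3,4}. tip j t)"
  by (auto simp: pyramid_def frustum_def tip_def)

lemma vol_frustum:
  assumes "0 < t" "t \<le> 1/3"
  shows "(1 - (1 - t)^4) / 3 - (4/5)^3 * t^4 \<le> vol (frustum t)"
proof -
  note L = lmeasurable_frustum lmeasurable_pyramid vol_tips(1)[OF assms]
  have "vol (pyramid 0) \<le> vol (frustum t \<union> pyramid t \<union> (\<Union>j\<in>{2,3,4}. tip j t))"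
    using L by (intro measure_mono_fmeasurable pyramid_subset) (auto intro: fmeasurableD)
  also have "\<dots> \<le> vol (frustum t) + vol (pyramid t) + vol (\<Union>j\<in>{2,3,4}. tip j t)"
    using measure_Un_le[of "frustum t \<union> pyramid t" lebesgue "\<Union>j\<in>{2,3,4}. tip j t"]
      measure_Un_le[of "frustum t" lebesgue "pyramid t"] L by (auto simp: fmeasurableD)
  finally show ?thesis using vol_pyramid[of 0] vol_pyramid[of t] vol_tips(2)[OF assms] assms by (simp add: diff_divide_distrib)
qed

text \<open>For \<open>u$1 \<ge> 0\<close> this half satisfies
  \<open>u \<bullet> x \<le> u$1 * x$1 \<le> u$1 * (1 + t)\<close>, so it survives the hyperplane
  \<open>u \<bullet> x = r\<close> once \<open>u$1 * (1 + t) \<le> r\<close>.\<close>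

definition half_frustum :: "real^4 \<Rightarrow> real \<Rightarrow> (real^4) set" where
  "half_frustum u t = frustum t \<inter> {x. tail_inner u x \<le> 0}"

lemma lmeasurable_half_frustum: "half_frustum u t \<in> lmeasurable"
  unfolding half_frustum_def by (rule lmeasurable_Int_closed[OF lmeasurable_frustum closed_tail_inner])

lemma vol_half_frustum:
  assumes "0 < t" "t \<le> 1/3"
  shows "(1 - (1 - t)^4) / 6 - 32/125 * t^4 \<le> vol (half_frustum u t)"
  using vol_frustum[OF assms] vol_tail_halfspace[OF lmeasurable_frustum turn_frustum, of t u]
  unfolding half_frustum_def by (simp add: power_divide)

lemma vol_half_frustum_pos:
  assumes "0 < t" "t \<le> 1/3"
  shows "0 < vol (half_frustum u t)"
proof -
  have "t^3 \<le> (1/3)^3" using assms by (intro power_mono) auto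
  then have "t * t^3 \<le> t * (1/3)^3" using assms by (intro mult_left_mono) auto
  then have "t^4 \<le> t / 27" by (simp add: power4_eq_xxxx power3_eq_cube mult.assoc)
  moreover have "(1 - t)^4 \<le> 1 - t" using power_decreasing[of 1 4 "1 - t"] assms by simp
  moreover have "0 < v" if "(1 - a) / 6 - 32/125 * b \<le> v" "b \<le> t / 27" "a \<le> 1 - t" for a b v :: real
    using that assms(1) by argo
  ultimately show ?thesis using vol_half_frustum[OF assms, of u] by blast
qed

text \<open>A measurable part is asked for instead of \<open>8 < vol V\<close>, because a cell may
  have infinite volume and \<open>measure\<close> is then 0.\<close>

definition exceeds_8 :: "(real^4) set \<Rightarrow> bool" where
  "exceeds_8 V \<longleftrightarrow> (\<exists>A\<in>lmeasurable. A \<subseteq> V \<and> 8 < vol A)"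

lemma exceeds_8_Un:
  assumes "A \<in> lmeasurable" "B \<in> lmeasurable" "A \<subseteq> V" "B \<subseteq> V" "A \<inter> B \<subseteq> {x. x$1 = 1}" "8 < vol A + vol B"
  shows "exceeds_8 V"
  unfolding exceeds_8_def
proof (intro bexI conjI)
  show "8 < vol (A \<union> B)" using vol_Un_overlap[OF assms(1,2,5)] assms(6) by simp
qed (use assms in auto)

text \<open>The frustum meets the 24-cell only in the hyperplane \<open>x$1 = 1\<close>, so with the
  24-cell intact any positive height is enough.\<close>

lemma exceeds_8_no_loss:
  assumes "cell24 \<subseteq> V" "0 < t" "t \<le> 1/3" "half_frustum u t \<subseteq> V"
  shows "exceeds_8 V"
proof (rule exceeds_8_Un[OF lmeasurable_cell24 lmeasurable_half_frustum[of u t] assms(1,4)])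
  show "cell24 \<inter> half_frustum u t \<subseteq> {x. x$1 = 1}"
  proof
    fix x assume x: "x \<in> cell24 \<inter> half_frustum u t"
    then have "\<bar>x$1\<bar> \<le> 1" unfolding cell24_def by blast
    then show "x \<in> {x. x$1 = 1}" using x by (simp add: half_frustum_def frustum_def)
  qed
qed (use vol_half_frustum_pos[OF assms(2,3), of u] in \<open>simp add: vol_cell24\<close>)

section \<open>Numerical estimates\<close>

text \<open>The summands stand for the cone cap, the tips and half of the pyramid above height
  13/40. The last two stay below \<open>1/3 - 293/1000\<close>, which leaves 293/1000 for the
  first.\<close>

lemma cap_bound_middle:
  fixes c :: real
  assumes "151/200 \<le> c" "c \<le> 117/125"
  shows "(2*c - 1)^4 / (3 * (c^2 * (2*c^2 - 1))) + (4/5)^3 * (13/40)^4 + (1 - 13/40)^4 / 6 < 1/3"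
proof -
  \<comment> \<open>The quartic \<open>(2*c - 1)^4 - 879/1000 * (c^2 * (2*c^2 - 1))\<close> minus
    its chord over the interval equals \<open>- (c - 151/200) * (117/125 - c) * Q\<close>. The chord
    is negative on the interval, and completing the square shows \<open>Q \<ge> 0\<close>.\<close>
  define Q where "Q = 7121/500 * c^2 - 3958389/500000 * c + 713595921/500000000"
  have "Q = 7121/500 * (c - 3958389/14242000)^2 + (713595921/500000000 - 7121/500 * (3958389/14242000)^2)"
    by (simp add: Q_def power2_eq_square algebra_simps)
  moreover have "0 \<le> 7121/500 * (c - 3958389/14242000)^2" by simp
  ultimately have "0 \<le> Q" by (simp add: power2_eq_square)
  have "(2*c - 1)^4 - 879/1000 * (c^2 * (2*c^2 - 1))
     = (4005040931/500000000000 * c - 107099136307/12500000000000) - (c - 151/200) * (117/125 - c) * Q"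
    unfolding Q_def by (simp add: power2_eq_square power4_eq_xxxx field_simps)
  moreover have "0 \<le> (c - 151/200) * (117/125 - c) * Q" using assms \<open>0 \<le> Q\<close> by simp
  ultimately have "(2*c - 1)^4 < 879/1000 * (c^2 * (2*c^2 - 1))" using assms by linarith
  moreover have "0 < 2*c^2 - 1"
  proof -
    have "(151/200)^2 \<le> c^2" using assms by (intro power_mono) auto
    then show ?thesis by (simp add: power2_eq_square)
  qed
  moreover have "0 < c^2" using assms by simp
  ultimately have "(2*c - 1)^4 / (3 * (c^2 * (2*c^2 - 1))) < 293/1000"
    by (simp add: divide_less_eq)
  moreover have "(4/5)^3 * (13/40)^4 + (1 - 13/40)^4 / 6 < 1/3 - (293/1000 :: real)"
    by (simp add: power_divide)
  ultimately show ?thesis by linarith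
qed

text \<open>With \<open>c\<close> and \<open>s\<close> the cosine and sine of the deviation,
  \<open>t\<close> is a height above which the pyramid has no point with
  \<open>u \<bullet> x \<le> 1\<close>, so no upper part has to be paid for. At
  \<open>c = 117/125\<close> the sine is \<open>44/125\<close> and this height is
  \<open>52/161\<close>, just below 13/40.\<close>

lemma cap_bound_large:
  fixes c s :: real
  assumes c: "117/125 \<le> c" "c < 1" and s: "0 < s" "s^2 = 1 - c^2"
  defines "t \<equiv> (1 - c + s) / (c + s)"
  shows "0 < t" "t \<le> 13/40" "(2*c - 1)^4 / (3 * (c^2 * (2*c^2 - 1))) + (4/5)^3 * t^4 < 1/3"
proof -
  show t0: "0 < t" using c s by (simp add: t_def)
  have cs: "s \<le> c"
  proof (rule power2_le_imp_le)
    have "(117/125)^2 \<le> c^2" using c by (intro power_mono) auto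
    then show "s^2 \<le> c^2" unfolding s by (simp add: power2_eq_square)
  qed (use c in simp)
  \<comment> \<open>This is \<open>t \<le> 13/40\<close> with the denominator cleared.\<close>
  have "27/40 * s \<le> 53/40 * c - 1"
  proof (rule power2_le_imp_le)
    have "(53/40 * (117/125) - 1)^2 \<le> (53/40 * c - 1)^2" using c by (intro power_mono) auto
    moreover have "(117/125)^2 \<le> c^2" using c by (intro power_mono) auto
    moreover have "(27/40 * s)^2 = (27/40)^2 * (1 - c^2)" unfolding power_mult_distrib s ..
    ultimately show "(27/40 * s)^2 \<le> (53/40 * c - 1)^2" by (simp add: power2_eq_square)
  qed (use c in simp)
  then show t1: "t \<le> 13/40" using c s by (simp add: t_def divide_le_eq field_simps)
  \<comment> \<open>The cone quotient tends to 1/3 as \<open>c\<close> tends to 1, so the tips must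
    vanish linearly in \<open>1 - c\<close>. Two of the four factors \<open>t\<close> are therefore
    bounded by \<open>s\<close>, the others by 13/40.\<close>
  have "s * (1 - c) \<le> c * (1 - c)" using cs c by (intro mult_right_mono) auto
  then have "1 - c + s \<le> s * (c + s)" using s(2) by (simp add: power2_eq_square algebra_simps)
  then have ts: "t \<le> s" using c s by (simp add: t_def divide_le_eq)
  have "t^4 = t^2 * t^2" by (simp add: power2_eq_square power4_eq_xxxx)
  also have "\<dots> \<le> (13/40)^2 * s^2" using t0 t1 ts by (intro mult_mono power_mono) auto
  finally have "t^4 \<le> 169/1600 * (1 - c^2)" by (simp add: s(2) power_divide)
  moreover have "0 \<le> 1 - c^2" unfolding s(2)[symmetric] by simp
  ultimately have T: "(4/5)^3 * t^4 \<le> 55/1000 * (1 - c^2)" by (simp add: power_divide)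
  define e where "e = 1 - c"
  have e: "0 < e" "e \<le> 8/125" and ce: "c = 1 - e" using c by (auto simp: e_def)
  have ee: "e * e \<le> 8/125 * e" using e by (intro mult_right_mono) auto
  have pos: "0 < c^2 * (2*c^2 - 1)"
  proof -
    have "(117/125)^2 \<le> c^2" using c by (intro power_mono) auto
    then show ?thesis using c by (intro mult_pos_pos) (simp_all add: power2_eq_square)
  qed
  have "(2*c - 1)^4 = 1 - 8 * e + 24 * (e*e) - 16 * (e*e) * e * (2 - e)"
    unfolding ce by (simp add: power4_eq_xxxx algebra_simps)
  moreover have "0 \<le> 16 * (e*e) * e * (2 - e)" using e by simp
  ultimately have lhs: "(2*c - 1)^4 \<le> 1 - 8 * e + 24 * (e*e)" by linarith
  have "c^2 * (2*c^2 - 1) = 1 - 6 * e + e*e * (11 - 8*e) + 2*(e*e)^2"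
    unfolding ce by (simp add: power2_eq_square algebra_simps)
  moreover have "0 \<le> e*e * (11 - 8*e) + 2*(e*e)^2" using e by simp
  ultimately have r1: "1 - 6 * e \<le> c^2 * (2*c^2 - 1)" by linarith
  have r2: "1 - 33/100 * e \<le> 1 - 165/1000 * (1 - c^2)"
    unfolding ce by (simp add: power2_eq_square algebra_simps)
  have "1 - 8 * e + 24 * (e*e) < (1 - 33/100 * e) * (1 - 6 * e)"
  proof -
    have "(1 - 33/100 * e) * (1 - 6 * e) = 1 - 633/100 * e + 198/100 * (e*e)" by (simp add: field_simps)
    then show ?thesis using e ee by linarith
  qed
  also have "\<dots> \<le> (1 - 165/1000 * (1 - c^2)) * (c^2 * (2*c^2 - 1))"
    using r1 r2 e by (intro mult_mono) auto
  finally have "(2*c - 1)^4 < (1 - 165/1000 * (1 - c^2)) * (c^2 * (2*c^2 - 1))" using lhs by linarith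
  then have "(2*c - 1)^4 / (3 * (c^2 * (2*c^2 - 1))) < (1 - 165/1000 * (1 - c^2)) / 3"
    using pos by (simp add: divide_less_eq)
  then show "(2*c - 1)^4 / (3 * (c^2 * (2*c^2 - 1))) + (4/5)^3 * t^4 < 1/3" using T by argo
qed

text \<open>With \<open>m = 4/3 * t\<close> the left side bounds the loss at a vertex cut to depth
  \<open>m\<close>; the right side bounds the gain, which is linear for small \<open>t\<close>. The
  number \<open>41422/100000\<close> exceeds \<open>sqrt 2 - 1\<close>, the largest possible
  depth.\<close>

lemma wedge_bound:
  fixes t :: real
  assumes "0 < t" "t \<le> 3/4 * (41422/100000)"
  shows "421/100 * (4/3 * t)^4 < (1 - (1 - t)^4) / 6 - 32/125 * t^4"
proof -
  define b :: real where "b = 3/4 * (41422/100000)"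
  have tb: "t \<le> b" using assms by (simp add: b_def)
  have t2: "t^2 \<le> b^2" and t3: "t^3 \<le> b^2 * t"
    using assms tb by (auto intro!: power_mono mult_right_mono simp: power3_eq_cube simp flip: power2_eq_square)
  have "t^3 \<le> b^3" using assms tb by (intro power_mono) auto
  \<comment> \<open>The polynomial is decreasing for \<open>t \<le> 3/4\<close>, so its value at
    \<open>b\<close> decides. Its last coefficient is
    \<open>6 * (421/100 * (256/81) + 32/125)\<close> rounded up, plus 1 from the expansion of
    \<open>(1 - t)^4\<close>.\<close>
  then have "0 < 4 - 6 * t + 4 * t^2 - 8239/100 * t^3"
  proof -
    have "4 * (b - t) * (b + t) \<le> 4 * (b - t) * (3/2)" using tb by (intro mult_left_mono) (auto simp: b_def)
    then have "4 * b^2 - 4 * t^2 \<le> 6 * (b - t)" by (simp add: power2_eq_square algebra_simps)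
    moreover have "0 < 4 - 6 * b + 4 * b^2 - 8239/100 * b^3" by (simp add: b_def power2_eq_square power3_eq_cube)
    ultimately show ?thesis using \<open>t^3 \<le> b^3\<close> by argo
  qed
  then have "0 < t * (4 - 6 * t + 4 * t^2 - 8239/100 * t^3)" using assms by simp
  also have "\<dots> = 4*t - 6 * t^2 + 4 * t^3 - 8239/100 * t^4"
    by (simp add: power2_eq_square power3_eq_cube power4_eq_xxxx algebra_simps)
  finally have "8139/100 * t^4 < 4*t - 6 * t^2 + 4 * t^3 - t^4" by simp
  also have "\<dots> = 1 - (1 - t)^4" by (simp add: power2_eq_square power3_eq_cube power4_eq_xxxx algebra_simps)
  finally have "8139/100 * t^4 < 1 - (1 - t)^4" .
  moreover have aux: "421/100 * (256/81 * q) < (1 - p) / 6 - 32/125 * q" if "0 \<le> q" "8139/100 * q < 1 - p" for p q :: real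
    using that by argo
  ultimately have "421/100 * (256/81 * t^4) < (1 - (1 - t)^4) / 6 - 32/125 * t^4"
    using assms by (intro aux) auto
  moreover have "(4/3 * t)^4 = 256/81 * t^4" unfolding power_mult_distrib by (simp add: power_divide)
  ultimately show ?thesis by (simp only:)
qed

section \<open>The volume balance in a chamber\<close>

text \<open>The region lost behind the hyperplane \<open>u \<bullet> x = 1\<close> and the pyramid volume not gained both lie in
  the cap that \<open>vol_cone_cap\<close> measures.\<close>

lemma cap_balance:
  fixes u :: "real^4" and t :: real
  assumes u: "norm u = 1" "1 < 2 * (u$1)^2" "0 < u$1" and t: "0 < t" "t \<le> 1/3"
    and Q: "(2 * u$1 - 1)^4 / (3 * ((u$1)^2 * (2 * (u$1)^2 - 1))) + (4/5)^3 * t^4 + vol (pyramid t \<inter> {x. u \<bullet> x \<le> 1}) < 1/3"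
  shows "8 < vol (cell24 \<inter> {x. u \<bullet> x \<le> 1}) + vol (frustum t \<inter> {x. u \<bullet> x \<le> 1})"
proof -
  define c where "c = u$1"
  let ?L = "{x::real^4. u \<bullet> x \<le> 1}" and ?G = "{x::real^4. 1 \<le> u \<bullet> x}"
  define K where "K = {x::real^4. x$1 + \<bar>x$2\<bar> + \<bar>x$3\<bar> + \<bar>x$4\<bar> \<le> 2 \<and> 1 \<le> c * x$1 + u$2 * x$2 + u$3 * x$3 + u$4 * x$4}"
  have c: "0 < c" "1 < 2 * c^2" using u by (auto simp: c_def)
  have sq: "c^2 + (u$2)^2 + (u$3)^2 + (u$4)^2 = 1"
  proof -
    have "u \<bullet> u = 1" using u(1) by (simp add: norm_eq_1)
    then show ?thesis by (simp add: inner_vec_def sum_4 c_def power2_eq_square)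
  qed
  have lt2: "(u$2)^2 < c^2" "(u$3)^2 < c^2" "(u$4)^2 < c^2"
    using sq c(2) zero_le_power2[of "u$2"] zero_le_power2[of "u$3"] zero_le_power2[of "u$4"] by linarith+
  then have lt: "\<bar>u$2\<bar> < c" "\<bar>u$3\<bar> < c" "\<bar>u$4\<bar> < c"
    using c(1) by (auto intro: power2_less_imp_less)
  have "1 < 2 * c"
  proof (rule ccontr)
    assume "\<not> 1 < 2 * c"
    then have "c^2 \<le> (1/2)^2" using c by (intro power_mono) auto
    then show False using c by (simp add: power2_eq_square)
  qed
  note K = vol_cone_cap[OF lt this, folded K_def]
  \<comment> \<open>For a fixed sum of squares the product is least when a single coordinate carries
    all of it.\<close>
  have prod: "c^4 * (2*c^2 - 1) \<le> (c^2 - (u$2)^2) * (c^2 - (u$3)^2) * (c^2 - (u$4)^2)"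
  proof -
    define p q w where "p = (u$2)^2" and "q = (u$3)^2" and "w = (u$4)^2"
    have pqw: "0 \<le> p" "0 \<le> q" "0 \<le> w" "p + q + w = 1 - c^2" using sq by (auto simp: p_def q_def w_def)
    have le: "p + q + w \<le> c^2" using pqw c by linarith
    have "(c^2 - p) * (c^2 - q) * (c^2 - w) = c^4 * (c^2 - (p + q + w)) + c^2 * (q*w) + p * q * (c^2 - w) + c^2 * (p * w)"
      by (simp add: power4_eq_xxxx power2_eq_square algebra_simps)
    moreover have "0 \<le> c^2 * (q*w)" "0 \<le> p * q * (c^2 - w)" "0 \<le> c^2 * (p * w)" using pqw le by auto
    ultimately have "c^4 * (c^2 - (p + q + w)) \<le> (c^2 - p) * (c^2 - q) * (c^2 - w)" by linarith
    then show ?thesis using pqw by (simp add: p_def q_def w_def)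
  qed
  have "vol K \<le> (2*c - 1)^4 * c^2 / (3 * ((c^2 - (u$2)^2) * (c^2 - (u$3)^2) * (c^2 - (u$4)^2)))"
    by (rule K(2))
  also have "\<dots> \<le> (2*c - 1)^4 * c^2 / (3 * (c^4 * (2*c^2 - 1)))"
    using prod c lt2 by (intro divide_left_mono mult_nonneg_nonneg mult_left_mono mult_pos_pos) auto
  also have "\<dots> = (2*c - 1)^4 / (3 * (c^2 * (2*c^2 - 1)))"
    using c by (simp add: power4_eq_xxxx power2_eq_square)
  finally have volK: "vol K \<le> (2*c - 1)^4 / (3 * (c^2 * (2*c^2 - 1)))" .
  note cl = closed_halfspaces[where u = u and r = 1]
  note I = lmeasurable_Int_closed
  note m = lmeasurable_cell24 lmeasurable_pyramid lmeasurable_frustum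
  have split: "vol S \<le> vol (S \<inter> ?L) + vol (S \<inter> ?G)" if "S \<in> lmeasurable" for S
  proof -
    have "S = (S \<inter> ?L) \<union> (S \<inter> ?G)" by auto
    moreover have "vol ((S \<inter> ?L) \<union> (S \<inter> ?G)) \<le> vol (S \<inter> ?L) + vol (S \<inter> ?G)"
      using I[OF that cl(1)] I[OF that cl(2)] by (intro measure_Un_le) (auto intro: fmeasurableD)
    ultimately show ?thesis by simp
  qed
  have "vol (cell24 \<inter> ?G) + vol (pyramid 0 \<inter> ?G) = vol ((cell24 \<inter> ?G) \<union> (pyramid 0 \<inter> ?G))"
  proof (rule vol_Un_overlap[symmetric])
    show "cell24 \<inter> ?G \<inter> (pyramid 0 \<inter> ?G) \<subseteq> {x. x$1 = 1}"
    proof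
      fix x assume x: "x \<in> cell24 \<inter> ?G \<inter> (pyramid 0 \<inter> ?G)"
      then have "\<bar>x$1\<bar> \<le> 1" unfolding cell24_def by blast
      then show "x \<in> {x. x$1 = 1}" using x by (simp add: pyramid_def)
    qed
  qed (intro I m cl)+
  also have "\<dots> \<le> vol K"
  proof (rule measure_mono_fmeasurable[OF _ _ K(1)])
    have "cross_polytope \<inter> ?G \<subseteq> K"
      unfolding K_def cross_polytope_def c_def by (auto simp: inner_vec_def sum_4)
    moreover have "cell24 \<subseteq> cross_polytope" "pyramid 0 \<subseteq> cross_polytope"
      unfolding cell24_def pyramid_def cross_polytope_def by blast+
    ultimately show "cell24 \<inter> ?G \<union> pyramid 0 \<inter> ?G \<subseteq> K" by blast
    show "cell24 \<inter> ?G \<union> pyramid 0 \<inter> ?G \<in> sets lebesgue"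
      by (intro fmeasurableD fmeasurable.Un I m cl)
  qed
  finally have lost: "vol (cell24 \<inter> ?G) + vol (pyramid 0 \<inter> ?G) \<le> vol K" .
  have tl: "(\<Union>j\<in>{2,3,4}. tip j t) \<in> lmeasurable" by (rule vol_tips(1)[OF t])
  have "vol (pyramid 0 \<inter> ?L) \<le> vol (frustum t \<inter> ?L \<union> pyramid t \<inter> ?L \<union> (\<Union>j\<in>{2,3,4}. tip j t))"
    using pyramid_subset[of t]
    by (intro measure_mono_fmeasurable fmeasurableD fmeasurable.Un I m cl tl) blast
  also have "\<dots> \<le> vol (frustum t \<inter> ?L) + vol (pyramid t \<inter> ?L) + vol (\<Union>j\<in>{2,3,4}. tip j t)"
    using measure_Un_le[of "frustum t \<inter> ?L \<union> pyramid t \<inter> ?L" lebesgue "\<Union>j\<in>{2,3,4}. tip j t"]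
      measure_Un_le[of "frustum t \<inter> ?L" lebesgue "pyramid t \<inter> ?L"]
      fmeasurableD[OF I[OF m(3) cl(1)]] fmeasurableD[OF I[OF m(2) cl(1)]] fmeasurableD[OF tl]
    by fastforce
  finally have gain: "vol (pyramid 0 \<inter> ?L) \<le> vol (frustum t \<inter> ?L) + vol (pyramid t \<inter> ?L) + (4/5)^3 * t^4"
    using vol_tips(2)[OF t] by linarith
  have "vol (pyramid 0) = 1/3" using vol_pyramid[of 0] by simp
  then show ?thesis
    using split[OF m(1)] split[OF m(2)[of 0]] lost gain volK Q vol_cell24
    unfolding c_def by linarith
qed

text \<open>Hoelder's inequality for the maximum and sum norms; \<open>s\<close> is the Euclidean
  length of the tail of \<open>u\<close> and bounds each of its entries.\<close>

lemma tail_inner_bound: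
  assumes "norm u = 1" "0 \<le> s" "s^2 = 1 - (u$1)^2"
  shows "\<bar>tail_inner u x\<bar> \<le> s * (\<bar>x$2\<bar> + \<bar>x$3\<bar> + \<bar>x$4\<bar>)"
proof -
  have "u \<bullet> u = 1" using assms(1) by (simp add: norm_eq_1)
  then have sq: "s^2 = (u$2)^2 + (u$3)^2 + (u$4)^2"
    unfolding assms(3) by (simp add: inner_vec_def sum_4 power2_eq_square)
  have le: "\<bar>u$2\<bar> \<le> s" "\<bar>u$3\<bar> \<le> s" "\<bar>u$4\<bar> \<le> s"
    by (rule power2_le_imp_le; use assms(2) sq in simp)+
  have "\<bar>tail_inner u x\<bar> \<le> \<bar>u$2\<bar> * \<bar>x$2\<bar> + \<bar>u$3\<bar> * \<bar>x$3\<bar> + \<bar>u$4\<bar> * \<bar>x$4\<bar>"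
    unfolding tail_inner_def abs_mult[symmetric] by linarith
  also have "\<dots> \<le> s * \<bar>x$2\<bar> + s * \<bar>x$3\<bar> + s * \<bar>x$4\<bar>"
    using le by (intro add_mono mult_right_mono) auto
  finally show ?thesis by (simp add: algebra_simps)
qed

lemma cap_gain:
  fixes u :: "real^4"
  assumes u: "norm u = 1" and c: "151/200 \<le> u$1" "u$1 < 1"
  obtains t where "0 < t" "t \<le> 13/40"
    "8 < vol (cell24 \<inter> {x. u \<bullet> x \<le> 1}) + vol (frustum t \<inter> {x. u \<bullet> x \<le> 1})"
proof (cases "u$1 \<le> 117/125")
  case True
  have "(151/200)^2 \<le> (u$1)^2" using c by (intro power_mono) auto
  then have c2: "1 < 2 * (u$1)^2" by (simp add: power2_eq_square)
  have "2 * vol (pyramid (13/40) \<inter> {x. u \<bullet> x \<le> 1}) \<le> vol (pyramid (13/40))"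
  proof (rule vol_tail_open_halfspace[OF lmeasurable_pyramid turn_pyramid])
    fix x assume x: "x \<in> pyramid (13/40) \<inter> {x. u \<bullet> x \<le> 1}"
    \<comment> \<open>The product on the left exceeds 1. Hence a point of this part with
      \<open>u \<bullet> x \<le> 1\<close> has negative tail, and \<open>turn\<close> shows that
      such points fill at most half of it.\<close>
    have "151/200 * (53/40) \<le> u$1 * x$1" using c x by (intro mult_mono) (auto simp: pyramid_def)
    then show "tail_inner u x < 0" using x unfolding inner_tail by simp
  qed (auto intro: lmeasurable_Int_closed[OF lmeasurable_pyramid closed_halfspaces(1)])
  then have "vol (pyramid (13/40) \<inter> {x. u \<bullet> x \<le> 1}) \<le> (1 - 13/40)^4 / 6"
    using vol_pyramid[of "13/40"] by simp
  then have "8 < vol (cell24 \<inter> {x. u \<bullet> x \<le> 1}) + vol (frustum (13/40) \<inter> {x. u \<bullet> x \<le> 1})"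
    using cap_bound_middle[OF c(1) True] c by (intro cap_balance u c2) linarith+
  then show ?thesis using that[of "13/40"] by simp
next
  case False
  define c s where "c = u$1" and "s = sqrt (1 - c^2)"
  have c': "117/125 \<le> c" "c < 1" using False c by (auto simp: c_def)
  have "c^2 < 1" using c' power_strict_mono[of c 1 2] by simp
  then have s: "0 < s" "s^2 = 1 - c^2" by (auto simp: s_def)
  define t where "t = (1 - c + s) / (c + s)"
  note tb = cap_bound_large[OF c' s, folded t_def]
  have "(117/125)^2 \<le> (u$1)^2" using c' by (intro power_mono) (auto simp: c_def)
  then have c2: "1 < 2 * (u$1)^2" by (simp add: power2_eq_square)
  \<comment> \<open>\<open>x$1 = 1 + t\<close> solves \<open>c * x$1 - s * (2 - x$1) = 1\<close>,
    the extreme case of \<open>tail_inner_bound\<close> on the pyramid.\<close>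
  have "pyramid t \<inter> {x. u \<bullet> x \<le> 1} \<subseteq> {x. x$1 = 1 + t}"
  proof
    fix x assume x: "x \<in> pyramid t \<inter> {x. u \<bullet> x \<le> 1}"
    have x1: "1 + t \<le> x$1" and xs: "\<bar>x$2\<bar> + \<bar>x$3\<bar> + \<bar>x$4\<bar> \<le> 2 - x$1"
      using x tb(1) by (auto simp: pyramid_def sum_4)
    have "\<bar>tail_inner u x\<bar> \<le> s * (\<bar>x$2\<bar> + \<bar>x$3\<bar> + \<bar>x$4\<bar>)"
      using s by (intro tail_inner_bound u) (auto simp: c_def)
    also have "\<dots> \<le> s * (2 - x$1)" using xs s by (intro mult_left_mono) auto
    finally have "c * x$1 - s * (2 - x$1) \<le> 1" using x unfolding inner_tail c_def by auto
    moreover have "(c + s) * t = 1 - c + s" using c' s by (simp add: t_def)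
    ultimately have "(c + s) * x$1 \<le> (c + s) * (1 + t)" by (simp add: algebra_simps)
    then show "x \<in> {x. x$1 = 1 + t}" using x1 c' s by simp
  qed
  then have "vol (pyramid t \<inter> {x. u \<bullet> x \<le> 1}) = 0"
    using negligible_subset negligible_coordinate_hyperplane negligible_imp_measure0 by blast
  then have "8 < vol (cell24 \<inter> {x. u \<bullet> x \<le> 1}) + vol (frustum t \<inter> {x. u \<bullet> x \<le> 1})"
    using tb c' by (intro cap_balance u c2) (auto simp: c_def)
  then show ?thesis using that tb by blast
qed

text \<open>\<open>u$1 + u$2 - r\<close> is the depth of the cut at the vertex
  \<open>(1,1,0,0)\<close>. The height is only 3/4 of it: at the full depth,
  \<open>u$1 * (1 + t) \<le> r\<close> would fail for some directions with \<open>u$1\<close> close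
  to 151/200 and \<open>r\<close> close to 1.\<close>

lemma near_vertex_gain:
  fixes u :: "real^4" and r :: real
  assumes u: "norm u = 1" and top: "\<bar>u$2\<bar> + \<bar>u$3\<bar> + \<bar>u$4\<bar> \<le> u$1"
    and ord: "\<bar>u$3\<bar> \<le> u$2" "\<bar>u$4\<bar> \<le> u$2"
    and c: "u$1 < 151/200" and r: "1 \<le> r" "r < u$1 + u$2"
  defines "t \<equiv> 3/4 * (u$1 + u$2 - r)"
  shows "0 < t" "t \<le> 13/40" "u$1 * (1 + t) \<le> r"
    "8 < vol (cell24 \<inter> {x. u \<bullet> x \<le> r}) + vol (half_frustum u t)"
proof -
  define c b w m where "c = u$1" and "b = u$2" and "w = max \<bar>u$3\<bar> \<bar>u$4\<bar>" and "m = c + b - r"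
  have "u \<bullet> u = 1" using u by (simp add: norm_eq_1)
  then have sq: "c^2 + b^2 + (u$3)^2 + (u$4)^2 = 1"
    by (simp add: inner_vec_def sum_4 c_def b_def power2_eq_square)
  have b0: "0 \<le> b" using ord by (simp add: b_def)
  have w: "0 \<le> w" "w \<le> c - b" "w \<le> b" using top ord b0 by (auto simp: w_def c_def b_def)
  have c0: "0 \<le> c" using top by (simp add: c_def)
  have tail2: "(u$3)^2 + (u$4)^2 \<le> (\<bar>u$3\<bar> + \<bar>u$4\<bar>)^2"
    by (simp add: power2_sum)
  have c2: "c^2 \<le> (151/200)^2" using c c0 by (intro power_mono) (auto simp: c_def)
  \<comment> \<open>A crude first bound: the quadratic inequality used for \<open>b2\<close> also
    admits small values of \<open>b\<close>, which are excluded here.\<close>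
  have b1: "569/1000 \<le> b"
  proof -
    have "(u$3)^2 \<le> b * \<bar>u$3\<bar>" "(u$4)^2 \<le> b * \<bar>u$4\<bar>"
      using ord mult_right_mono[of "\<bar>u$3\<bar>" b "\<bar>u$3\<bar>"] mult_right_mono[of "\<bar>u$4\<bar>" b "\<bar>u$4\<bar>"]
      by (auto simp: b_def power2_eq_square)
    then have "1 - c^2 \<le> b * (b + \<bar>u$3\<bar> + \<bar>u$4\<bar>)" using sq by (simp add: algebra_simps power2_eq_square)
    also have "\<dots> \<le> b * c" using top b0 by (intro mult_left_mono) (auto simp: b_def c_def)
    also have "\<dots> \<le> b * (151/200)" using c b0 by (intro mult_left_mono) (auto simp: c_def)
    finally show ?thesis using c2 by (simp add: power2_eq_square)
  qed
  have b2: "646/1000 \<le> b"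
  proof (rule ccontr)
    assume "\<not> 646/1000 \<le> b"
    then have "0 \<le> (b - 569/1000) * (646/1000 - b)" using b1 by simp
    \<comment> \<open>The chord of the square over \<open>[569/1000, 646/1000]\<close>.\<close>
    then have bb: "b^2 \<le> (569/1000 + 646/1000) * b - 569/1000 * (646/1000)"
      by (simp add: power2_eq_square field_simps)
    have "(\<bar>u$3\<bar> + \<bar>u$4\<bar>)^2 \<le> (c - b)^2" using top b0 by (intro power_mono) (auto simp: b_def c_def)
    then have "1 \<le> c^2 + b^2 + (c - b)^2" using sq tail2 by linarith
    also have "\<dots> = 2 * b^2 + 2 * (c * (c - b))" by (simp add: power2_eq_square algebra_simps)
    finally have "1 \<le> 2 * b^2 + 2 * (c * (c - b))" .
    moreover have "c * (c - b) \<le> 151/200 * (151/200 - b)"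
      using c c0 w by (intro mult_mono) (auto simp: c_def)
    ultimately show False using bb b1 \<open>\<not> 646/1000 \<le> b\<close> by argo
  qed
  have c7: "7/10 \<le> c"
  proof (rule power2_le_imp_le)
    have "b^2 + ((u$3)^2 + (u$4)^2) \<le> b^2 + (\<bar>u$3\<bar> + \<bar>u$4\<bar>)^2" using tail2 by simp
    also have "\<dots> \<le> (b + (\<bar>u$3\<bar> + \<bar>u$4\<bar>))^2" using b0 by (simp add: power2_sum)
    also have "\<dots> \<le> c^2" using top b0 by (intro power_mono) (auto simp: b_def c_def)
    finally have "1 \<le> 2 * c^2" using sq by linarith
    then show "(7/10)^2 \<le> c^2" by (simp add: power2_eq_square)
  qed (rule c0)
  have cb: "c + b \<le> 141422/100000"
  proof (rule power2_le_imp_le)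
    have "(c + b)^2 + (c - b)^2 = 2 * (c^2 + b^2)" by (simp add: power2_eq_square algebra_simps)
    moreover have "0 \<le> (c - b)^2" "c^2 + b^2 \<le> 1" using sq zero_le_power2[of "u$3"] zero_le_power2[of "u$4"] by (simp, linarith)
    ultimately have "(c + b)^2 \<le> 2" by argo
    then show "(c + b)^2 \<le> (141422/100000)^2" by (simp add: power2_eq_square)
  qed simp
  have m: "0 < m" "m \<le> 41422/100000" using r cb by (auto simp: m_def c_def b_def)
  have tm: "t = 3/4 * m" by (simp add: t_def m_def c_def b_def)
  show t: "0 < t" "t \<le> 13/40" using m by (auto simp: tm)
  show "u$1 * (1 + t) \<le> r"
  proof -
    have bs: "b^2 \<le> 1 - c^2" using sq zero_le_power2[of "u$3"] zero_le_power2[of "u$4"] by linarith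
    \<comment> \<open>The worst case is \<open>r = 1\<close>, where the claim reads
      \<open>(c + b - 1) * (1 + 3/4 * c) \<le> b\<close>; this is the same inequality. Squaring
      brings in \<open>b^2 \<le> 1 - c^2\<close>, and a factor \<open>1 - c\<close> splits
      off.\<close>
    have "3/4 * c * b \<le> (1 - c) * (1 + 3/4 * c)"
    proof (rule power2_le_imp_le)
      have "(3/4 * c * b)^2 \<le> (3/4 * c)^2 * (1 - c^2)"
        using bs unfolding power_mult_distrib[of "3/4*c"] by (intro mult_left_mono) auto
      also have "\<dots> = (1 - c) * (9/16 * (c^2 * (1 + c)))" by (simp add: power2_eq_square field_simps)
      also have "\<dots> \<le> (1 - c) * ((1 - c) * (1 + 3/4 * c)^2)"
      proof (intro mult_left_mono)
        have "c^2 * (1 + c) \<le> (151/200)^2 * (1 + 151/200)" using c c0 c2 by (intro mult_mono) (auto simp: c_def)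
        moreover have "(1 - 151/200) * (1 + 3/2 * c + 9/16 * c^2) \<le> (1 - c) * (1 + 3/4 * c)^2"
        proof -
          have "(1 + 3/4 * c)^2 = 1 + 3/2 * c + 9/16 * c^2" by (simp add: power2_eq_square algebra_simps)
          moreover have "(1 - 151/200) * (1 + 3/4 * c)^2 \<le> (1 - c) * (1 + 3/4 * c)^2"
            using c by (intro mult_right_mono) (auto simp: c_def)
          ultimately show ?thesis by (simp only:)
        qed
        moreover note c7
        moreover have "(7/10)^2 \<le> c^2" using c7 by (intro power_mono) auto
        ultimately show "9/16 * (c^2 * (1 + c)) \<le> (1 - c) * (1 + 3/4 * c)^2"
          by (simp add: power2_eq_square)
      qed (use c in \<open>simp add: c_def\<close>)
      also have "\<dots> = ((1 - c) * (1 + 3/4 * c))^2" by (simp only: power_mult_distrib power2_eq_square mult_ac)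
      finally show "(3/4 * c * b)^2 \<le> ((1 - c) * (1 + 3/4 * c))^2" .
    qed (use c c0 in \<open>simp add: c_def\<close>)
    moreover have "m * (1 + 3/4 * c) \<le> (c + b - 1) * (1 + 3/4 * c)"
      using r c0 by (intro mult_right_mono) (auto simp: m_def)
    moreover have "(c + b - 1) * (1 + 3/4 * c) = b + 3/4 * c * b - (1 - c) * (1 + 3/4 * c)"
      by (simp add: field_simps)
    ultimately have "m * (1 + 3/4 * c) \<le> b" by linarith
    then show ?thesis unfolding tm c_def[symmetric] by (simp add: m_def algebra_simps)
  qed
  \<comment> \<open>On the cap \<open>(c - w) * (1 - x$1) + (b - w) * (1 - x$2) \<le> m\<close>, and
    \<open>w \<le> c - b\<close> bounds the two weights from below by \<open>b\<close> and
    \<open>2*b - c\<close>.\<close>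
  define A B where "A = m / b" and "B = m / (2*b - c)"
  have d: "537/1000 \<le> 2*b - c" using b2 c by (simp add: c_def)
  \<comment> \<open>The constants are \<open>1/0.646\<close> and \<open>1/0.537\<close> rounded up;
    in the volume of the wedge they lead to the \<open>421/100\<close> of
    \<open>wedge_bound\<close>.\<close>
  have "m * 1 \<le> m * (1548/1000 * b)" "m * 1 \<le> m * (1863/1000 * (2*b - c))"
    using m b2 d by (auto intro!: mult_left_mono)
  then have AB: "0 < A" "A \<le> 1548/1000 * m" "0 < B" "B \<le> 1863/1000 * m"
    using m b2 d by (simp_all add: A_def B_def divide_le_eq mult.assoc mult.left_commute)
  have AB1: "A \<le> 1" "B \<le> 1" using AB m by auto
  have sub: "cell24 \<inter> {x. r \<le> u \<bullet> x} \<subseteq> wedge A B"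
  proof
    fix x assume x: "x \<in> cell24 \<inter> {x. r \<le> u \<bullet> x}"
    then have "\<bar>x$1\<bar> \<le> 1" "\<bar>x$2\<bar> \<le> 1" "\<bar>x$1\<bar> + \<bar>x$2\<bar> + \<bar>x$3\<bar> + \<bar>x$4\<bar> \<le> 2"
      unfolding cell24_def sum_4 by blast+
    then have x1: "0 \<le> 1 - x$1" "0 \<le> 1 - x$2" "\<bar>x$3\<bar> + \<bar>x$4\<bar> \<le> (1 - x$1) + (1 - x$2)" by auto
    have "u$3 * x$3 + u$4 * x$4 \<le> \<bar>u$3\<bar> * \<bar>x$3\<bar> + \<bar>u$4\<bar> * \<bar>x$4\<bar>"
      unfolding abs_mult[symmetric] by linarith
    also have "\<dots> \<le> w * \<bar>x$3\<bar> + w * \<bar>x$4\<bar>" by (intro add_mono mult_right_mono) (auto simp: w_def)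
    also have "\<dots> = w * (\<bar>x$3\<bar> + \<bar>x$4\<bar>)" by (simp add: algebra_simps)
    also have "\<dots> \<le> w * ((1 - x$1) + (1 - x$2))" using x1 w by (intro mult_left_mono) auto
    finally have "r \<le> c * x$1 + b * x$2 + w * ((1 - x$1) + (1 - x$2))"
      using x by (simp add: inner_vec_def sum_4 c_def b_def)
    then have "(c - w) * (1 - x$1) + (b - w) * (1 - x$2) \<le> m" by (simp add: m_def algebra_simps)
    moreover have "b * (1 - x$1) \<le> (c - w) * (1 - x$1)" "(2*b - c) * (1 - x$2) \<le> (b - w) * (1 - x$2)"
      using x1 w by (auto intro!: mult_right_mono)
    ultimately have "(1 - x$1) * b + (1 - x$2) * (2*b - c) \<le> m" by (simp add: algebra_simps)
    then have "((1 - x$1) * b + (1 - x$2) * (2*b - c)) / m \<le> 1" using m by simp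
    then have "(1 - x$1) / A + (1 - x$2) / B \<le> 1"
      unfolding A_def B_def by (simp add: add_divide_distrib)
    then show "x \<in> wedge A B" using x1 by (simp add: wedge_def)
  qed
  note W = vol_wedge[OF AB(1) AB1(1) AB(3) AB1(2)]
  note cl = closed_halfspaces[where u = u and r = r]
  note I = lmeasurable_Int_closed[OF lmeasurable_cell24]
  have "vol cell24 \<le> vol ((cell24 \<inter> {x. u \<bullet> x \<le> r}) \<union> wedge A B)"
    using sub by (intro measure_mono_fmeasurable fmeasurableD fmeasurable.Un I cl W lmeasurable_cell24) auto
  also have "\<dots> \<le> vol (cell24 \<inter> {x. u \<bullet> x \<le> r}) + vol (wedge A B)"
    by (intro measure_Un_le fmeasurableD I cl W)
  finally have "8 \<le> vol (cell24 \<inter> {x. u \<bullet> x \<le> r}) + vol (wedge A B)" by (simp add: vol_cell24)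
  moreover have "vol (wedge A B) \<le> 421/100 * (4/3 * t)^4"
  proof -
    have "A^3 * B + A^2 * B^2 + A * B^3 \<le>
      (1548/1000 * m)^3 * (1863/1000 * m) + (1548/1000 * m)^2 * (1863/1000 * m)^2 + (1548/1000 * m) * (1863/1000 * m)^3"
      using AB m by (intro add_mono mult_mono power_mono) auto
    also have "\<dots> = ((1548/1000)^3 * (1863/1000) + (1548/1000)^2 * (1863/1000)^2 + 1548/1000 * (1863/1000)^3) * m^4"
      by (simp add: power2_eq_square power3_eq_cube power4_eq_xxxx algebra_simps)
    also have "\<dots> \<le> 6 * (421/100) * m^4"
      using m by (intro mult_right_mono) (auto simp: power2_eq_square power3_eq_cube)
    also have "m^4 = (4/3 * t)^4" by (simp add: tm)
    finally show ?thesis using W(2) by argo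
  qed
  moreover have "421/100 * (4/3 * t)^4 < (1 - (1 - t)^4) / 6 - 32/125 * t^4"
    using m by (intro wedge_bound) (auto simp: tm)
  moreover have "(1 - (1 - t)^4) / 6 - 32/125 * t^4 \<le> vol (half_frustum u t)"
    using t by (intro vol_half_frustum) auto
  ultimately show "8 < vol (cell24 \<inter> {x. u \<bullet> x \<le> r}) + vol (half_frustum u t)" by linarith
qed

text \<open>Two centres in directions at angle \<open>arccos c\<close> and at distances \<open>2 * h\<close>, \<open>2 * r\<close> satisfy
  \<open>h^2 + r^2 - 2 * h * r * c \<ge> 1\<close>; this set of pairs \<open>(h, r)\<close> avoids a triangle by convexity.\<close>

lemma packing_triangle:
  fixes c h r M :: real
  assumes "1 \<le> h" "1 \<le> r" "c \<le> 1" "0 \<le> c" "M \<le> 2 * c" "h + r < 1 + M"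
  shows "h^2 + r^2 - 2 * h * r * c < 1"
proof -
  define p q where "p = h - 1" and "q = r - 1"
  have pq: "0 \<le> p" "0 \<le> q" "p + q + 1 < 2 * c" using assms by (auto simp: p_def q_def)
  have "h^2 + r^2 - 2 * h * r * c - 1 = (p + q + 1) * (p + q + 1 - 2 * c) - 2 * (1 + c) * (p * q)"
    unfolding p_def q_def by (simp add: power2_eq_square algebra_simps)
  moreover have "(p + q + 1) * (p + q + 1 - 2 * c) < 0" using pq by (intro mult_pos_neg) auto
  moreover have "0 \<le> 2 * (1 + c) * (p * q)" using pq assms by simp
  ultimately show ?thesis by linarith
qed

text \<open>The left side is convex in \<open>h\<close> and in \<open>r\<close>, so chords reduce
  the claim to extreme values. At \<open>h = 1\<close> it is \<open>r < 2 * c\<close>; at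
  \<open>h = sqrt 2\<close> it is \<open>r^2 + 1 < 2 * sqrt 2 * c * r\<close>, which is checked at
  \<open>r = 1\<close> and \<open>r = c + b\<close>. Hence no active neighbour lies in direction
  \<open>axis 1 1\<close> when the hyperplane cuts the 24-cell and
  \<open>c \<ge> 151/200\<close>.\<close>

lemma packing_excludes_near:
  fixes c b h r :: real
  assumes c: "151/200 \<le> c" "c < 1" and b: "0 \<le> b" "b^2 \<le> 1 - c^2"
    and r: "1 \<le> r" "r < c + b" and h: "1 \<le> h" "h \<le> sqrt 2"
  shows "h^2 + r^2 - 2 * h * r * c < 1"
proof -
  define \<sigma> where "\<sigma> = sqrt (2::real)"
  have \<sigma>: "\<sigma>^2 = 2" "1414/1000 \<le> \<sigma>" "\<sigma> \<le> 1415/1000"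
  proof -
    show "\<sigma>^2 = 2" by (simp add: \<sigma>_def)
    show "1414/1000 \<le> \<sigma>" unfolding \<sigma>_def by (rule real_le_rsqrt) (simp add: power2_eq_square)
    show "\<sigma> \<le> 1415/1000" unfolding \<sigma>_def by (rule real_le_lsqrt) (simp_all add: power2_eq_square)
  qed
  have c2: "(151/200)^2 \<le> c^2" using c by (intro power_mono) auto
  have far: "r^2 + 1 < 2 * \<sigma> * c * r"
  proof -
    define M where "M = c + b"
    have "(2 * \<sigma> - 2) * c * b + 2 * \<sigma> * c^2 - (b^2 + c^2 + 1) > 0"
    proof -
      have *: "(2 * (1414/1000) - 2) * (c * b) + 2 * (1414/1000) * c^2 \<le> (2 * \<sigma> - 2) * (c * b) + 2 * \<sigma> * c^2"
        using \<sigma> c b by (intro add_mono mult_right_mono) auto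
      have "0 < (2 * (1414/1000) - 2) * (c * b) + 2 * (1414/1000) * c^2 - (b^2 + c^2 + 1)"
      proof (cases "b \<le> 64/100")
        case True
        have "b * b \<le> 64/100 * b" using True b by (intro mult_right_mono) auto
        moreover have "151/200 * b \<le> c * b" using c b by (intro mult_right_mono) auto
        ultimately show ?thesis using c2 b by (simp add: power2_eq_square)
      next
        case False
        have "151/200 * (64/100) \<le> c * b" using False c b by (intro mult_mono) auto
        then show ?thesis using b c2 by (simp add: power2_eq_square)
      qed
      then show ?thesis using * by (simp add: mult.assoc)
    qed
    then have M: "M^2 + 1 < 2 * \<sigma> * c * M" by (simp add: M_def power2_eq_square algebra_simps)
    have one: "2 < 2 * \<sigma> * c"
    proof -
      have "1414/1000 * (151/200) \<le> \<sigma> * c" using \<sigma> c by (intro mult_mono) auto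
      then show ?thesis by simp
    qed
    have M1: "1 < M" using r by (simp add: M_def)
    have "0 \<le> (r - 1) * (M - r)" using r by (simp add: M_def)
    then have "r^2 \<le> (1 + M) * r - M" by (simp add: power2_eq_square algebra_simps)
    moreover have "(M - 1) * ((1 + M) * r - M + 1 - 2 * \<sigma> * c * r)
        = (M - r) * (2 - 2 * \<sigma> * c) + (r - 1) * (M^2 + 1 - 2 * \<sigma> * c * M)"
      by (simp add: power2_eq_square algebra_simps)
    moreover have "(M - r) * (2 - 2 * \<sigma> * c) + (r - 1) * (M^2 + 1 - 2 * \<sigma> * c * M) < 0"
      using r one M by (intro add_neg_nonpos mult_pos_neg mult_nonneg_nonpos) (auto simp: M_def)
    ultimately have "(M - 1) * ((1 + M) * r - M + 1 - 2 * \<sigma> * c * r) < 0" by simp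
    then have "(1 + M) * r - M + 1 - 2 * \<sigma> * c * r < 0" using M1 by (simp add: mult_less_0_iff)
    then show ?thesis using \<open>r^2 \<le> (1 + M) * r - M\<close> by linarith
  qed
  have near: "r < 2 * c"
  proof -
    have "b \<le> c"
    proof (rule power2_le_imp_le)
      show "b^2 \<le> c^2" using b c2 by (simp add: power2_eq_square)
    qed (use c in simp)
    then show ?thesis using r by simp
  qed
  have "0 \<le> (h - 1) * (\<sigma> - h)" using h by (simp add: \<sigma>_def)
  then have hh: "h^2 \<le> (1 + \<sigma>) * h - \<sigma>" by (simp add: power2_eq_square algebra_simps)
  have "(\<sigma> - 1) * ((1 + \<sigma>) * h - \<sigma> + r^2 - 2 * h * r * c - 1)
     = (\<sigma> - h) * (r * (r - 2 * c)) + (h - 1) * (r^2 + 1 - 2 * \<sigma> * c * r) + (\<sigma>^2 - 2) * (h - 1)"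
    by (simp add: power2_eq_square algebra_simps)
  moreover have "(\<sigma> - h) * (r * (r - 2 * c)) + (h - 1) * (r^2 + 1 - 2 * \<sigma> * c * r) < 0"
  proof (cases "h = 1")
    case True
    then show ?thesis using \<sigma> r near by (simp add: mult_less_0_iff)
  next
    case False
    then show ?thesis using h r near far
      by (intro add_nonpos_neg mult_nonneg_nonpos mult_pos_neg) (auto simp: \<sigma>_def)
  qed
  ultimately have "(\<sigma> - 1) * ((1 + \<sigma>) * h - \<sigma> + r^2 - 2 * h * r * c - 1) < 0" using \<sigma>(1) by simp
  then have "(1 + \<sigma>) * h - \<sigma> + r^2 - 2 * h * r * c - 1 < 0" using \<sigma> by (simp add: mult_less_0_iff)
  then show ?thesis using hh by linarith
qed

text \<open>The value \<open>h = sqrt 2\<close> encodes that direction \<open>axis 1 1\<close> has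
  no active neighbour, so the packing inequality is assumed only below it. In the chamber
  \<open>u$1 + u$2\<close> is the maximum of \<open>u \<bullet> x\<close> on the 24-cell; the cases
  ask whether the hyperplane cuts the 24-cell and, if so, whether \<open>u\<close> is closer to a
  facet normal or to a vertex.\<close>

lemma chamber_volume:
  fixes u :: "real^4" and r h :: real and V :: "(real^4) set"
  assumes u: "norm u = 1" and top: "\<bar>u$2\<bar> + \<bar>u$3\<bar> + \<bar>u$4\<bar> \<le> u$1"
    and ord: "\<bar>u$3\<bar> \<le> u$2" "\<bar>u$4\<bar> \<le> u$2" and c: "u$1 < 1"
    and r: "1 \<le> r" "r < sqrt 2" and h: "1 \<le> h" "h \<le> sqrt 2"
    and packing: "h < sqrt 2 \<Longrightarrow> 1 \<le> h^2 + r^2 - 2 * h * r * u$1"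
    and cell: "cell24 \<inter> {x. u \<bullet> x \<le> r} \<subseteq> V"
    and frustum: "\<And>t. 0 < t \<Longrightarrow> t \<le> 13/40 \<Longrightarrow> 1 + t \<le> h \<Longrightarrow> frustum t \<inter> {x. u \<bullet> x \<le> r} \<subseteq> V"
  shows "exceeds_8 V"
proof -
  define c b where "c = u$1" and "b = u$2"
  have "u \<bullet> u = 1" using u by (simp add: norm_eq_1)
  then have sq: "c^2 + b^2 + (u$3)^2 + (u$4)^2 = 1"
    by (simp add: inner_vec_def sum_4 c_def b_def power2_eq_square)
  have b0: "0 \<le> b" using ord by (simp add: b_def)
  have bc: "b \<le> c" using top b0 by (simp add: b_def c_def)
  have c0: "0 < c"
  proof (rule ccontr)
    assume "\<not> 0 < c"
    then have "c = 0" "b = 0" "u$3 = 0" "u$4 = 0" using top b0 bc by (auto simp: c_def b_def)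
    then show False using sq by simp
  qed
  have b: "0 < b"
  proof (rule ccontr)
    assume "\<not> 0 < b"
    then have "b = 0" "u$3 = 0" "u$4 = 0" using ord b0 by (auto simp: b_def)
    then have "c^2 = 1" using sq by simp
    then show False using c c0 by (simp add: c_def power2_eq_1_iff)
  qed
  \<comment> \<open>In the chamber the angle to \<open>axis 1 1\<close> is at most 45
    degrees.\<close>
  have c2: "1 \<le> 2 * c^2"
  proof -
    have "b^2 + (u$3)^2 + (u$4)^2 \<le> (b + \<bar>u$3\<bar> + \<bar>u$4\<bar>)^2" using b by (simp add: power2_sum)
    also have "\<dots> \<le> c^2" using top b by (intro power_mono) (auto simp: b_def c_def)
    finally show ?thesis using sq by linarith
  qed
  have c_lower: "sqrt 2 \<le> 2 * c" by (rule real_le_lsqrt) (use c2 c0 in \<open>simp_all add: power_mult_distrib\<close>)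
  have r2: "r < 2 * c" using r c_lower by linarith
  have h1: "1 < h"
  proof (rule ccontr)
    assume "\<not> 1 < h"
    then have "h = 1" "h < sqrt 2" using h by auto
    then have "1 \<le> 1 + r^2 - 2 * r * c" using packing by (simp add: c_def)
    then have "0 \<le> r * (r - 2 * c)" by (simp add: power2_eq_square algebra_simps)
    then show False using r r2 by (simp add: zero_le_mult_iff)
  qed
  have half: "half_frustum u t \<subseteq> V" if t: "0 < t" "t \<le> 13/40" "1 + t \<le> h" "c * (1 + t) \<le> r" for t
  proof -
    have "half_frustum u t \<subseteq> frustum t \<inter> {x. u \<bullet> x \<le> r}"
    proof
      fix x assume x: "x \<in> half_frustum u t"
      then have "c * x$1 \<le> c * (1 + t)" using c0 by (auto simp: half_frustum_def frustum_def)
      then show "x \<in> frustum t \<inter> {x. u \<bullet> x \<le> r}"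
        using x t(4) unfolding half_frustum_def inner_tail by (auto simp: c_def)
    qed
    then show ?thesis using frustum[OF t(1-3)] by blast
  qed
  note cl = closed_halfspaces(1)
  note m = lmeasurable_Int_closed[OF lmeasurable_cell24] lmeasurable_Int_closed[OF lmeasurable_frustum]
  have overlap: "cell24 \<inter> frustum t \<subseteq> {x. x$1 = 1}" for t
  proof
    fix x assume x: "x \<in> cell24 \<inter> frustum t"
    then have "\<bar>x$1\<bar> \<le> 1" unfolding cell24_def by blast
    then show "x \<in> {x. x$1 = 1}" using x by (simp add: frustum_def)
  qed
  consider "c + b \<le> r" | "r < c + b" "151/200 \<le> c" | "r < c + b" "c < 151/200" by linarith
  then show ?thesis
  proof cases
    case 1
    define t where "t = min (13/40) (min (h - 1) (r / c - 1))"
    have "c < r" using 1 b by simp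
    then have t: "0 < t" "t \<le> 13/40" "t \<le> h - 1" "t \<le> r / c - 1"
      using h1 c0 unfolding t_def by (simp, blast intro: min.coboundedI1 min.coboundedI2 order_refl)+
    have "c * (1 + t) \<le> c * (r / c)" using t c0 by (intro mult_left_mono) auto
    then have ct: "c * (1 + t) \<le> r" using c0 by simp
    have "u \<bullet> x \<le> r" if x: "x \<in> cell24" for x
    proof -
      have x1: "\<bar>x$1\<bar> \<le> 1" "\<bar>x$1\<bar> + \<bar>x$2\<bar> + \<bar>x$3\<bar> + \<bar>x$4\<bar> \<le> 2"
        using x unfolding cell24_def sum_4 by blast+
      have "u \<bullet> x \<le> c * \<bar>x$1\<bar> + (\<bar>u$2\<bar> * \<bar>x$2\<bar> + \<bar>u$3\<bar> * \<bar>x$3\<bar> + \<bar>u$4\<bar> * \<bar>x$4\<bar>)"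
      proof -
        have "c * x$1 \<le> c * \<bar>x$1\<bar>" using c0 by (intro mult_left_mono) auto
        then show ?thesis
          unfolding inner_tail tail_inner_def abs_mult[symmetric] c_def by linarith
      qed
      also have "\<dots> \<le> c * \<bar>x$1\<bar> + (b * \<bar>x$2\<bar> + b * \<bar>x$3\<bar> + b * \<bar>x$4\<bar>)"
        using ord b by (intro add_left_mono add_mono mult_right_mono) (auto simp: b_def)
      also have "\<dots> = c * \<bar>x$1\<bar> + b * (\<bar>x$2\<bar> + \<bar>x$3\<bar> + \<bar>x$4\<bar>)" by (simp add: algebra_simps)
      also have "\<dots> \<le> c * \<bar>x$1\<bar> + b * (2 - \<bar>x$1\<bar>)" using x1 b by (intro add_left_mono mult_left_mono) auto
      also have "\<dots> = 2 * b + (c - b) * \<bar>x$1\<bar>" by (simp add: algebra_simps)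
      also have "\<dots> \<le> 2 * b + (c - b) * 1" using x1 bc by (intro add_left_mono mult_left_mono) auto
      finally show ?thesis using 1 by simp
    qed
    then have "cell24 \<subseteq> V" using cell by blast
    then show ?thesis using half[OF t(1,2) _ ct] t by (intro exceeds_8_no_loss[of V t u]) auto
  next
    case 2
    have hs: "h = sqrt 2"
    proof (rule ccontr)
      assume "h \<noteq> sqrt 2"
      then have "1 \<le> h^2 + r^2 - 2 * h * r * c" using packing h by (simp add: c_def)
      moreover have "b^2 \<le> 1 - c^2" using sq zero_le_power2[of "u$3"] zero_le_power2[of "u$4"] by linarith
      ultimately show False
        using packing_excludes_near[of c b r h] 2 c b r h by (simp add: c_def)
    qed
    obtain t where t: "0 < t" "t \<le> 13/40"
      "8 < vol (cell24 \<inter> {x. u \<bullet> x \<le> 1}) + vol (frustum t \<inter> {x. u \<bullet> x \<le> 1})"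
      using cap_gain[OF u] 2 c by (auto simp: c_def)
    have "1 + t \<le> h" unfolding hs by (rule real_le_rsqrt) (use power_mono[of "1 + t" "53/40" 2] t in \<open>simp add: power2_eq_square\<close>)
    moreover have "{x. u \<bullet> x \<le> 1} \<subseteq> {x. u \<bullet> x \<le> r}" using r by auto
    ultimately show ?thesis
      using cell frustum[OF t(1,2)] t(3) overlap[of t]
      by (intro exceeds_8_Un[OF m(1)[OF cl[of u 1]] m(2)[OF cl[of u 1]]]) blast+
  next
    case 3
    note g = near_vertex_gain[OF u top ord 3(2)[unfolded c_def] r(1) 3(1)[unfolded c_def b_def]]
    let ?t = "3/4 * (u$1 + u$2 - r)"
    \<comment> \<open>The packing inequality excludes the open triangle
      \<open>h + r < 1 + c + b\<close>, so a deep cut at the vertex forces the neighbour in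
      direction \<open>axis 1 1\<close> far away.\<close>
    have "1 + (c + b - r) \<le> h"
    proof (rule ccontr)
      assume *: "\<not> 1 + (c + b - r) \<le> h"
      have "c + b \<le> sqrt 2"
      proof (rule real_le_rsqrt)
        have "(c + b)^2 + (c - b)^2 = 2 * (c^2 + b^2)" by (simp add: power2_eq_square algebra_simps)
        moreover have "0 \<le> (c - b)^2" "c^2 + b^2 \<le> 1" using sq zero_le_power2[of "u$3"] zero_le_power2[of "u$4"] by (simp, linarith)
        ultimately show "(c + b)^2 \<le> 2" by argo
      qed
      then have "h < sqrt 2" using * r by linarith
      then show False
        using packing packing_triangle[of h r c "c + b"] h r c c0 bc * by (simp add: c_def)
    qed
    then have "1 + ?t \<le> h" using 3(1) unfolding c_def b_def by argo
    then have "half_frustum u ?t \<subseteq> V" using half g(1-3) by (simp add: c_def)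
    then show ?thesis
      using g(4) cell overlap[of ?t]
      by (intro exceeds_8_Un[OF m(1)[OF cl] lmeasurable_half_frustum]) (auto simp: half_frustum_def)
  qed
qed

section \<open>Symmetries of the Hurwitz units\<close>

text \<open>The 24 unit Hurwitz quaternions, which are the facet normals of
  \<open>cell24\<close>.\<close>

definition hurwitz_units :: "(real^4) set" where
  "hurwitz_units = {axis i s | i s. s \<in> {1, -1}} \<union> {w. \<forall>i. w$i \<in> {1/2, -1/2}}"

definition signs :: "('n \<Rightarrow> real) \<Rightarrow> real^'n \<Rightarrow> real^'n" where
  "signs e x = (\<chi> i. e i * x$i)"

text \<open>Half of a symmetric Hadamard matrix, hence an orthogonal involution. It exchanges
  \<open>axis 1 1\<close> with the vector of entries 1/2 and so links the two kinds of units, which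
  signs and swaps keep apart.\<close>

definition hadamard :: "real^4 \<Rightarrow> real^4" where
  "hadamard x = vector [(x$1 + x$2 + x$3 + x$4) / 2, (x$1 + x$2 - x$3 - x$4) / 2,
     (x$1 - x$2 + x$3 - x$4) / 2, (x$1 - x$2 - x$3 + x$4) / 2]"

definition hurwitz_symmetry :: "(real^4 \<Rightarrow> real^4) \<Rightarrow> bool" where
  "hurwitz_symmetry T \<longleftrightarrow> orthogonal_transformation T \<and> T ` hurwitz_units = hurwitz_units"

lemma hurwitz_symmetry_involution:
  assumes "orthogonal_transformation T" "\<And>x. T (T x) = x" "\<And>w. w \<in> hurwitz_units \<Longrightarrow> T w \<in> hurwitz_units"
  shows "hurwitz_symmetry T"
proof -
  have "w \<in> T ` hurwitz_units" if "w \<in> hurwitz_units" for w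
    using assms(2)[of w, symmetric] assms(3)[OF that] by (rule image_eqI)
  then show ?thesis using assms unfolding hurwitz_symmetry_def by blast
qed

lemma hurwitz_symmetry_comp:
  "hurwitz_symmetry S \<Longrightarrow> hurwitz_symmetry T \<Longrightarrow> hurwitz_symmetry (S \<circ> T)"
  unfolding hurwitz_symmetry_def
  by (metis image_comp orthogonal_transformation_compose)

lemma hurwitz_units_cases:
  assumes "w \<in> hurwitz_units"
  obtains i s where "s = 1 \<or> s = -1" "w = axis i s" | "\<And>i. w$i = 1/2 \<or> w$i = -1/2"
  using assms unfolding hurwitz_units_def by auto

lemma axis_in_hurwitz: "s = 1 \<or> s = -1 \<Longrightarrow> axis i s \<in> hurwitz_units"
  unfolding hurwitz_units_def by auto

lemma half_in_hurwitz: "(\<And>i. w$i = 1/2 \<or> w$i = -1/2) \<Longrightarrow> w \<in> hurwitz_units"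
  unfolding hurwitz_units_def by auto

lemma hurwitz_symmetry_swap: "hurwitz_symmetry (swap i j)"
proof (rule hurwitz_symmetry_involution[OF orthogonal_transformation_swap swap_swap])
  fix w assume "w \<in> hurwitz_units"
  then show "swap i j w \<in> hurwitz_units"
  proof (cases rule: hurwitz_units_cases)
    case (1 k s)
    have "swap i j w = axis (Transposition.transpose i j k) s"
      unfolding 1 by (auto simp: vec_eq_iff swap_nth axis_def transpose_eq_iff)
    then show ?thesis using 1 by (simp add: axis_in_hurwitz)
  next
    case 2
    then show ?thesis by (intro half_in_hurwitz) (simp add: swap_nth)
  qed
qed

lemma hurwitz_symmetry_signs:
  assumes "\<And>i. e i = 1 \<or> e i = -1"
  shows "hurwitz_symmetry (signs e)"
proof (rule hurwitz_symmetry_involution)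
  have ee: "e i * (e i * a) = a" for i a using assms[of i] by auto
  show "orthogonal_transformation (signs e)"
    unfolding orthogonal_transformation_def
    by (auto intro!: linearI sum.cong simp: vec_eq_iff inner_vec_def signs_def algebra_simps ee)
  show "signs e (signs e x) = x" for x by (simp add: vec_eq_iff signs_def ee)
  fix w assume "w \<in> hurwitz_units"
  then show "signs e w \<in> hurwitz_units"
  proof (cases rule: hurwitz_units_cases)
    case (1 k s)
    have "signs e w = axis k (e k * s)" unfolding 1 by (auto simp: vec_eq_iff signs_def axis_def)
    then show ?thesis using 1 assms[of k] by (auto intro: axis_in_hurwitz)
  next
    case 2
    have "signs e w $ i = 1/2 \<or> signs e w $ i = -1/2" for i
      using 2[of i] assms[of i] by (auto simp: signs_def)
    then show ?thesis by (rule half_in_hurwitz)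
  qed
qed

lemma vec_eq_4: "x = (y::real^4) \<longleftrightarrow> x$1 = y$1 \<and> x$2 = y$2 \<and> x$3 = y$3 \<and> x$4 = y$4"
  by (simp add: vec_eq_iff forall_4)

lemma four_cases: obtains "i = (1::4)" | "i = 2" | "i = 3" | "i = 4"
  using forall_4[of "\<lambda>i. i = 1 \<or> i = 2 \<or> i = 3 \<or> i = 4"] by auto

lemma hadamard_half:
  fixes p q r s :: real
  assumes "p = 1/2 \<or> p = -1/2" "q = 1/2 \<or> q = -1/2" "r = 1/2 \<or> r = -1/2" "s = 1/2 \<or> s = -1/2"
  shows "vector [(p + q + r + s) / 2, (p + q - r - s) / 2, (p - q + r - s) / 2, (p - q - r + s) / 2] \<in> hurwitz_units"
proof -
  have ax: "x \<in> hurwitz_units" if "x = axis 1 1 \<or> x = axis 2 1 \<or> x = axis 3 1 \<or> x = axis 4 1 \<or>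
      x = axis 1 (-1) \<or> x = axis 2 (-1) \<or> x = axis 3 (-1) \<or> x = axis 4 (-1) \<or>
      (x$1 = 1/2 \<or> x$1 = -1/2) \<and> (x$2 = 1/2 \<or> x$2 = -1/2) \<and> (x$3 = 1/2 \<or> x$3 = -1/2) \<and> (x$4 = 1/2 \<or> x$4 = -1/2)" for x
    using that unfolding hurwitz_units_def by (auto simp: forall_4)
  show ?thesis
    using assms by (intro ax) (elim disjE; hypsubst; simp add: vec_eq_4 axis_def)
qed

lemma hadamard_axis:
  assumes "s = 1 \<or> s = -1" shows "hadamard (axis i s) \<in> hurwitz_units"
proof (rule half_in_hurwitz)
  have "\<forall>k. hadamard (axis i s) $ k = s/2 \<or> hadamard (axis i s) $ k = - s/2"
    unfolding forall_4 by (cases rule: four_cases[of i]) (simp_all add: hadamard_def axis_def)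
  then show "hadamard (axis i s) $ k = 1/2 \<or> hadamard (axis i s) $ k = -1/2" for k
    using assms by fastforce
qed

lemma hurwitz_symmetry_hadamard: "hurwitz_symmetry hadamard"
proof (rule hurwitz_symmetry_involution)
  show "orthogonal_transformation hadamard"
    unfolding orthogonal_transformation_def
    by (auto intro!: linearI simp: vec_eq_4 inner_vec_def sum_4 hadamard_def field_simps)
  show "hadamard (hadamard x) = x" for x by (simp add: vec_eq_4 hadamard_def field_simps)
  fix w assume "w \<in> hurwitz_units"
  then show "hadamard w \<in> hurwitz_units"
  proof (cases rule: hurwitz_units_cases)
    case (1 i s) then show ?thesis using hadamard_axis by simp
  next
    case 2 then show ?thesis unfolding hadamard_def by (intro hadamard_half) auto
  qed
qed

lemma half_square: "a = 1/2 \<or> a = -1/2 \<Longrightarrow> a * a = (1/4 :: real)"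
  by (elim disjE; hypsubst; simp)

lemma finite_hurwitz_units: "finite hurwitz_units"
proof -
  let ?E = "{0, 1, -1, 1/2, -1/2 :: real}"
  have *: "w \<in> (\<lambda>(a,b,c,d). vector [a,b,c,d]) ` (?E \<times> ?E \<times> ?E \<times> ?E)" if "w \<in> hurwitz_units" for w
  proof (rule image_eqI)
    show "w = (case (w$1, w$2, w$3, w$4) of (a,b,c,d) \<Rightarrow> vector [a,b,c,d])" by (simp add: vec_eq_4)
    have "w$i \<in> ?E" for i
      using that by (cases rule: hurwitz_units_cases) (auto simp: axis_def)
    then show "(w$1, w$2, w$3, w$4) \<in> ?E \<times> ?E \<times> ?E \<times> ?E" by blast
  qed
  then have "hurwitz_units \<subseteq> (\<lambda>(a,b,c,d). vector [a,b,c,d]) ` (?E \<times> ?E \<times> ?E \<times> ?E)" by blast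
  then show ?thesis by (rule finite_subset) (intro finite_imageI finite_cartesian_product; simp)
qed

lemma norm_hurwitz_unit:
  assumes "w \<in> hurwitz_units" shows "norm w = 1"
  using assms
proof (cases rule: hurwitz_units_cases)
  case 2
  have "w \<bullet> w = (\<Sum>i\<in>(UNIV::4 set). 1/4)"
    unfolding inner_vec_def inner_real_def by (intro sum.cong refl half_square 2)
  then show ?thesis by (simp add: norm_eq_1)
qed (auto simp: norm_eq_1 inner_axis_axis)

lemma hurwitz_transitive:
  assumes "w \<in> hurwitz_units"
  obtains T where "hurwitz_symmetry T" "T w = axis 1 1"
  using assms
proof (cases rule: hurwitz_units_cases)
  case (1 i s)
  have "(signs (\<lambda>_. s) \<circ> swap 1 i) w = axis 1 1"
    using 1(1) unfolding 1(2) by (auto simp: vec_eq_iff signs_def swap_nth axis_def transpose_eq_iff)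
  moreover have "hurwitz_symmetry (signs (\<lambda>_. s) \<circ> swap 1 i)"
    using 1 by (intro hurwitz_symmetry_comp hurwitz_symmetry_signs hurwitz_symmetry_swap)
  ultimately show ?thesis by (rule that[rotated])
next
  case 2
  have "signs (\<lambda>i. 2 * w$i) w $ i = 1/2" for i using half_square[OF 2[of i]] by (simp add: signs_def)
  then have "signs (\<lambda>i. 2 * w$i) w = (\<chi> i. 1/2)" by (simp add: vec_eq_iff)
  then have "(hadamard \<circ> signs (\<lambda>i. 2 * w$i)) w = axis 1 1"
    unfolding o_apply by (simp add: vec_eq_4 hadamard_def axis_def)
  moreover have "hurwitz_symmetry (hadamard \<circ> signs (\<lambda>i. 2 * w$i))"
  proof (intro hurwitz_symmetry_comp hurwitz_symmetry_signs hurwitz_symmetry_hadamard)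
    show "2 * w$i = 1 \<or> 2 * w$i = -1" for i using 2[of i] by argo
  qed
  ultimately show ?thesis by (rule that[rotated])
qed

text \<open>A unit with the largest inner product with \<open>u\<close> is sent to
  \<open>axis 1 1\<close>. Comparison with the half-integral unit that carries the signs of the
  image gives the sum inequality; a swap and a sign that fix the first coordinate order the
  rest.\<close>

lemma to_chamber:
  fixes u :: "real^4"
  obtains T where "hurwitz_symmetry T"
    "\<bar>T u $ 2\<bar> + \<bar>T u $ 3\<bar> + \<bar>T u $ 4\<bar> \<le> T u $ 1" "\<bar>T u $ 3\<bar> \<le> T u $ 2" "\<bar>T u $ 4\<bar> \<le> T u $ 2"
proof -
  have "hurwitz_units \<noteq> {}" using axis_in_hurwitz by blast
  then obtain w where w: "w \<in> hurwitz_units" "\<And>w'. w' \<in> hurwitz_units \<Longrightarrow> u \<bullet> w' \<le> u \<bullet> w"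
  proof -
    let ?I = "(\<lambda>w. u \<bullet> w) ` hurwitz_units"
    have fin: "finite ?I" using finite_hurwitz_units by simp
    have "Max ?I \<in> ?I" using fin \<open>hurwitz_units \<noteq> {}\<close> by (intro Max_in) auto
    then obtain w where "w \<in> hurwitz_units" "Max ?I = u \<bullet> w" by auto
    moreover have "u \<bullet> w' \<le> Max ?I" if "w' \<in> hurwitz_units" for w'
      using fin that by (intro Max_ge) auto
    ultimately show ?thesis using that by simp
  qed
  obtain S where S: "hurwitz_symmetry S" "S w = axis 1 1" using hurwitz_transitive[OF w(1)] .
  define v where "v = S u"
  have max: "v \<bullet> w' \<le> v$1" if "w' \<in> hurwitz_units" for w'
  proof -
    have "w' \<in> S ` hurwitz_units" using S(1) that by (simp add: hurwitz_symmetry_def)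
    then obtain w'' where "w'' \<in> hurwitz_units" "w' = S w''" by blast
    moreover have "S a \<bullet> S b = a \<bullet> b" for a b
      using S(1) by (simp add: hurwitz_symmetry_def orthogonal_transformation_def)
    moreover have "v$1 = S u \<bullet> S w" unfolding S(2) v_def by (simp add: inner_axis)
    ultimately show ?thesis using w(2) by (simp add: v_def)
  qed
  have sum: "\<bar>v$2\<bar> + \<bar>v$3\<bar> + \<bar>v$4\<bar> \<le> v$1"
  proof -
    define w' :: "real^4" where "w' = (\<chi> i. if i = 1 \<or> 0 \<le> v$i then 1/2 else -1/2)"
    have "v \<bullet> w' \<le> v$1" by (intro max half_in_hurwitz) (simp add: w'_def)
    moreover have "v \<bullet> w' = (v$1 + \<bar>v$2\<bar> + \<bar>v$3\<bar> + \<bar>v$4\<bar>) / 2"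
      by (simp add: inner_vec_def sum_4 w'_def)
    ultimately show ?thesis by simp
  qed
  obtain j where j: "j \<noteq> 1" "\<bar>v$2\<bar> \<le> \<bar>v$j\<bar>" "\<bar>v$3\<bar> \<le> \<bar>v$j\<bar>" "\<bar>v$4\<bar> \<le> \<bar>v$j\<bar>"
  proof -
    consider "\<bar>v$3\<bar> \<le> \<bar>v$2\<bar>" "\<bar>v$4\<bar> \<le> \<bar>v$2\<bar>" | "\<bar>v$2\<bar> \<le> \<bar>v$3\<bar>" "\<bar>v$4\<bar> \<le> \<bar>v$3\<bar>" | "\<bar>v$2\<bar> \<le> \<bar>v$4\<bar>" "\<bar>v$3\<bar> \<le> \<bar>v$4\<bar>"
      by linarith
    then show ?thesis using that[of 2] that[of 3] that[of 4] by cases auto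
  qed
  define e :: "4 \<Rightarrow> real" where "e i = (if i = 2 \<and> v$j < 0 then -1 else 1)" for i
  define T where "T = signs e \<circ> swap 2 j \<circ> S"
  have Tk: "T u $ k = e k * v $ Transposition.transpose 2 j k" for k
    by (simp add: T_def signs_def swap_nth v_def)
  have "Transposition.transpose 2 j 1 = 1" using j(1) by (simp add: Transposition.transpose_def)
  then have T12: "T u $ 1 = v$1" "T u $ 2 = \<bar>v$j\<bar>" by (simp_all add: Tk e_def)
  have abs_T: "\<bar>T u $ k\<bar> = \<bar>v $ Transposition.transpose 2 j k\<bar>" for k
    by (simp add: Tk e_def)
  have le: "\<bar>T u $ k\<bar> \<le> T u $ 2" if "k \<noteq> 1" for k
  proof -
    have "Transposition.transpose 2 j k \<noteq> 1" using that j(1) by (simp add: Transposition.transpose_def)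
    moreover have "\<bar>v$l\<bar> \<le> \<bar>v$j\<bar>" if "l \<noteq> 1" for l
      using that j by (cases rule: four_cases[of l]) auto
    ultimately show ?thesis unfolding abs_T T12 by blast
  qed
  have "(\<Sum>k\<in>UNIV. \<bar>v $ Transposition.transpose 2 j k\<bar>) = (\<Sum>k\<in>UNIV. \<bar>v$k\<bar>)"
    by (rule sum.reindex_bij_betw[where g = "\<lambda>k. \<bar>v$k\<bar>"]) (rule bij_transpose)
  then have "(\<Sum>k\<in>UNIV. \<bar>T u $ k\<bar>) = (\<Sum>k\<in>UNIV. \<bar>v$k\<bar>)" by (simp only: abs_T)
  then have "\<bar>T u $ 2\<bar> + \<bar>T u $ 3\<bar> + \<bar>T u $ 4\<bar> \<le> T u $ 1"
    using sum T12(1) unfolding sum_4 by linarith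
  moreover have "hurwitz_symmetry T"
    unfolding T_def by (intro hurwitz_symmetry_comp hurwitz_symmetry_signs hurwitz_symmetry_swap S) (simp add: e_def)
  ultimately show ?thesis using le[of 3] le[of 4] by (intro that[of T]) simp_all
qed

section \<open>Cells of separated sets\<close>

text \<open>The Voronoi cell of the origin against the points \<open>Y\<close>: the inequality is
  \<open>norm z \<le> norm (z - y)\<close> after squaring.\<close>

definition origin_cell :: "(real^4) set \<Rightarrow> (real^4) set" where
  "origin_cell Y = {z. \<forall>y\<in>Y. z \<bullet> y \<le> (norm y)^2 / 2}"

definition separated :: "(real^4) set \<Rightarrow> bool" where
  "separated Y \<longleftrightarrow> (\<forall>y\<in>Y. 2 \<le> norm y) \<and> (\<forall>y\<in>Y. \<forall>y'\<in>Y. y \<noteq> y' \<longrightarrow> 2 \<le> norm (y - y'))"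

lemma origin_cell_image:
  assumes "orthogonal_transformation T"
  shows "origin_cell (T ` Y) = T ` origin_cell Y"
proof -
  have "surj T" using assms by (rule orthogonal_transformation_surj)
  have iff: "T z \<in> origin_cell (T ` Y) \<longleftrightarrow> z \<in> origin_cell Y" for z
    using assms by (auto simp: origin_cell_def orthogonal_transformation_norm orthogonal_transformation_def)
  show ?thesis
  proof (intro set_eqI iffI)
    fix x assume x: "x \<in> origin_cell (T ` Y)"
    obtain z where "x = T z" using \<open>surj T\<close> by (rule surjE)
    then show "x \<in> T ` origin_cell Y" using x iff by blast
  qed (use iff in blast)
qed

lemma separated_image:
  assumes "orthogonal_transformation T" "separated Y"
  shows "separated (T ` Y)"
proof -
  have "norm (T y) = norm y" "T y - T y' = T (y - y')" for y y'
    using assms(1) by (auto simp: orthogonal_transformation_norm linear_diff orthogonal_transformation_linear)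
  then show ?thesis using assms(2) by (auto simp: separated_def)
qed

lemma sgn_orthogonal:
  "orthogonal_transformation T \<Longrightarrow> sgn (T y) = T (sgn y)"
  by (simp add: sgn_div_norm orthogonal_transformation_norm linear_cmul orthogonal_transformation_linear)

lemma scaleR_norm_sgn: "norm y *\<^sub>R sgn y = (y :: 'a::real_normed_vector)"
  by (cases "y = 0") (simp_all add: sgn_div_norm)

lemma exceeds_8_orthogonal:
  assumes T: "orthogonal_transformation T" and V: "exceeds_8 (T ` V)"
  shows "exceeds_8 V"
proof -
  obtain A where A: "A \<in> lmeasurable" "A \<subseteq> T ` V" "8 < vol A" using V unfolding exceeds_8_def by blast
  have inv: "orthogonal_transformation (inv T)" and inj: "inj T"
    using T by (auto intro: orthogonal_transformation_inv orthogonal_transformation_inj)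
  show ?thesis
    unfolding exceeds_8_def
  proof (intro bexI conjI)
    show "inv T ` A \<subseteq> V" using image_mono[OF A(2), of "inv T"] inj by (simp add: image_comp)
    show "8 < vol (inv T ` A)" using measure_orthogonal_image[OF inv A(1)] A(3) by simp
    show "inv T ` A \<in> lmeasurable" by (rule measurable_orthogonal_image[OF inv A(1)])
  qed
qed

text \<open>Both norms lie between 2 and \<open>2 * sqrt 2\<close>, so two such points on one ray
  are less than 2 apart.\<close>

lemma same_direction_eq:
  assumes Y: "separated Y" "y \<in> Y" "y' \<in> Y" and n: "norm y < 2 * sqrt 2" "norm y' < 2 * sqrt 2"
    and s: "sgn y = sgn y'"
  shows "y = y'"
proof (rule ccontr)
  assume "y \<noteq> y'"
  then have "2 \<le> norm (y - y')" using Y by (auto simp: separated_def)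
  have "y = norm y *\<^sub>R sgn y" "y' = norm y' *\<^sub>R sgn y'" by (simp_all add: scaleR_norm_sgn)
  then have "y - y' = (norm y - norm y') *\<^sub>R sgn y" unfolding s by (metis scaleR_diff_left)
  then have "norm (y - y') = \<bar>norm y - norm y'\<bar> * norm (sgn y)" by simp
  also have "\<dots> \<le> \<bar>norm y - norm y'\<bar>" by (simp add: norm_sgn)
  also have "\<dots> < 2"
  proof -
    have "2 \<le> norm y" "2 \<le> norm y'" using Y by (auto simp: separated_def)
    moreover have "sqrt 2 < 2" by (rule real_less_lsqrt) auto
    ultimately show ?thesis using n by auto
  qed
  finally show False using \<open>2 \<le> norm (y - y')\<close> by simp
qed

lemma inner_half_vector:
  fixes z w :: "real^'n"
  assumes "\<And>i. w$i = 1/2 \<or> w$i = -1/2" "(\<Sum>i\<in>UNIV. \<bar>z$i\<bar>) \<le> 2"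
  shows "z \<bullet> w \<le> 1"
proof -
  have "z$i * w$i \<le> \<bar>z$i\<bar> / 2" for i
  proof -
    have "\<bar>w$i\<bar> = 1/2" using assms(1)[of i] by argo
    then have "\<bar>z$i * w$i\<bar> = \<bar>z$i\<bar> / 2" by (simp add: abs_mult)
    then show ?thesis by linarith
  qed
  then have "z \<bullet> w \<le> (\<Sum>i\<in>UNIV. \<bar>z$i\<bar> / 2)" unfolding inner_vec_def inner_real_def by (rule sum_mono)
  then show ?thesis using assms(2) by (simp flip: sum_divide_distrib)
qed

text \<open>The units \<open>axis i s\<close> bound the single coordinates; among the half-integral
  ones, that with the signs of \<open>z\<close> bounds the sum.\<close>

lemma cell24_eq: "cell24 = {z. \<forall>w\<in>hurwitz_units. z \<bullet> w \<le> 1}"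
proof (intro set_eqI iffI)
  fix z assume "z \<in> cell24"
  then have z: "\<And>i. \<bar>z$i\<bar> \<le> 1" "(\<Sum>i\<in>UNIV. \<bar>z$i\<bar>) \<le> 2" unfolding cell24_def by blast+
  have "z \<bullet> w \<le> 1" if "w \<in> hurwitz_units" for w
    using that
  proof (cases rule: hurwitz_units_cases)
    case (1 i s) then show ?thesis using z(1)[of i] by (auto simp: inner_axis)
  next
    case 2
    then show ?thesis using z(2) by (rule inner_half_vector)
  qed
  then show "z \<in> {z. \<forall>w\<in>hurwitz_units. z \<bullet> w \<le> 1}" by blast
next
  fix z :: "real^4" assume "z \<in> {z. \<forall>w\<in>hurwitz_units. z \<bullet> w \<le> 1}"
  then have z: "z \<bullet> w \<le> 1" if "w \<in> hurwitz_units" for w using that by blast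
  have "\<bar>z$i\<bar> \<le> 1" for i
    using z[of "axis i 1"] z[of "axis i (-1)"] axis_in_hurwitz[of 1 i] axis_in_hurwitz[of "-1" i]
    by (auto simp: inner_axis)
  moreover have "(\<Sum>i\<in>UNIV. \<bar>z$i\<bar>) \<le> 2"
  proof -
    define w :: "real^4" where "w = (\<chi> i. if 0 \<le> z$i then 1/2 else -1/2)"
    have "z \<bullet> w \<le> 1" by (intro z half_in_hurwitz) (simp add: w_def)
    moreover have "z \<bullet> w = (\<Sum>i\<in>UNIV. \<bar>z$i\<bar> / 2)"
      unfolding inner_vec_def by (intro sum.cong) (auto simp: w_def)
    ultimately show ?thesis by (simp flip: sum_divide_distrib)
  qed
  ultimately show "z \<in> cell24" unfolding cell24_def by blast
qed

text \<open>Over the facet with normal \<open>axis 1 1\<close> no other facet inequality fails, so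
  among active neighbours in unit directions only one in this direction can cut the frustum.\<close>

lemma frustum_hurwitz:
  assumes "z \<in> frustum t" "w \<in> hurwitz_units" "w \<noteq> axis 1 1"
  shows "z \<bullet> w \<le> 1"
  using assms(2)
proof (cases rule: hurwitz_units_cases)
  case (1 i s)
  have "\<bar>z$2\<bar> \<le> 1" "\<bar>z$3\<bar> \<le> 1" "\<bar>z$4\<bar> \<le> 1" "1 \<le> z$1"
  proof -
    have "\<bar>a\<bar> \<le> 1" if "\<bar>a\<bar> \<le> 1 - 9/5 * (b - 1)" "1 \<le> b" for a b :: real using that by argo
    then show "\<bar>z$2\<bar> \<le> 1" "\<bar>z$3\<bar> \<le> 1" "\<bar>z$4\<bar> \<le> 1" "1 \<le> z$1"
      using assms(1) unfolding frustum_def mem_Collect_eq by blast+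
  qed
  then show ?thesis
    using 1 assms(3) by (cases rule: four_cases[of i]) (auto simp: inner_axis)
next
  case 2
  have "(\<Sum>i\<in>UNIV. \<bar>z$i\<bar>) \<le> 2" using assms(1) unfolding frustum_def by blast
  with 2 show ?thesis by (rule inner_half_vector)
qed

lemma norm_cell24: "z \<in> cell24 \<Longrightarrow> norm z \<le> sqrt 2"
proof -
  assume "z \<in> cell24"
  then have z: "\<And>i. \<bar>z$i\<bar> \<le> 1" "(\<Sum>i\<in>UNIV. \<bar>z$i\<bar>) \<le> 2" unfolding cell24_def by blast+
  have "z$i * z$i \<le> \<bar>z$i\<bar>" for i
    using mult_left_mono[OF z(1)[of i], of "\<bar>z$i\<bar>"] by (simp flip: abs_mult)
  then have "z \<bullet> z \<le> (\<Sum>i\<in>UNIV. \<bar>z$i\<bar>)" unfolding inner_vec_def inner_real_def by (rule sum_mono)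
  then have "(norm z)^2 \<le> 2" using z(2) by (simp add: power2_norm_eq_inner)
  then show ?thesis by (rule real_le_rsqrt)
qed

text \<open>The bisector of an inactive neighbour has distance at least \<open>sqrt 2\<close> from
  the origin. This is why every region is kept in the ball of that radius.\<close>

lemma inner_inactive:
  fixes y z :: "real^4"
  assumes "norm z \<le> sqrt 2" "2 * sqrt 2 \<le> norm y"
  shows "z \<bullet> y \<le> (norm y)^2 / 2"
proof -
  have "z \<bullet> y \<le> norm z * norm y" by (rule norm_cauchy_schwarz)
  also have "\<dots> \<le> (norm y / 2) * norm y" using assms by (intro mult_right_mono) auto
  finally show ?thesis by (simp add: power2_eq_square)
qed

lemma inner_active:
  fixes y z :: "real^4"
  assumes "z \<bullet> sgn y \<le> norm y / 2"
  shows "z \<bullet> y \<le> (norm y)^2 / 2"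
proof -
  have "z \<bullet> y = norm y * (z \<bullet> sgn y)" by (cases "y = 0") (simp_all add: sgn_div_norm)
  also have "\<dots> \<le> norm y * (norm y / 2)" using assms by (intro mult_left_mono) auto
  finally show ?thesis by (simp add: power2_eq_square)
qed

text \<open>The half distance of the active neighbour in direction \<open>axis 1 1\<close>, and \<open>sqrt 2\<close> if there is none.\<close>

lemma axis_distance:
  assumes Y: "separated Y"
  obtains h where "1 \<le> h" "h \<le> sqrt 2" "h < sqrt 2 \<longrightarrow> (2 * h) *\<^sub>R axis 1 1 \<in> Y"
    "\<forall>y\<in>Y. norm y < 2 * sqrt 2 \<longrightarrow> sgn y = axis 1 1 \<longrightarrow> norm y = 2 * h"
proof (cases "\<exists>y\<in>Y. norm y < 2 * sqrt 2 \<and> sgn y = axis 1 1")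
  case True
  then obtain y where y: "y \<in> Y" "norm y < 2 * sqrt 2" "sgn y = axis 1 1" by blast
  have "(2 * (norm y / 2)) *\<^sub>R axis 1 1 = y" using scaleR_norm_sgn[of y] y(3) by simp
  then have "(2 * (norm y / 2)) *\<^sub>R axis 1 1 \<in> Y" using y(1) by (simp only:)
  moreover have "2 \<le> norm y" using Y y by (auto simp: separated_def)
  moreover have "\<forall>y'\<in>Y. norm y' < 2 * sqrt 2 \<longrightarrow> sgn y' = axis 1 1 \<longrightarrow> norm y' = 2 * (norm y / 2)"
  proof (intro ballI impI)
    fix y' assume y': "y' \<in> Y" "norm y' < 2 * sqrt 2" "sgn y' = axis 1 1"
    have "y = y'"
      by (rule same_direction_eq[OF Y y(1) y'(1) y(2) y'(2)]) (simp only: y(3) y'(3))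
    then show "norm y' = 2 * (norm y / 2)" by simp
  qed
  moreover have "1 \<le> norm y / 2" "norm y / 2 \<le> sqrt 2" using \<open>2 \<le> norm y\<close> y(2) by simp_all
  ultimately show ?thesis by (intro that[of "norm y / 2"] impI)
next
  case False
  then have "\<forall>y\<in>Y. norm y < 2 * sqrt 2 \<longrightarrow> sgn y = axis 1 1 \<longrightarrow> norm y = 2 * sqrt 2" by blast
  moreover have "1 \<le> sqrt (2::real)" by simp
  ultimately show ?thesis by (intro that[of "sqrt 2"]) simp_all
qed

lemma one_deviating_direction:
  assumes Y: "separated Y" and y0: "y0 \<in> Y" "norm y0 < 2 * sqrt 2" "sgn y0 \<notin> hurwitz_units"
    and others: "\<And>y. y \<in> Y \<Longrightarrow> norm y < 2 * sqrt 2 \<Longrightarrow> sgn y \<in> hurwitz_units \<or> sgn y = sgn y0"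
  shows "exceeds_8 (origin_cell Y)"
proof -
  obtain T where T: "hurwitz_symmetry T"
    and ch: "\<bar>T (sgn y0) $ 2\<bar> + \<bar>T (sgn y0) $ 3\<bar> + \<bar>T (sgn y0) $ 4\<bar> \<le> T (sgn y0) $ 1"
      "\<bar>T (sgn y0) $ 3\<bar> \<le> T (sgn y0) $ 2" "\<bar>T (sgn y0) $ 4\<bar> \<le> T (sgn y0) $ 2"
    using to_chamber .
  have orth: "orthogonal_transformation T" and TW: "T ` hurwitz_units = hurwitz_units"
    using T by (auto simp: hurwitz_symmetry_def)
  have inj: "inj T" using orth by (rule orthogonal_transformation_inj)
  define u where "u = T (sgn y0)"
  define r where "r = norm y0 / 2"
  have ny0: "2 \<le> norm y0" using Y y0 by (auto simp: separated_def)
  have u1: "norm u = 1" using orth ny0 by (auto simp: u_def orthogonal_transformation_norm norm_sgn)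
  have uW: "u \<notin> hurwitz_units" using TW y0(3) inj unfolding u_def by (metis image_iff injD)
  have Ty0: "T y0 = (2 * r) *\<^sub>R u"
  proof -
    have "T y0 = norm (T y0) *\<^sub>R sgn (T y0)" by (simp add: scaleR_norm_sgn)
    then show ?thesis using orth by (simp add: sgn_orthogonal orthogonal_transformation_norm u_def r_def)
  qed
  have Y': "separated (T ` Y)" using orth Y by (rule separated_image)
  \<comment> \<open>Equality of directions is sharpened to equality of points, so a single
    hyperplane has to be dealt with besides the facets.\<close>
  have others': "sgn y \<in> hurwitz_units \<or> y = T y0" if y: "y \<in> T ` Y" "norm y < 2 * sqrt 2" for y
  proof -
    obtain x where x: "x \<in> Y" "y = T x" using y(1) by blast
    then have "norm x < 2 * sqrt 2" using y(2) orth by (simp add: orthogonal_transformation_norm)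
    then have "sgn x \<in> hurwitz_units \<or> x = y0"
      using others[OF x(1)] same_direction_eq[OF Y x(1) y0(1) _ y0(2)] by blast
    moreover have "T (sgn x) \<in> hurwitz_units" if "sgn x \<in> hurwitz_units"
      using TW that by blast
    ultimately show ?thesis using x(2) by (auto simp: sgn_orthogonal[OF orth])
  qed
  obtain h where h: "1 \<le> h" "h \<le> sqrt 2" "h < sqrt 2 \<longrightarrow> (2 * h) *\<^sub>R axis 1 1 \<in> T ` Y"
    "\<forall>y\<in>T ` Y. norm y < 2 * sqrt 2 \<longrightarrow> sgn y = axis 1 1 \<longrightarrow> norm y = 2 * h"
    by (rule axis_distance[OF Y'])
  have in_cell: "z \<in> origin_cell (T ` Y)"
    if z: "norm z \<le> sqrt 2" "u \<bullet> z \<le> r" "z$1 \<le> h"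
      "\<And>w. w \<in> hurwitz_units \<Longrightarrow> w \<noteq> axis 1 1 \<Longrightarrow> z \<bullet> w \<le> 1" for z
  proof -
    have "z \<bullet> y \<le> (norm y)^2 / 2" if y: "y \<in> T ` Y" for y
    proof (cases "norm y < 2 * sqrt 2")
      case False then show ?thesis using z(1) by (intro inner_inactive) auto
    next
      case True
      have "2 \<le> norm y" using Y' y by (auto simp: separated_def)
      have "z \<bullet> sgn y \<le> norm y / 2"
      proof (cases "y = T y0")
        case True
        then have "sgn y = u" "norm y = 2 * r"
          using orth by (simp_all add: sgn_orthogonal u_def r_def orthogonal_transformation_norm)
        then show ?thesis using z(2) by (simp add: inner_commute)
      next
        case False
        then have W: "sgn y \<in> hurwitz_units" using others'[OF y True] by blast
        show ?thesis
        proof (cases "sgn y = axis 1 1")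
          case True
          then have "norm y = 2 * h" using h(4) y \<open>norm y < 2 * sqrt 2\<close> by blast
          then show ?thesis using True z(3) by (simp add: inner_axis)
        next
          case False
          then show ?thesis using z(4)[OF W] \<open>2 \<le> norm y\<close> by simp
        qed
      qed
      then show ?thesis by (rule inner_active)
    qed
    then show ?thesis by (simp add: origin_cell_def)
  qed
  have "exceeds_8 (origin_cell (T ` Y))"
  proof (rule chamber_volume[OF u1])
    show "\<bar>u$2\<bar> + \<bar>u$3\<bar> + \<bar>u$4\<bar> \<le> u$1" "\<bar>u$3\<bar> \<le> u$2" "\<bar>u$4\<bar> \<le> u$2" using ch by (simp_all add: u_def)
    show "1 \<le> r" "r < sqrt 2" using ny0 y0 by (auto simp: r_def)
    show "1 \<le> h" "h \<le> sqrt 2" by (fact h)+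
    show "u$1 < 1"
    proof (rule ccontr)
      assume "\<not> u$1 < 1"
      then have "u$1 = 1" using component_le_norm_cart[of u 1] u1 by simp
      then have "u \<bullet> axis 1 1 = 1" by (simp add: inner_axis)
      then have "(norm (u - axis 1 1))^2 = 0"
        using u1 by (simp add: power2_norm_eq_inner inner_diff inner_commute inner_axis_axis norm_eq_1)
      then have "u = axis 1 1" by simp
      then show False using uW axis_in_hurwitz[of 1 1] by simp
    qed
    show "1 \<le> h^2 + r^2 - 2 * h * r * u$1" if "h < sqrt 2"
    proof -
      let ?a = "(2 * h) *\<^sub>R axis 1 1 :: real^4" and ?b = "(2 * r) *\<^sub>R u"
      have "?a \<noteq> ?b"
      proof
        assume "?a = ?b"
        then have "sgn ?a = sgn ?b" by simp
        moreover have "sgn ?a = axis 1 1" "sgn ?b = u"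
        proof -
          have "sgn (axis 1 1 :: real^4) = axis 1 1" "sgn u = u"
            using u1 by (simp_all add: sgn_div_norm)
          moreover have "sgn (2 * h) = 1" "sgn (2 * r) = 1"
            using h(1) ny0 unfolding sgn_1_pos r_def by linarith+
          ultimately show "sgn ?a = axis 1 1" "sgn ?b = u"
            by (simp_all only: sgn_scaleR real_scaleR_def scaleR_one)
        qed
        ultimately show False using uW axis_in_hurwitz[of 1 1] by simp
      qed
      moreover have "?a \<in> T ` Y" "?b \<in> T ` Y" using h(3) that Ty0 y0(1) by (auto simp flip: Ty0)
      ultimately have "2 \<le> norm (?a - ?b)" using Y' by (auto simp: separated_def)
      then have "2^2 \<le> (norm (?a - ?b))^2" by (intro power_mono) auto
      also have "\<dots> = 4 * (h^2 + r^2 - 2 * h * r * u$1)"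
        using u1 unfolding power2_norm_eq_inner
        by (simp add: inner_diff inner_commute inner_axis_axis inner_axis norm_eq_1 power2_eq_square algebra_simps)
      finally show ?thesis by simp
    qed
    show "cell24 \<inter> {x. u \<bullet> x \<le> r} \<subseteq> origin_cell (T ` Y)"
    proof
      fix z assume z: "z \<in> cell24 \<inter> {x. u \<bullet> x \<le> r}"
      have "\<bar>z$1\<bar> \<le> 1" using z unfolding cell24_def by blast
      then show "z \<in> origin_cell (T ` Y)"
        using z h(1) norm_cell24[of z] by (intro in_cell) (auto simp: cell24_eq)
    qed
    show "frustum t \<inter> {x. u \<bullet> x \<le> r} \<subseteq> origin_cell (T ` Y)" if "t \<le> 13/40" "1 + t \<le> h" for t
    proof
      fix z assume z: "z \<in> frustum t \<inter> {x. u \<bullet> x \<le> r}"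
      then have "z$1 \<le> 1 + t" by (simp add: frustum_def)
      then show "z \<in> origin_cell (T ` Y)"
        using z that norm_frustum[of z t] frustum_hurwitz[of z t] by (intro in_cell) auto
    qed
  qed
  then have "exceeds_8 (T ` origin_cell Y)" by (simp add: origin_cell_image[OF orth])
  then show ?thesis by (rule exceeds_8_orthogonal[OF orth])
qed

text \<open>An active neighbour in direction \<open>w\<close> may exist, but then at a distance
  above 2; either way the pyramid over that facet is free up to a positive height.\<close>

lemma missing_root:
  assumes Y: "separated Y" and dirs: "\<And>y. y \<in> Y \<Longrightarrow> norm y < 2 * sqrt 2 \<Longrightarrow> sgn y \<in> hurwitz_units"
    and w: "w \<in> hurwitz_units" "2 *\<^sub>R w \<notin> Y"
  shows "exceeds_8 (origin_cell Y)"
proof -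
  obtain T where T: "hurwitz_symmetry T" and Tw: "T w = axis 1 1" using hurwitz_transitive[OF w(1)] .
  have orth: "orthogonal_transformation T" and TW: "T ` hurwitz_units = hurwitz_units"
    using T by (auto simp: hurwitz_symmetry_def)
  have inj: "inj T" using orth by (rule orthogonal_transformation_inj)
  have Y': "separated (T ` Y)" using orth Y by (rule separated_image)
  have dirs': "sgn y \<in> hurwitz_units" if "y \<in> T ` Y" "norm y < 2 * sqrt 2" for y
    using that dirs TW orth by (auto simp: sgn_orthogonal orthogonal_transformation_norm)
  obtain h where h: "1 \<le> h" "h \<le> sqrt 2" "h < sqrt 2 \<longrightarrow> (2 * h) *\<^sub>R axis 1 1 \<in> T ` Y"
    "\<forall>y\<in>T ` Y. norm y < 2 * sqrt 2 \<longrightarrow> sgn y = axis 1 1 \<longrightarrow> norm y = 2 * h"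
    by (rule axis_distance[OF Y'])
  have "h \<noteq> 1"
  proof
    assume "h = 1"
    then have "2 *\<^sub>R axis 1 1 \<in> T ` Y" using h(3) by simp
    then obtain y where y: "y \<in> Y" "T y = 2 *\<^sub>R T w" unfolding Tw by force
    have "T (2 *\<^sub>R w) = 2 *\<^sub>R T w" using orth by (simp add: linear_cmul orthogonal_transformation_linear)
    then have "y = 2 *\<^sub>R w" using y(2) inj by (metis injD)
    then show False using y(1) w(2) by simp
  qed
  then have h1: "1 < h" using h(1) by simp
  have in_cell: "z \<in> origin_cell (T ` Y)"
    if z: "norm z \<le> sqrt 2" "z$1 \<le> h" "\<And>w. w \<in> hurwitz_units \<Longrightarrow> w \<noteq> axis 1 1 \<Longrightarrow> z \<bullet> w \<le> 1" for z
  proof -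
    have "z \<bullet> y \<le> (norm y)^2 / 2" if y: "y \<in> T ` Y" for y
    proof (cases "norm y < 2 * sqrt 2")
      case False then show ?thesis using z(1) by (intro inner_inactive) auto
    next
      case True
      have "2 \<le> norm y" using Y' y by (auto simp: separated_def)
      have "z \<bullet> sgn y \<le> norm y / 2"
      proof (cases "sgn y = axis 1 1")
        case True
        then have "norm y = 2 * h" using h(4) y \<open>norm y < 2 * sqrt 2\<close> by blast
        then show ?thesis using True z(2) by (simp add: inner_axis)
      next
        case False
        then show ?thesis using z(3)[OF dirs'[OF y True]] \<open>2 \<le> norm y\<close> by simp
      qed
      then show ?thesis by (rule inner_active)
    qed
    then show ?thesis by (simp add: origin_cell_def)
  qed
  define t where "t = min (13/40) (h - 1)"
  have t: "0 < t" "t \<le> 13/40" "1 + t \<le> h" using h1 unfolding t_def by linarith+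
  have "exceeds_8 (origin_cell (T ` Y))"
  \<comment> \<open>With \<open>u = 0\<close> the tail condition is vacuous and the half frustum is
    the whole frustum.\<close>
  proof (rule exceeds_8_no_loss[where u = 0 and t = t])
    show "cell24 \<subseteq> origin_cell (T ` Y)"
    proof
      fix z assume z: "z \<in> cell24"
      have "\<bar>z$1\<bar> \<le> 1" using z unfolding cell24_def by blast
      then show "z \<in> origin_cell (T ` Y)"
        using z h1 norm_cell24[of z] by (intro in_cell) (auto simp: cell24_eq)
    qed
    show "half_frustum 0 t \<subseteq> origin_cell (T ` Y)"
    proof
      fix z assume "z \<in> half_frustum 0 t"
      then have z: "z \<in> frustum t" by (simp add: half_frustum_def)
      then have "z$1 \<le> 1 + t" by (simp add: frustum_def)
      then show "z \<in> origin_cell (T ` Y)"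
        using z t norm_frustum[of z t] frustum_hurwitz[of z t] by (intro in_cell) auto
    qed
  qed (use t in auto)
  then have "exceeds_8 (T ` origin_cell Y)" by (simp add: origin_cell_image[OF orth])
  then show ?thesis by (rule exceeds_8_orthogonal[OF orth])
qed

lemma origin_cell_all_roots:
  assumes Y: "separated Y" and dirs: "\<And>y. y \<in> Y \<Longrightarrow> norm y < 2 * sqrt 2 \<Longrightarrow> sgn y \<in> hurwitz_units"
    and roots: "\<And>w. w \<in> hurwitz_units \<Longrightarrow> 2 *\<^sub>R w \<in> Y"
  shows "origin_cell Y = cell24"
proof (intro equalityI subsetI)
  fix z assume z: "z \<in> origin_cell Y"
  have "z \<bullet> w \<le> 1" if "w \<in> hurwitz_units" for w
  proof -
    have "z \<bullet> (2 *\<^sub>R w) \<le> (norm (2 *\<^sub>R w))^2 / 2" using z roots[OF that] unfolding origin_cell_def by blast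
    then show ?thesis using norm_hurwitz_unit[OF that] by simp
  qed
  then show "z \<in> cell24" by (simp add: cell24_eq)
next
  fix z assume z: "z \<in> cell24"
  have "z \<bullet> y \<le> (norm y)^2 / 2" if y: "y \<in> Y" for y
  proof (cases "norm y < 2 * sqrt 2")
    case False then show ?thesis using norm_cell24[OF z] by (intro inner_inactive) auto
  next
    case True
    have "2 \<le> norm y" using Y y by (auto simp: separated_def)
    moreover have "z \<bullet> sgn y \<le> 1" using z dirs[OF y True] by (simp add: cell24_eq)
    ultimately show ?thesis by (intro inner_active) simp
  qed
  then show "z \<in> origin_cell Y" by (simp add: origin_cell_def)
qed

section \<open>Root coordinates\<close>

text \<open>\<open>{\<plusminus>e\<^sub>1 \<plusminus> e\<^sub>2, \<plusminus>e\<^sub>3 \<plusminus> e\<^sub>4}\<close> contains an orthogonal frame of \<open>D\<^sub>4\<close> roots; in its coordinates the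
  root directions become the Hurwitz units.\<close>

definition root_frame :: "real^4 \<Rightarrow> real^4" where
  "root_frame x = vector [(x$1 + x$2) / sqrt 2, (x$1 - x$2) / sqrt 2, (x$3 + x$4) / sqrt 2, (x$3 - x$4) / sqrt 2]"

lemma root_frame_root_frame [simp]: "root_frame (root_frame x) = x"
  by (simp add: vec_eq_4 root_frame_def add_divide_distrib diff_divide_distrib)

lemma orthogonal_transformation_root_frame: "orthogonal_transformation root_frame"
proof -
  have "root_frame v \<bullet> root_frame w = v \<bullet> w" for v w
  proof -
    have s: "(a / sqrt 2) * (b / sqrt 2) = a * b / 2" for a b :: real by simp
    show ?thesis by (simp add: inner_vec_def sum_4 root_frame_def s) (simp add: field_simps)
  qed
  moreover have "linear root_frame"
    by (intro linearI) (simp_all add: vec_eq_4 root_frame_def add_divide_distrib diff_divide_distrib algebra_simps)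
  ultimately show ?thesis by (simp add: orthogonal_transformation_def)
qed

lemma D4_roots_iff:
  "\<alpha> \<in> D4_roots \<longleftrightarrow> (\<exists>s t i j. (s = 1 \<or> s = -1) \<and> (t = 1 \<or> t = -1) \<and> i \<noteq> j \<and> \<alpha> = s *\<^sub>R axis i 1 + t *\<^sub>R axis j 1)"
  (is "_ \<longleftrightarrow> ?R")
proof
  assume "\<alpha> \<in> D4_roots"
  then obtain s t i j where a: "\<alpha> = s *\<^sub>R axis i 1 + t *\<^sub>R axis j 1" "s \<in> {1, -1}" "t \<in> {1, -1}" "i < j"
    unfolding D4_roots_def by blast
  then have "s = 1 \<or> s = -1" "t = 1 \<or> t = -1" "i \<noteq> j" by auto
  then show ?R using a(1) by blast
next
  assume ?R
  then obtain s t i j where a: "s = 1 \<or> s = -1" "t = 1 \<or> t = -1" "i \<noteq> j" "\<alpha> = s *\<^sub>R axis i 1 + t *\<^sub>R axis j 1"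
    by blast
  have I: "s *\<^sub>R axis i 1 + t *\<^sub>R axis j 1 \<in> D4_roots" if "s = 1 \<or> s = -1" "t = 1 \<or> t = -1" "i < j" for s t :: real and i j :: 4
    using that unfolding D4_roots_def by blast
  show "\<alpha> \<in> D4_roots"
  proof (cases "i < j")
    case True then show ?thesis using I[OF a(1,2)] a(4) by simp
  next
    case False
    then have "j < i" using a(3) by simp
    then show ?thesis using I[OF a(2,1)] a(4) by (simp add: add.commute)
  qed
qed

lemma root_frame_root:
  assumes "\<alpha> \<in> D4_roots"
  shows "root_frame (\<alpha> /\<^sub>R sqrt 2) \<in> hurwitz_units"
proof -
  obtain s t i j where a: "s = 1 \<or> s = -1" "t = 1 \<or> t = -1" "i \<noteq> j" "\<alpha> = s *\<^sub>R axis i 1 + t *\<^sub>R axis j 1"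
    using assms unfolding D4_roots_iff by blast
  have "root_frame (\<alpha> /\<^sub>R sqrt 2) = vector [(\<alpha>$1 + \<alpha>$2) / 2, (\<alpha>$1 - \<alpha>$2) / 2, (\<alpha>$3 + \<alpha>$4) / 2, (\<alpha>$3 - \<alpha>$4) / 2]"
  proof -
    have "inverse (sqrt 2) * a / sqrt 2 = a / 2" for a :: real by (simp add: field_simps)
    then show ?thesis by (simp add: vec_eq_4 root_frame_def flip: distrib_left right_diff_distrib)
  qed
  moreover have "vector [(\<alpha>$1 + \<alpha>$2) / 2, (\<alpha>$1 - \<alpha>$2) / 2, (\<alpha>$3 + \<alpha>$4) / 2, (\<alpha>$3 - \<alpha>$4) / 2] \<in> hurwitz_units"
    (is "?v \<in> _")
  proof -
    have "i \<noteq> j \<longrightarrow> ?v \<in> {axis 1 1, axis 1 (-1), axis 2 1, axis 2 (-1), axis 3 1, axis 3 (-1), axis 4 1, axis 4 (-1)} \<or>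
      (\<forall>i. ?v$i = 1/2 \<or> ?v$i = -1/2)"
      unfolding a(4) forall_4
      by (cases rule: four_cases[of i]; cases rule: four_cases[of j]; rule disjE[OF a(1)]; rule disjE[OF a(2)];
        simp add: vec_eq_4 axis_def)
    then show ?thesis using a(3) axis_in_hurwitz half_in_hurwitz by auto
  qed
  ultimately show ?thesis by simp
qed

lemma root_frame_hurwitz:
  assumes "w \<in> hurwitz_units"
  shows "sqrt 2 *\<^sub>R root_frame w \<in> D4_roots"
proof -
  have q: "sqrt 2 *\<^sub>R root_frame w = vector [w$1 + w$2, w$1 - w$2, w$3 + w$4, w$3 - w$4]"
    by (simp add: vec_eq_4 root_frame_def)
  have I: "v \<in> D4_roots" if "s = 1 \<or> s = -1" "t = 1 \<or> t = -1" "i \<noteq> j" "v = s *\<^sub>R axis i 1 + t *\<^sub>R axis j 1" for v s t i j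
    using that unfolding D4_roots_iff by blast
  show ?thesis
    using assms
  proof (cases rule: hurwitz_units_cases)
    case (1 i s)
    note s = 1
    have ms: "- s = 1 \<or> - s = -1" using s(1) by auto
    show ?thesis
    proof (cases rule: four_cases[of i])
      case 1
      show ?thesis unfolding q unfolding s(2) 1
        by (rule I[OF s(1) s(1), of 1 2]) (simp_all add: vec_eq_4 axis_def)
    next
      case 2
      show ?thesis unfolding q unfolding s(2) 2
        by (rule I[OF s(1) ms, of 1 2]) (simp_all add: vec_eq_4 axis_def)
    next
      case 3
      show ?thesis unfolding q unfolding s(2) 3
        by (rule I[OF s(1) s(1), of 3 4]) (simp_all add: vec_eq_4 axis_def)
    next
      case 4
      show ?thesis unfolding q unfolding s(2) 4
        by (rule I[OF s(1) ms, of 3 4]) (simp_all add: vec_eq_4 axis_def)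
    qed
  next
    case 2
    have two: "2 * w$i = 1 \<or> 2 * w$i = -1" for i using 2[of i] by argo
    have ne: "(if w$1 = w$2 then 1 else 2) \<noteq> (if w$3 = w$4 then 3 else 4 :: 4)" by auto
    have op: "w$j = - w$i" if "w$i \<noteq> w$j" for i j using 2[of i] 2[of j] that by argo
    show ?thesis
    proof (rule I[OF two[of 1] two[of 3] ne])
      show "sqrt 2 *\<^sub>R root_frame w = (2 * w$1) *\<^sub>R axis (if w$1 = w$2 then 1 else 2) 1 + (2 * w$3) *\<^sub>R axis (if w$3 = w$4 then 3 else 4) 1"
        unfolding q using op[of 1 2] op[of 3 4]
        by (cases "w$1 = w$2"; cases "w$3 = w$4") (simp_all add: vec_eq_4 axis_def)
    qed
  qed
qed

lemma root_frame_in_hurwitz_iff: "root_frame x \<in> hurwitz_units \<longleftrightarrow> x \<in> D4_root_directions"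
proof
  assume "root_frame x \<in> hurwitz_units"
  then have "sqrt 2 *\<^sub>R root_frame (root_frame x) \<in> D4_roots" by (rule root_frame_hurwitz)
  then have "sqrt 2 *\<^sub>R x \<in> D4_roots" by simp
  moreover have "x = (sqrt 2 *\<^sub>R x) /\<^sub>R sqrt 2" by simp
  ultimately show "x \<in> D4_root_directions" unfolding D4_root_directions_def by (rule rev_image_eqI)
next
  assume "x \<in> D4_root_directions"
  then show "root_frame x \<in> hurwitz_units" unfolding D4_root_directions_def using root_frame_root by blast
qed

lemma finite_D4_root_directions: "finite D4_root_directions"
proof -
  have "D4_root_directions \<subseteq> root_frame ` hurwitz_units"
  proof
    fix x assume "x \<in> D4_root_directions"
    then have "root_frame x \<in> hurwitz_units" by (simp add: root_frame_in_hurwitz_iff)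
    then have "root_frame (root_frame x) \<in> root_frame ` hurwitz_units" by (rule imageI)
    then show "x \<in> root_frame ` hurwitz_units" by simp
  qed
  then show ?thesis by (rule finite_subset) (simp add: finite_hurwitz_units)
qed

text \<open>Needed to see that in a rotated copy of the roots the deviating directions come in
  antipodal pairs.\<close>

lemma D4_root_directions_uminus: "x \<in> D4_root_directions \<Longrightarrow> - x \<in> D4_root_directions"
proof -
  assume "x \<in> D4_root_directions"
  then obtain \<alpha> where \<alpha>: "\<alpha> \<in> D4_roots" "x = \<alpha> /\<^sub>R sqrt 2" unfolding D4_root_directions_def by blast
  obtain s t i j where a: "s = 1 \<or> s = -1" "t = 1 \<or> t = -1" "i \<noteq> j" "\<alpha> = s *\<^sub>R axis i 1 + t *\<^sub>R axis j 1"
    using \<alpha>(1) unfolding D4_roots_iff by blast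
  have "- \<alpha> = (- s) *\<^sub>R axis i 1 + (- t) *\<^sub>R axis j 1" by (simp add: a(4))
  moreover have "- s = 1 \<or> - s = -1" "- t = 1 \<or> - t = -1" using a by auto
  ultimately have "- \<alpha> \<in> D4_roots" unfolding D4_roots_iff using a(3) by blast
  moreover have "- x = (- \<alpha>) /\<^sub>R sqrt 2" by (simp add: \<alpha>(2))
  ultimately show ?thesis unfolding D4_root_directions_def by blast
qed

lemma norm_D4_root_direction: "x \<in> D4_root_directions \<Longrightarrow> norm x = 1"
  using norm_hurwitz_unit[of "root_frame x"] orthogonal_transformation_norm[OF orthogonal_transformation_root_frame, of x]
  by (simp add: root_frame_in_hurwitz_iff)

section \<open>The Voronoi cell and its Lebesgue measure\<close>

lemma voronoi_cell_translate:
  "voronoi_cell C c = (+) c ` origin_cell ((\<lambda>y. y - c) ` (C - {c}))"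
proof -
  have iff: "norm z \<le> norm (z - y) \<longleftrightarrow> z \<bullet> y \<le> (norm y)^2 / 2" for z y :: "real^4"
  proof -
    have "norm z \<le> norm (z - y) \<longleftrightarrow> (norm z)^2 \<le> (norm (z - y))^2" by (simp add: power2_le_iff_abs_le)
    also have "(norm (z - y))^2 = (norm z)^2 - 2 * (z \<bullet> y) + (norm y)^2"
      by (simp add: power2_norm_eq_inner inner_diff inner_commute)
    finally show ?thesis by auto
  qed
  show ?thesis
  proof (intro set_eqI iffI)
    fix z assume z: "z \<in> voronoi_cell C c"
    have "z - c \<in> origin_cell ((\<lambda>y. y - c) ` (C - {c}))"
      unfolding origin_cell_def
    proof (intro CollectI ballI)
      fix y assume "y \<in> (\<lambda>y. y - c) ` (C - {c})"
      then have "c + y \<in> C" by auto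
      then have "norm (z - c) \<le> norm (z - (c + y))" using z by (simp add: voronoi_cell_def)
      then show "(z - c) \<bullet> y \<le> (norm y)^2 / 2" unfolding iff[symmetric] by (simp add: algebra_simps)
    qed
    then have "c + (z - c) \<in> (+) c ` origin_cell ((\<lambda>y. y - c) ` (C - {c}))" by (rule imageI)
    then show "z \<in> (+) c ` origin_cell ((\<lambda>y. y - c) ` (C - {c}))" by simp
  next
    fix z assume "z \<in> (+) c ` origin_cell ((\<lambda>y. y - c) ` (C - {c}))"
    then obtain x where x: "z = c + x" "x \<in> origin_cell ((\<lambda>y. y - c) ` (C - {c}))" by blast
    have "norm (z - c) \<le> norm (z - c')" if "c' \<in> C" for c'
    proof (cases "c' = c")
      case False
      then have "x \<bullet> (c' - c) \<le> (norm (c' - c))^2 / 2" using x(2) that unfolding origin_cell_def by blast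
      then have "norm x \<le> norm (x - (c' - c))" by (simp add: iff)
      then show ?thesis using x(1) by (simp add: algebra_simps)
    qed simp
    then show "z \<in> voronoi_cell C c" by (simp add: voronoi_cell_def)
  qed
qed

lemma closed_voronoi_cell: "closed (voronoi_cell C c)"
proof -
  have "voronoi_cell C c = (\<Inter>c'\<in>C. {z. norm (z - c) \<le> norm (z - c')})" by (auto simp: voronoi_cell_def)
  then show ?thesis by (simp add: closed_INT closed_Collect_le continuous_on_norm continuous_on_diff)
qed

lemma emeasure_exceeds_8:
  assumes "closed V" "exceeds_8 V"
  shows "8 < emeasure lborel V"
proof -
  obtain A where A: "A \<in> lmeasurable" "A \<subseteq> V" "8 < vol A" using assms(2) unfolding exceeds_8_def by blast
  have "(8::ennreal) = ennreal 8" by simp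
  also have "\<dots> < ennreal (vol A)" using A(3) by (subst ennreal_less_iff) auto
  also have "\<dots> = emeasure lebesgue A" using A(1) by (simp add: emeasure_eq_measure2)
  also have "\<dots> \<le> emeasure lebesgue V" using assms(1) A by (intro emeasure_mono) (auto simp: borel_closed)
  also have "\<dots> = emeasure lborel V" using assms(1) by (simp add: borel_closed)
  finally show ?thesis .
qed

theorem theorem1p1:
  fixes C :: "(real^4) set" and c :: "real^4"
  assumes "unit_ball_packing C"
    and "c \<in> C"
    and "\<exists>\<^sub>\<le>\<^sub>1 u. u \<in> active_directions C c \<and> u \<notin> D4_root_directions"
  shows "emeasure lborel (voronoi_cell C c) \<ge> 8 \<and>
    (emeasure lborel (voronoi_cell C c) = 8 \<longleftrightarrow>
       copy_of_sqrt2_D4_roots c (active_neighbours C c))"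
proof -
  define X where "X = (\<lambda>y. y - c) ` (C - {c})"
  define Y where "Y = root_frame ` X"
  let ?D = "D4_root_directions" and ?V = "voronoi_cell C c"
  note orth = orthogonal_transformation_root_frame
  have nf: "norm (root_frame x) = norm x" for x by (rule orthogonal_transformation_norm[OF orth])
  have X: "separated X"
    using assms(1,2) unfolding X_def separated_def unit_ball_packing_def by auto
  have Y: "separated Y" unfolding Y_def by (rule separated_image[OF orth X])
  have dirs: "active_directions C c = sgn ` {x \<in> X. norm x < 2 * sqrt 2}"
  proof -
    have "active_neighbours C c = (+) c ` {x \<in> X. norm x < 2 * sqrt 2}"
      unfolding active_neighbours_def X_def by (force simp: image_iff)
    then show ?thesis unfolding active_directions_def by (simp add: image_image sgn_div_norm)
  qed
  have active: "y \<in> active_neighbours C c \<longleftrightarrow> y - c \<in> X \<and> norm (y - c) < 2 * sqrt 2" for y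
    unfolding active_neighbours_def X_def by auto
  have V: "?V = (+) c ` origin_cell X" unfolding X_def by (rule voronoi_cell_translate)
  have oY: "origin_cell Y = root_frame ` origin_cell X" unfolding Y_def by (rule origin_cell_image[OF orth])
  have large: "8 < emeasure lborel ?V" if "exceeds_8 (origin_cell Y)"
  proof -
    have "exceeds_8 (origin_cell X)" using that unfolding oY by (rule exceeds_8_orthogonal[OF orth])
    then obtain A where A: "A \<in> lmeasurable" "A \<subseteq> origin_cell X" "8 < vol A" unfolding exceeds_8_def by blast
    have "exceeds_8 ?V"
      unfolding exceeds_8_def V
    proof (intro bexI conjI)
      show "(+) c ` A \<subseteq> (+) c ` origin_cell X" using A(2) by (rule image_mono)
      show "8 < vol ((+) c ` A)" using A(3) by (simp only: measure_translation)
      show "(+) c ` A \<in> lmeasurable" using A(1) by (rule measurable_translation)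
    qed
    then show ?thesis by (rule emeasure_exceeds_8[OF closed_voronoi_cell])
  qed
  have YX: "sgn (root_frame x) \<in> hurwitz_units \<longleftrightarrow> sgn x \<in> ?D" for x
    by (simp only: sgn_orthogonal[OF orth] root_frame_in_hurwitz_iff)
  \<comment> \<open>By \<open>same_direction_eq\<close> this says that the active neighbours, seen
    from \<open>c\<close>, are exactly the doubled root directions. It decides everything: it yields
    volume 8 and a copy of the roots, its failure yields more than 8, and any copy compatible with
    the hypothesis satisfies it.\<close>
  define good where "good \<longleftrightarrow> (\<forall>x\<in>X. norm x < 2 * sqrt 2 \<longrightarrow> sgn x \<in> ?D) \<and> (\<forall>d\<in>?D. 2 *\<^sub>R d \<in> X)"
  have roots2: "(2 *\<^sub>R (\<alpha> /\<^sub>R sqrt 2)) = sqrt 2 *\<^sub>R \<alpha>" for \<alpha> :: "real^4"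
  proof -
    have "2 * inverse (sqrt 2) = sqrt 2" by (simp add: field_simps)
    then show ?thesis by simp
  qed
  have good_eq: "emeasure lborel ?V = 8 \<and> copy_of_sqrt2_D4_roots c (active_neighbours C c)" if g: "good"
  proof
    have "origin_cell Y = cell24"
    proof (rule origin_cell_all_roots[OF Y])
      fix y assume "y \<in> Y" "norm y < 2 * sqrt 2"
      then show "sgn y \<in> hurwitz_units" using g unfolding Y_def good_def by (auto simp: nf YX)
    next
      fix w assume "w \<in> hurwitz_units"
      then have "root_frame w \<in> ?D" by (simp flip: root_frame_in_hurwitz_iff)
      then have "2 *\<^sub>R root_frame w \<in> X" using g by (simp add: good_def)
      then have "root_frame (2 *\<^sub>R root_frame w) \<in> Y" unfolding Y_def by (rule imageI)
      then show "2 *\<^sub>R w \<in> Y"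
        using orth by (simp add: linear_cmul orthogonal_transformation_linear)
    qed
    moreover have "root_frame ` origin_cell Y = origin_cell X" unfolding oY by (simp add: image_image)
    ultimately have "origin_cell X = root_frame ` cell24" by simp
    then have V': "?V = (+) c ` (root_frame ` cell24)" using V by simp
    have L: "root_frame ` cell24 \<in> lmeasurable" by (rule measurable_orthogonal_image[OF orth lmeasurable_cell24])
    have "vol ?V = 8"
      unfolding V' measure_translation measure_orthogonal_image[OF orth lmeasurable_cell24] by (rule vol_cell24)
    moreover have "?V \<in> lmeasurable" unfolding V' using L by (rule measurable_translation)
    ultimately have "emeasure lebesgue ?V = 8" by (simp add: emeasure_eq_measure2)
    then show "emeasure lborel ?V = 8" using closed_voronoi_cell[of C c] by (simp add: borel_closed)
    have "active_neighbours C c = (\<lambda>\<alpha>. c + sqrt 2 *\<^sub>R \<alpha>) ` D4_roots"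
    proof (intro set_eqI iffI)
      fix y assume "y \<in> active_neighbours C c"
      then have y: "y - c \<in> X" "norm (y - c) < 2 * sqrt 2" by (simp_all add: active)
      then have d: "sgn (y - c) \<in> ?D" using g by (simp add: good_def)
      then have "2 *\<^sub>R sgn (y - c) \<in> X" using g by (simp add: good_def)
      moreover have "norm (sgn (y - c)) = 1" using d by (rule norm_D4_root_direction)
      moreover have "(2::real) < 2 * sqrt 2" by simp
      moreover have "sgn (2 *\<^sub>R sgn (y - c)) = sgn (y - c)"
        using \<open>norm (sgn (y - c)) = 1\<close> by (simp add: sgn_scaleR sgn_div_norm[of "sgn (y - c)"])
      ultimately have "y - c = 2 *\<^sub>R sgn (y - c)"
        using same_direction_eq[OF X y(1), of "2 *\<^sub>R sgn (y - c)"] y(2) by simp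
      moreover obtain \<alpha> where "\<alpha> \<in> D4_roots" "sgn (y - c) = \<alpha> /\<^sub>R sqrt 2"
        using d unfolding D4_root_directions_def by blast
      ultimately have "y - c = sqrt 2 *\<^sub>R \<alpha>" by (simp only: roots2)
      then have "y = c + sqrt 2 *\<^sub>R \<alpha>" by (simp add: algebra_simps)
      then show "y \<in> (\<lambda>\<alpha>. c + sqrt 2 *\<^sub>R \<alpha>) ` D4_roots" using \<open>\<alpha> \<in> D4_roots\<close> by blast
    next
      fix y assume "y \<in> (\<lambda>\<alpha>. c + sqrt 2 *\<^sub>R \<alpha>) ` D4_roots"
      then obtain \<alpha> where \<alpha>: "\<alpha> \<in> D4_roots" "y = c + sqrt 2 *\<^sub>R \<alpha>" by blast
      then have d: "\<alpha> /\<^sub>R sqrt 2 \<in> ?D" unfolding D4_root_directions_def by blast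
      have yc: "y - c = 2 *\<^sub>R (\<alpha> /\<^sub>R sqrt 2)" unfolding roots2 \<alpha>(2) by simp
      have "norm (y - c) = 2" unfolding yc using norm_D4_root_direction[OF d] by simp
      moreover have "y - c \<in> X" unfolding yc using g d unfolding good_def by blast
      ultimately show "y \<in> active_neighbours C c" by (simp add: active)
    qed
    then show "copy_of_sqrt2_D4_roots c (active_neighbours C c)"
      unfolding copy_of_sqrt2_D4_roots_def using orthogonal_transformation_id by (intro exI[of _ "\<lambda>x. x"]) simp
  qed
  have not_good: "exceeds_8 (origin_cell Y)" if ng: "\<not> good"
  proof (cases "\<exists>x\<in>X. norm x < 2 * sqrt 2 \<and> sgn x \<notin> ?D")
    case True
    then obtain x0 where x0: "x0 \<in> X" "norm x0 < 2 * sqrt 2" "sgn x0 \<notin> ?D" by blast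
    have only: "sgn x \<in> ?D \<or> sgn x = sgn x0" if "x \<in> X" "norm x < 2 * sqrt 2" for x
      using assms(3) x0 that unfolding dirs Uniq_def by blast
    show ?thesis
    proof (rule one_deviating_direction[OF Y])
      show "root_frame x0 \<in> Y" using x0(1) by (simp add: Y_def)
      show "norm (root_frame x0) < 2 * sqrt 2" "sgn (root_frame x0) \<notin> hurwitz_units" using x0 by (simp_all add: nf YX)
      fix y assume "y \<in> Y" "norm y < 2 * sqrt 2"
      then obtain x where x: "x \<in> X" "y = root_frame x" "norm x < 2 * sqrt 2" unfolding Y_def by (auto simp: nf)
      then show "sgn y \<in> hurwitz_units \<or> sgn y = sgn (root_frame x0)"
        using only[OF x(1,3)] unfolding x(2) sgn_orthogonal[OF orth] by (auto simp: root_frame_in_hurwitz_iff)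
    qed
  next
    case False
    then obtain d where d: "d \<in> ?D" "2 *\<^sub>R d \<notin> X" using ng unfolding good_def by blast
    show ?thesis
    proof (rule missing_root[OF Y])
      show "root_frame d \<in> hurwitz_units" using d(1) by (simp add: root_frame_in_hurwitz_iff)
      show "2 *\<^sub>R root_frame d \<notin> Y"
      proof
        assume "2 *\<^sub>R root_frame d \<in> Y"
        then have "root_frame (2 *\<^sub>R root_frame d) \<in> root_frame ` Y" by (rule imageI)
        then have "2 *\<^sub>R d \<in> X"
          using orth unfolding Y_def by (simp add: image_image linear_cmul orthogonal_transformation_linear)
        then show False using d(2) by simp
      qed
      fix y assume "y \<in> Y" "norm y < 2 * sqrt 2"
      then show "sgn y \<in> hurwitz_units" using False unfolding Y_def by (auto simp: nf YX)
    qed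
  qed
  \<comment> \<open>A copy may be rotated by any \<open>T\<close>. A deviating direction
    \<open>T d\<close> would bring along the distinct deviating direction \<open>- T d\<close>, so
    at most one deviation means none, and \<open>T\<close> permutes the root directions.\<close>
  have copy_good: "good" if copy: "copy_of_sqrt2_D4_roots c (active_neighbours C c)"
  proof -
    obtain T where T: "orthogonal_transformation T" "active_neighbours C c = (\<lambda>\<alpha>. c + sqrt 2 *\<^sub>R T \<alpha>) ` D4_roots"
      using copy unfolding copy_of_sqrt2_D4_roots_def by blast
    have lin: "linear T" using T(1) by (rule orthogonal_transformation_linear)
    have act: "{x \<in> X. norm x < 2 * sqrt 2} = (\<lambda>d. 2 *\<^sub>R T d) ` ?D"
    proof -
      have "{x \<in> X. norm x < 2 * sqrt 2} = (\<lambda>y. y - c) ` active_neighbours C c"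
      proof (intro set_eqI iffI)
        fix x assume "x \<in> {x \<in> X. norm x < 2 * sqrt 2}"
        then have "c + x \<in> active_neighbours C c" by (simp add: active)
        then have "c + x - c \<in> (\<lambda>y. y - c) ` active_neighbours C c" by (rule imageI)
        then show "x \<in> (\<lambda>y. y - c) ` active_neighbours C c" by simp
      qed (auto simp: active)
      also have "\<dots> = (\<lambda>\<alpha>. 2 *\<^sub>R T (\<alpha> /\<^sub>R sqrt 2)) ` D4_roots"
        unfolding T(2) image_image linear_cmul[OF lin] roots2 by simp
      finally show ?thesis by (simp add: D4_root_directions_def image_image)
    qed
    have sgnT: "sgn (2 *\<^sub>R T d) = T d" if "d \<in> ?D" for d
      using norm_D4_root_direction[OF that] orthogonal_transformation_norm[OF T(1), of d]
      by (simp add: sgn_scaleR sgn_div_norm)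
    have dirT: "active_directions C c = T ` ?D"
      unfolding dirs act image_image using sgnT by (intro image_cong) auto
    have sub: "T ` ?D \<subseteq> ?D"
    proof (rule ccontr)
      assume "\<not> T ` ?D \<subseteq> ?D"
      then obtain d where d: "d \<in> ?D" "T d \<notin> ?D" by blast
      have "T (- d) \<in> T ` ?D" using D4_root_directions_uminus[OF d(1)] by (rule imageI)
      then have "- T d \<in> T ` ?D" by (simp add: linear_neg[OF lin])
      moreover have "- T d \<notin> ?D" using d(2) D4_root_directions_uminus[of "- T d"] by auto
      ultimately have "- T d = T d" using assms(3) d unfolding dirT Uniq_def by blast
      then have "T d + T d = 0" by (metis add.left_inverse)
      then have "2 *\<^sub>R T d = 0" by (simp only: scaleR_2)
      then have "T d = 0" by simp
      then show False
        using norm_D4_root_direction[OF d(1)] orthogonal_transformation_norm[OF T(1), of d] by simp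
    qed
    have "T ` ?D = ?D"
      by (intro card_subset_eq finite_D4_root_directions sub card_image)
        (meson T(1) inj_on_subset orthogonal_transformation_inj subset_UNIV)
    moreover have "(\<lambda>d. 2 *\<^sub>R T d) ` ?D = (\<lambda>d. 2 *\<^sub>R d) ` T ` ?D" by (simp add: image_image)
    ultimately have "{x \<in> X. norm x < 2 * sqrt 2} = (\<lambda>d. 2 *\<^sub>R d) ` ?D" unfolding act by simp
    then have "\<forall>d\<in>?D. 2 *\<^sub>R d \<in> X" by blast
    moreover have "sgn x \<in> ?D" if "x \<in> X" "norm x < 2 * sqrt 2" for x
    proof -
      have "sgn x \<in> active_directions C c" using that unfolding dirs by blast
      then show ?thesis using sub unfolding dirT by blast
    qed
    ultimately show ?thesis unfolding good_def by blast
  qed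
  show ?thesis
  proof (cases good)
    case True
    then show ?thesis using good_eq by simp
  next
    case False
    then have "8 < emeasure lborel ?V" using large not_good by blast
    moreover have "\<not> copy_of_sqrt2_D4_roots c (active_neighbours C c)" using False copy_good by blast
    ultimately show ?thesis by auto
  qed
qed

end
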